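(* Let $\mathfrak{L}=\mathfrak{L}(\mathfrak{g},\sigma)$ be a twisted loop algebra with its standard Lie bialgebra cobracket $\delta_\circ$, and let $\mathfrak{D}=\mathfrak{C}\dotplus\mathfrak{W}^\circ$ be the standard Manin triple (see context). For $\mathtt{t}\in\wedge^2\mathfrak{L}\cong\wedge^2\mathfrak{C}$, $\mathtt{t}=\sum_{i=1}^na_i\otimes b_i$ with $a_i,b_i\in\mathfrak{C}$, put $f_{\mathtt{t}}(w)=\sum_{i=1}^nF(w,a_i)b_i$ for $w\in\mathfrak{W}^\circ$, $\mathfrak{W}_{\mathtt{t}}:=\{w+f_{\mathtt{t}}(w)\,|\,w\in\mathfrak{W}^\circ\}\subset\mathfrak{D}$ and $\delta_{\mathtt{t}}=\delta_\circ+\partial_{\mathtt{t}}$. Then $\mathfrak{W}_{\mathtt{t}}$ is a Lie subalgebra of $\mathfrak{D}$ if and only if $(\mathfrak{L},\delta_{\mathtt{t}})$ is a Lie bialgebra. Moreover, the map $$\{\mathtt{t}\in\wedge^2\mathfrak{L}\,|\,(\mathfrak{L},\delta_{\mathtt{t}})\text{ is a Lie bialgebra}\}\longrightarrow\mathsf{MT}(\mathfrak{D},\mathfrak{C};\mathfrak{W}^\circ),\qquad\mathtt{t}\mapsto\mathfrak{W}_{\mathtt{t}},$$ is a bijection, and (for such $\mathtt{t}$) the cobracket $\delta_{\mathtt{t}}:\mathfrak{L}\to\wedge^2\mathfrak{L}$ is determined by the Manin triple $\mathfrak{D}=\mathfrak{C}\dotplus\mathfrak{W}_{\mathtt{t}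}$.
   Context: Loop algebras. $\mathfrak{g}$ is a finite dimensional simple complex Lie algebra with Killing form $\kappa$, $\sigma$ an automorphism of $\mathfrak{g}$ of order $m$, $\varepsilon=\exp(2\pi i/m)$, $\mathfrak{g}_k=\{a\,|\,\sigma(a)=\varepsilon^ka\}$ and $\mathfrak{g}_k^\ddagger=\{a\,|\,\sigma(a)=\varepsilon^{-k}a\}$. $\mathfrak{L}=\bigoplus_{k}\mathfrak{g}_kz^k$, $\mathfrak{L}^\ddagger=\mathfrak{L}(\mathfrak{g},\sigma^{-1})=\bigoplus_k\mathfrak{g}_k^\ddagger z^k$ (subalgebras of $\mathfrak{g}[z,z^{-1}]$), with forms $B$, resp. $B^\ddagger$, both given by $(az^k,bz^l)\mapsto\kappa(a,b)\delta_{k+l,0}$. The map $\mathfrak{L}\to\mathfrak{L}^\ddagger$, $(az^k)^\ddagger=az^{-k}$, is a Lie algebra isomorphism and an isometry. $\mathfrak{L}_+$ denotes $\mathfrak{L}$ written in a variable $z_+$, $\mathfrak{L}_-$ denotes $\mathfrak{L}^\ddagger$ written in a variable $z_-$, and $\mathfrak{D}:=\mathfrak{L}_+\times\mathfrak{L}_-$ carries the form $F((f_+,f_-),(g_+,g_-))=B(f_+,g_+)-B^\ddagger(f_-,g_-)$. Let $\mathfrak{C}:=\{(f,f^\ddagger)\,|\,f\in\mathfrak{L}\}$, identified with $\mathfrak{L}$ via $f\mapsto(f,f^\ddagger)$. The Lie algebra $\mathfrak{g}_0$ is non-zero and reductive; fix a triangular decomposition $\mathfrak{g}_0=\mathfrak{g}_0^+\oplus\mathfrak{h}\oplus\mathfrak{g}_0^-$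 ($\mathfrak{h}$ a Cartan subalgebra of $\mathfrak{g}_0$). Put $\mathfrak{B}_+=(\mathfrak{g}_0^+\oplus\mathfrak{h})\oplus\bigoplus_{k\ge1}\mathfrak{g}_kz_+^k$, $\mathfrak{B}_-=(\mathfrak{g}_0^-\oplus\mathfrak{h})\oplus\bigoplus_{k\ge1}\mathfrak{g}_k^\ddagger z_-^k$, let $\pi_\pm:\mathfrak{B}_\pm\to\mathfrak{h}$ be the canonical projections and $\mathfrak{W}^\circ=\{(f_+,f_-)\in\mathfrak{B}_+\times\mathfrak{B}_-\,|\,\pi_+(f_+)+\pi_-(f_-)=0\}$. Then $\mathfrak{D}=\mathfrak{C}\dotplus\mathfrak{W}^\circ$ is a Manin triple, and the standard Lie bialgebra cobracket $\delta_\circ:\mathfrak{L}\to\wedge^2\mathfrak{L}$ is the (unique) Lie bialgebra cobracket on $\mathfrak{L}\cong\mathfrak{C}$ determined by it. Lie bialgebras. $\wedge^2V\subset V\otimes V$ is the space of skew-symmetric tensors. For $a$ in a Lie algebra $\mathfrak{r}$, $\mathtt{t}\in\mathfrak{r}^{\otimes2}$: $\partial_{\mathtt{t}}(a)=[a\otimes1+1\otimes a,\mathtt{t}]$. A Lie bialgebra is a pair $(\mathfrak{r},\delta)$ with $\delta:\mathfrak{r}\to\wedge^2\mathfrak{r}$ linear, $\delta([a,b])=[a\otimes1+1\otimes a,\delta(b)]-[b\otimes1+1\otimes b,\delta(a)]$ and $\mathrm{alt}((\delta\otimes\mathbb{1})\circ\delta)=0$, where $\mathrm{alt}(a\otimes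 b\otimes c)=a\otimes b\otimes c+c\otimes a\otimes b+b\otimes c\otimes a$. Manin triples. A Manin triple $((\mathfrak{R},F),\mathfrak{R}_+,\mathfrak{R}_-)$, also written $\mathfrak{R}=\mathfrak{R}_+\dotplus\mathfrak{R}_-$, is a Lie algebra with a symmetric invariant non-degenerate bilinear form $F$ and Lie subalgebras $\mathfrak{R}_\pm\subseteq\mathfrak{R}_\pm^\perp$ with $\mathfrak{R}=\mathfrak{R}_+\dotplus\mathfrak{R}_-$ (direct sum of vector spaces). A cobracket $\delta$ on $\mathfrak{R}_+$ is determined by it if $F(\delta(a),b_1\otimes b_2)=F(a,[b_1,b_2])$ for all $a\in\mathfrak{R}_+$, $b_1,b_2\in\mathfrak{R}_-$, where $F(a_1\otimes a_2,b_1\otimes b_2)=F(a_1,b_1)F(a_2,b_2)$. Subspaces $W'\asymp W''$ are commensurable if $\dim((W'+W'')/(W'\cap W''))<\infty$. $\mathsf{MT}(\mathfrak{R},\mathfrak{R}_+;\mathfrak{R}_-)$ is the set of $\mathfrak{W}\subset\mathfrak{R}$ such that $(\mathfrak{R},\mathfrak{R}_+,\mathfrak{W})$ is a Manin triple (with the form $F$) and $\mathfrak{W}\asymp\mathfrak{R}_-$. *)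

theory Defs
  imports Complex_Main "HOL-Library.Poly_Mapping" "HOL-Library.Product_Plus"
begin

section \<open>Complex vector spaces\<close>

class scaleC =
  fixes scaleC :: "complex \<Rightarrow> 'a \<Rightarrow> 'a" (infixr "*\<^sub>C" 75)

class complex_vector = scaleC + ab_group_add +
  assumes scaleC_add_right: "a *\<^sub>C (x + y) = a *\<^sub>C x + a *\<^sub>C y"
    and scaleC_add_left: "(a + b) *\<^sub>C x = a *\<^sub>C x + b *\<^sub>C x"
    and scaleC_scaleC: "a *\<^sub>C b *\<^sub>C x = (a * b) *\<^sub>C x"
    and scaleC_one: "1 *\<^sub>C x = x"

global_interpretation complex_vector:
  vector_space "scaleC :: complex \<Rightarrow> 'a \<Rightarrow> 'a :: complex_vector"
  by unfold_locales (simp_all add: scaleC_add_right scaleC_add_left scaleC_scaleC scaleC_one)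

global_interpretation complex_vector_pair:
  vector_space_pair "scaleC :: complex \<Rightarrow> 'a \<Rightarrow> 'a :: complex_vector"
    "scaleC :: complex \<Rightarrow> 'b \<Rightarrow> 'b :: complex_vector"
  by unfold_locales

abbreviation cspan :: "'a::complex_vector set \<Rightarrow> 'a set" where
  "cspan \<equiv> complex_vector.span"

abbreviation csubspace :: "'a::complex_vector set \<Rightarrow> bool" where
  "csubspace \<equiv> complex_vector.subspace"

abbreviation clinear :: "('a::complex_vector \<Rightarrow> 'b::complex_vector) \<Rightarrow> bool" where
  "clinear \<equiv> Vector_Spaces.linear scaleC scaleC"

lemma clinearI:
  fixes f :: "'a::complex_vector \<Rightarrow> 'b::complex_vector"
  assumes "\<And>x y. f (x + y) = f x + f y" "\<And>c x. f (c *\<^sub>C x) = c *\<^sub>C f x"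
  shows "clinear f"
  unfolding Vector_Spaces.linear_iff
  using assms complex_vector.vector_space_axioms[where 'a = 'a]
    complex_vector.vector_space_axioms[where 'a = 'b] by blast

instantiation complex :: complex_vector
begin
definition scaleC_complex :: "complex \<Rightarrow> complex \<Rightarrow> complex" where
  "scaleC_complex = (*)"
instance
  by standard (simp_all add: scaleC_complex_def algebra_simps)
end

instantiation prod :: (complex_vector, complex_vector) complex_vector
begin
definition scaleC_prod :: "complex \<Rightarrow> 'a \<times> 'b \<Rightarrow> 'a \<times> 'b" where
  "scaleC_prod c p = (c *\<^sub>C fst p, c *\<^sub>C snd p)"
instance
  by standard (simp_all add: scaleC_prod_def scaleC_add_right scaleC_add_left scaleC_scaleC
      scaleC_one)
end

instantiation poly_mapping :: (type, complex_vector) complex_vector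
begin
lift_definition scaleC_poly_mapping :: "complex \<Rightarrow> ('a \<Rightarrow>\<^sub>0 'b) \<Rightarrow> ('a \<Rightarrow>\<^sub>0 'b)"
  is "\<lambda>c f x. c *\<^sub>C f x"
proof -
  fix c :: complex and f :: "'a \<Rightarrow> 'b"
  assume "finite {x. f x \<noteq> 0}"
  then show "finite {x. c *\<^sub>C f x \<noteq> 0}"
    by (rule rev_finite_subset) auto
qed
instance
  by standard (transfer; simp add: scaleC_add_right scaleC_add_left scaleC_scaleC scaleC_one)+
end

lemma lookup_scaleC: "Poly_Mapping.lookup (c *\<^sub>C f) x = c *\<^sub>C Poly_Mapping.lookup f x"
  by transfer simp

definition linear_on :: "'a::complex_vector set \<Rightarrow> ('a \<Rightarrow> 'b::complex_vector) \<Rightarrow> bool" where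
  "linear_on V f \<longleftrightarrow>
     (\<forall>x\<in>V. \<forall>y\<in>V. f (x + y) = f x + f y) \<and> (\<forall>c. \<forall>x\<in>V. f (c *\<^sub>C x) = c *\<^sub>C f x)"

definition bilinear_on ::
  "'a::complex_vector set \<Rightarrow> 'b::complex_vector set \<Rightarrow> ('a \<Rightarrow> 'b \<Rightarrow> 'c::complex_vector) \<Rightarrow> bool" where
  "bilinear_on V W \<beta> \<longleftrightarrow>
     (\<forall>y\<in>W. linear_on V (\<lambda>x. \<beta> x y)) \<and> (\<forall>x\<in>V. linear_on W (\<beta> x))"

definition finite_dimensional :: "'a::complex_vector set \<Rightarrow> bool" where
  "finite_dimensional V \<longleftrightarrow> (\<exists>S. finite S \<and> V = cspan S)"

text \<open>The condition on \<open>S\<close> says that the quotient of the sum by the intersection is spanned by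
  the classes of finitely many vectors, i.e. is finite-dimensional.\<close>

definition commensurable :: "'a::complex_vector set \<Rightarrow> 'a set \<Rightarrow> bool" where
  "commensurable W1 W2 \<longleftrightarrow> csubspace W1 \<and> csubspace W2 \<and>
     (\<exists>S. finite S \<and> {x + y | x y. x \<in> W1 \<and> y \<in> W2} = cspan (S \<union> (W1 \<inter> W2)))"

definition direct_sum :: "'a::complex_vector set \<Rightarrow> 'a set \<Rightarrow> 'a set \<Rightarrow> bool" where
  "direct_sum V V1 V2 \<longleftrightarrow>
     V = {x + y | x y. x \<in> V1 \<and> y \<in> V2} \<and> V1 \<inter> V2 = {0}"

text \<open>The value of the trace does not depend on the chosen basis when the space is
  finite-dimensional, which is the only case in which it is used.\<close>

definition trace_endo :: "('a::complex_vector \<Rightarrow> 'a) \<Rightarrow> complex" where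
  "trace_endo f =
     (let B = (SOME B. complex_vector.independent B \<and> cspan B = UNIV)
      in \<Sum>b\<in>B. complex_vector.representation B (f b) b)"


section \<open>Tensor products\<close>

text \<open>The tensor product of two spaces is the free vector space on pairs modulo the
  subspace spanned by the bilinearity relations.\<close>

abbreviation free_gen :: "'a \<Rightarrow> 'b \<Rightarrow> (('a \<times> 'b) \<Rightarrow>\<^sub>0 complex)" where
  "free_gen x y \<equiv> Poly_Mapping.single (x, y) 1"

definition tensor_relations :: "(('a::complex_vector \<times> 'b::complex_vector) \<Rightarrow>\<^sub>0 complex) set" where
  "tensor_relations =
     {free_gen (x + x') y - free_gen x y - free_gen x' y | x x' y. True} \<union>
     {free_gen x (y + y') - free_gen x y - free_gen x y' | x y y'. True} \<union>
     {free_gen (c *\<^sub>C x) y - c *\<^sub>C free_gen x y | c x y. True} \<union>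
     {free_gen x (c *\<^sub>C y) - c *\<^sub>C free_gen x y | c x y. True}"

definition tensor_rel ::
  "(('a::complex_vector \<times> 'b::complex_vector) \<Rightarrow>\<^sub>0 complex) \<Rightarrow> (('a \<times> 'b) \<Rightarrow>\<^sub>0 complex) \<Rightarrow> bool" where
  "tensor_rel f g \<longleftrightarrow> f - g \<in> cspan tensor_relations"

lemma tensor_rel_equivp:
  "equivp (tensor_rel :: (('a::complex_vector \<times> 'b::complex_vector) \<Rightarrow>\<^sub>0 complex) \<Rightarrow> _)"
proof (rule equivpI)
  show "reflp (tensor_rel :: (('a \<times> 'b) \<Rightarrow>\<^sub>0 complex) \<Rightarrow> _)"
    by (rule reflpI) (simp add: tensor_rel_def complex_vector.span_zero)
  show "symp (tensor_rel :: (('a \<times> 'b) \<Rightarrow>\<^sub>0 complex) \<Rightarrow> _)"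
    by (rule sympI) (metis complex_vector.span_neg minus_diff_eq tensor_rel_def)
  show "transp (tensor_rel :: (('a \<times> 'b) \<Rightarrow>\<^sub>0 complex) \<Rightarrow> _)"
  proof (rule transpI)
    fix f g h :: "('a \<times> 'b) \<Rightarrow>\<^sub>0 complex"
    assume "tensor_rel f g" "tensor_rel g h"
    then have "(f - g) + (g - h) \<in> cspan tensor_relations"
      unfolding tensor_rel_def by (rule complex_vector.span_add)
    then show "tensor_rel f h" by (simp add: tensor_rel_def)
  qed
qed

quotient_type (overloaded) ('a, 'b) tensor =
    "('a::complex_vector \<times> 'b::complex_vector) \<Rightarrow>\<^sub>0 complex" / tensor_rel
  by (rule tensor_rel_equivp)

instantiation tensor :: (complex_vector, complex_vector) complex_vector
begin

lift_definition zero_tensor :: "('a, 'b) tensor" is 0 .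

lift_definition plus_tensor :: "('a, 'b) tensor \<Rightarrow> ('a, 'b) tensor \<Rightarrow> ('a, 'b) tensor" is "(+)"
  unfolding tensor_rel_def by (simp only: add_diff_add complex_vector.span_add)

lift_definition uminus_tensor :: "('a, 'b) tensor \<Rightarrow> ('a, 'b) tensor" is uminus
  unfolding tensor_rel_def by (simp only: minus_diff_minus complex_vector.span_neg)

lift_definition minus_tensor :: "('a, 'b) tensor \<Rightarrow> ('a, 'b) tensor \<Rightarrow> ('a, 'b) tensor" is "(-)"
  unfolding tensor_rel_def
proof -
  fix f f' g g' :: "('a \<times> 'b) \<Rightarrow>\<^sub>0 complex"
  assume "f - f' \<in> cspan tensor_relations" "g - g' \<in> cspan tensor_relations"
  then have "(f - f') - (g - g') \<in> cspan tensor_relations"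
    by (rule complex_vector.span_diff)
  also have "(f - f') - (g - g') = (f - g) - (f' - g')" by (simp add: algebra_simps)
  finally show "(f - g) - (f' - g') \<in> cspan tensor_relations" .
qed

lift_definition scaleC_tensor :: "complex \<Rightarrow> ('a, 'b) tensor \<Rightarrow> ('a, 'b) tensor" is scaleC
  unfolding tensor_rel_def
  by (simp only: complex_vector.scale_right_diff_distrib[symmetric] complex_vector.span_scale)

instance
proof
  fix a b c :: "('a, 'b) tensor" and k l :: complex
  have refl: "tensor_rel f f" for f :: "('a \<times> 'b) \<Rightarrow>\<^sub>0 complex"
    by (simp add: tensor_rel_def complex_vector.span_zero)
  show "a + b + c = a + (b + c)"
    by transfer (metis add.assoc refl)
  show "a + b = b + a"
    by transfer (metis add.commute refl)
  show "0 + a = a"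
    by transfer (simp add: refl)
  show "- a + a = 0"
    by transfer (simp add: refl)
  show "a - b = a + - b"
    by transfer (simp add: refl)
  show "k *\<^sub>C (a + b) = k *\<^sub>C a + k *\<^sub>C b"
    by transfer (simp add: refl scaleC_add_right)
  show "(k + l) *\<^sub>C a = k *\<^sub>C a + l *\<^sub>C a"
    by transfer (simp add: refl scaleC_add_left)
  show "k *\<^sub>C l *\<^sub>C a = (k * l) *\<^sub>C a"
    by transfer (simp add: refl scaleC_scaleC)
  show "1 *\<^sub>C a = a"
    by transfer (simp add: refl scaleC_one)
qed

end

lift_definition tensor_pure :: "'a::complex_vector \<Rightarrow> 'b::complex_vector \<Rightarrow> ('a, 'b) tensor"
  (infixl "\<otimes>" 70) is free_gen .

lemma tensor_pure_bilinear:
  "bilinear_on UNIV UNIV ((\<otimes>) :: 'a::complex_vector \<Rightarrow> 'b::complex_vector \<Rightarrow> _)"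
proof -
  have base: "tensor_rel f g" if "f - g \<in> tensor_relations"
    for f g :: "('a \<times> 'b) \<Rightarrow>\<^sub>0 complex"
    using that by (simp add: tensor_rel_def complex_vector.span_base)
  have "(x + x') \<otimes> y = x \<otimes> y + x' \<otimes> y" for x x' :: 'a and y :: 'b
    by transfer (rule base, unfold diff_diff_add[symmetric] tensor_relations_def, blast)
  moreover have "x \<otimes> (y + y') = x \<otimes> y + x \<otimes> y'" for x :: 'a and y y' :: 'b
    by transfer (rule base, unfold diff_diff_add[symmetric] tensor_relations_def, blast)
  moreover have "(c *\<^sub>C x) \<otimes> y = c *\<^sub>C (x \<otimes> y)" for c and x :: 'a and y :: 'b
    by transfer (rule base, unfold tensor_relations_def, blast)
  moreover have "x \<otimes> (c *\<^sub>C y) = c *\<^sub>C (x \<otimes> y)" for c and x :: 'a and y :: 'b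
    by transfer (rule base, unfold tensor_relations_def, blast)
  ultimately show ?thesis
    unfolding bilinear_on_def linear_on_def by blast
qed

definition tensor_on ::
  "'a::complex_vector set \<Rightarrow> 'b::complex_vector set \<Rightarrow> ('a, 'b) tensor set" where
  "tensor_on V W = cspan {x \<otimes> y | x y. x \<in> V \<and> y \<in> W}"

text \<open>For a map that is bilinear on the product of two subspaces, \<open>tensor_lift_on\<close> is the induced
  linear map on their tensor product; the lemma \<open>tensor_lift_on_sum\<close> below shows that it is well
  defined.  The subspaces matter because cobrackets are only linear on a subalgebra.\<close>

definition tensor_lift_on :: "'a::complex_vector set \<Rightarrow> 'b::complex_vector set \<Rightarrow>
    ('a \<Rightarrow> 'b \<Rightarrow> 'c::complex_vector) \<Rightarrow> ('a, 'b) tensor \<Rightarrow> 'c" where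
  "tensor_lift_on V W \<beta> T =
     (THE u. \<exists>ps. set ps \<subseteq> V \<times> W \<and> T = (\<Sum>(x, y)\<leftarrow>ps. x \<otimes> y) \<and> u = (\<Sum>(x, y)\<leftarrow>ps. \<beta> x y))"

abbreviation tensor_lift ::
  "('a::complex_vector \<Rightarrow> 'b::complex_vector \<Rightarrow> 'c::complex_vector) \<Rightarrow> ('a, 'b) tensor \<Rightarrow> 'c" where
  "tensor_lift \<equiv> tensor_lift_on UNIV UNIV"

definition free_eval ::
  "('a \<Rightarrow> 'b \<Rightarrow> 'c::complex_vector) \<Rightarrow> (('a \<times> 'b) \<Rightarrow>\<^sub>0 complex) \<Rightarrow> 'c" where
  "free_eval \<beta> f = (\<Sum>p\<in>Poly_Mapping.keys f. Poly_Mapping.lookup f p *\<^sub>C \<beta> (fst p) (snd p))"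

lemma free_eval_superset:
  assumes "finite A" "Poly_Mapping.keys f \<subseteq> A"
  shows "free_eval \<beta> f = (\<Sum>p\<in>A. Poly_Mapping.lookup f p *\<^sub>C \<beta> (fst p) (snd p))"
  unfolding free_eval_def
  by (rule sum.mono_neutral_left) (use assms in \<open>auto simp: in_keys_iff\<close>)

lemma free_eval_add: "free_eval \<beta> (f + g) = free_eval \<beta> f + free_eval \<beta> g"
proof -
  let ?A = "Poly_Mapping.keys f \<union> Poly_Mapping.keys g"
  have "Poly_Mapping.keys (f + g) \<subseteq> ?A" by (rule Poly_Mapping.keys_add)
  then show ?thesis
    by (simp add: free_eval_superset[of ?A] lookup_add scaleC_add_left sum.distrib)
qed

lemma free_eval_scaleC: "free_eval \<beta> (c *\<^sub>C f) = c *\<^sub>C free_eval \<beta> f"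
proof -
  have "Poly_Mapping.keys (c *\<^sub>C f) \<subseteq> Poly_Mapping.keys f" by (auto simp: in_keys_iff lookup_scaleC)
  then show ?thesis
    by (simp add: free_eval_superset[of "Poly_Mapping.keys f"] lookup_scaleC complex_vector.scale_sum_right
        scaleC_complex_def)
qed

lemma free_eval_linear: "clinear (free_eval \<beta>)"
  by (rule clinearI) (simp_all add: free_eval_add free_eval_scaleC)

lemma free_eval_gen: "free_eval \<beta> (free_gen x y) = \<beta> x y"
  by (simp add: free_eval_def scaleC_one)

lemma free_eval_relations:
  assumes "bilinear_on UNIV UNIV \<beta>" and "f \<in> cspan tensor_relations"
  shows "free_eval \<beta> f = 0"
proof -
  have "free_eval \<beta> r = 0" if "r \<in> tensor_relations" for r
    using that assms(1) unfolding tensor_relations_def bilinear_on_def linear_on_def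
    by (auto simp: complex_vector_pair.linear_diff[OF free_eval_linear] free_eval_scaleC free_eval_gen)
  then show ?thesis
    using complex_vector_pair.linear_eq_0_on_span[OF free_eval_linear _ assms(2)] by blast
qed

lemma abs_tensor_free_eval:
  assumes "bilinear_on UNIV UNIV \<beta>"
  shows "free_eval \<beta> (rep_tensor (abs_tensor f)) = free_eval \<beta> f"
proof -
  have "tensor_rel (rep_tensor (abs_tensor f)) f"
    by (rule Quotient3_rep_abs[OF Quotient3_tensor])
      (simp add: tensor_rel_def complex_vector.span_zero)
  then have "free_eval \<beta> (rep_tensor (abs_tensor f) - f) = 0"
    by (intro free_eval_relations[OF assms]) (simp add: tensor_rel_def)
  then show ?thesis by (simp add: complex_vector_pair.linear_diff[OF free_eval_linear])
qed

lemma tensor_universal: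
  fixes \<beta> :: "'a::complex_vector \<Rightarrow> 'b::complex_vector \<Rightarrow> 'c::complex_vector"
  assumes "bilinear_on UNIV UNIV \<beta>"
  shows "\<exists>g. clinear g \<and> (\<forall>x y. g (x \<otimes> y) = \<beta> x y)"
proof (intro exI conjI allI)
  let ?g = "\<lambda>T. free_eval \<beta> (rep_tensor T)"
  show "clinear ?g"
  proof (rule clinearI)
    fix S T :: "('a, 'b) tensor" and c :: complex
    obtain f h where "S = abs_tensor f" "T = abs_tensor h"
      by (metis Quotient3_abs_rep[OF Quotient3_tensor])
    then show "?g (S + T) = ?g S + ?g T" and "?g (c *\<^sub>C S) = c *\<^sub>C ?g S"
      by (simp_all add: plus_tensor.abs_eq scaleC_tensor.abs_eq abs_tensor_free_eval[OF assms]
          free_eval_add free_eval_scaleC)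
  qed
  show "?g (x \<otimes> y) = \<beta> x y" for x y
    by (simp add: tensor_pure.abs_eq abs_tensor_free_eval[OF assms] free_eval_gen)
qed

lemma tensor_universal_on:
  fixes \<beta> :: "'a::complex_vector \<Rightarrow> 'b::complex_vector \<Rightarrow> 'c::complex_vector"
  assumes V: "csubspace V" and W: "csubspace W" and \<beta>: "bilinear_on V W \<beta>"
  shows "\<exists>g. clinear g \<and> (\<forall>x\<in>V. \<forall>y\<in>W. g (x \<otimes> y) = \<beta> x y)"
proof -
  have id: "clinear (\<lambda>x::'d::complex_vector. x)"
    by (rule clinearI) simp_all
  obtain p where p: "p ` UNIV \<subseteq> V" "clinear p" "\<forall>v\<in>V. p v = v"
    using complex_vector_pair.linear_exists_left_inverse_on[OF id V] by (auto simp: inj_on_def)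
  obtain q where q: "q ` UNIV \<subseteq> W" "clinear q" "\<forall>v\<in>W. q v = v"
    using complex_vector_pair.linear_exists_left_inverse_on[OF id W] by (auto simp: inj_on_def)
  have pV: "p x \<in> V" and qW: "q y \<in> W" for x y
    using p(1) q(1) by auto
  have "bilinear_on UNIV UNIV (\<lambda>x y. \<beta> (p x) (q y))"
    using \<beta> pV qW unfolding bilinear_on_def linear_on_def
    by (simp add: complex_vector_pair.linear_add[OF p(2)] complex_vector_pair.linear_add[OF q(2)]
        complex_vector_pair.linear_scale[OF p(2)] complex_vector_pair.linear_scale[OF q(2)])
  from tensor_universal[OF this] show ?thesis
    using p(3) q(3) by auto
qed

lemma clinear_sum_list_pure:
  assumes "clinear g" "set ps \<subseteq> V \<times> W" "\<forall>x\<in>V. \<forall>y\<in>W. g (x \<otimes> y) = \<beta> x y"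
  shows "g (\<Sum>(x, y)\<leftarrow>ps. x \<otimes> y) = (\<Sum>(x, y)\<leftarrow>ps. \<beta> x y)"
  using assms(2)
proof (induction ps)
  case Nil
  then show ?case by (simp add: complex_vector_pair.linear_0[OF assms(1)])
next
  case (Cons a ps)
  then show ?case
    using assms(3) by (auto simp: complex_vector_pair.linear_add[OF assms(1)])
qed

lemma tensor_lift_on_sum:
  assumes "csubspace V" "csubspace W" "bilinear_on V W \<beta>" "set ps \<subseteq> V \<times> W"
  shows "tensor_lift_on V W \<beta> (\<Sum>(x, y)\<leftarrow>ps. x \<otimes> y) = (\<Sum>(x, y)\<leftarrow>ps. \<beta> x y)"
proof -
  obtain g where "clinear g" "\<forall>x\<in>V. \<forall>y\<in>W. g (x \<otimes> y) = \<beta> x y"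
    using tensor_universal_on[OF assms(1-3)] by blast
  then have g: "g (\<Sum>(x, y)\<leftarrow>qs. x \<otimes> y) = (\<Sum>(x, y)\<leftarrow>qs. \<beta> x y)" if "set qs \<subseteq> V \<times> W" for qs
    using clinear_sum_list_pure that by blast
  show ?thesis
    unfolding tensor_lift_on_def
  proof (rule the_equality)
    show "\<exists>qs. set qs \<subseteq> V \<times> W \<and> (\<Sum>(x, y)\<leftarrow>ps. x \<otimes> y) = (\<Sum>(x, y)\<leftarrow>qs. x \<otimes> y) \<and>
        (\<Sum>(x, y)\<leftarrow>ps. \<beta> x y) = (\<Sum>(x, y)\<leftarrow>qs. \<beta> x y)"
      using assms(4) by blast
  qed (metis g assms(4))
qed

definition tensor_map :: "('a::complex_vector \<Rightarrow> 'c::complex_vector) \<Rightarrow>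
    ('b::complex_vector \<Rightarrow> 'd::complex_vector) \<Rightarrow> ('a, 'b) tensor \<Rightarrow> ('c, 'd) tensor" where
  "tensor_map f g = tensor_lift (\<lambda>x y. f x \<otimes> g y)"

definition tensor_swap :: "('a::complex_vector, 'b::complex_vector) tensor \<Rightarrow> ('b, 'a) tensor" where
  "tensor_swap = tensor_lift (\<lambda>x y. y \<otimes> x)"

definition wedge2 :: "'a::complex_vector set \<Rightarrow> ('a, 'a) tensor set" where
  "wedge2 V = {t \<in> tensor_on V V. tensor_swap t = - t}"

text \<open>The cyclic permutation sends \<open>a \<otimes> b \<otimes> c\<close> to \<open>c \<otimes> a \<otimes> b\<close>.\<close>

definition tensor_cycle ::
  "(('a::complex_vector, 'a) tensor, 'a) tensor \<Rightarrow> (('a, 'a) tensor, 'a) tensor" where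
  "tensor_cycle = tensor_lift (\<lambda>s c. tensor_lift (\<lambda>a b. c \<otimes> a \<otimes> b) s)"

definition alt3 ::
  "(('a::complex_vector, 'a) tensor, 'a) tensor \<Rightarrow> (('a, 'a) tensor, 'a) tensor" where
  "alt3 u = u + tensor_cycle u + tensor_cycle (tensor_cycle u)"

text \<open>The form on tensors with \<open>F (a\<^sub>1 \<otimes> a\<^sub>2, b\<^sub>1 \<otimes> b\<^sub>2) = F (a\<^sub>1, b\<^sub>1) F (a\<^sub>2, b\<^sub>2)\<close>.\<close>

definition tensor_form :: "'a::complex_vector set \<Rightarrow> ('a \<Rightarrow> 'a \<Rightarrow> complex) \<Rightarrow>
    ('a, 'a) tensor \<Rightarrow> ('a, 'a) tensor \<Rightarrow> complex" where
  "tensor_form R F s u =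
     tensor_lift_on R R (\<lambda>b1 b2. tensor_lift_on R R (\<lambda>a1 a2. F a1 b1 * F a2 b2) s) u"


section \<open>Lie algebras\<close>

class lie_algebra = complex_vector +
  fixes bracket :: "'a \<Rightarrow> 'a \<Rightarrow> 'a"
  assumes bracket_add_left: "bracket (x + y) z = bracket x z + bracket y z"
    and bracket_add_right: "bracket x (y + z) = bracket x y + bracket x z"
    and bracket_scaleC_left: "bracket (c *\<^sub>C x) y = c *\<^sub>C bracket x y"
    and bracket_scaleC_right: "bracket x (c *\<^sub>C y) = c *\<^sub>C bracket x y"
    and bracket_self: "bracket x x = 0"
    and jacobi: "bracket x (bracket y z) + bracket y (bracket z x) + bracket z (bracket x y) = 0"

lemma bracket_zero_left [simp]: "bracket 0 x = (0 :: 'a::lie_algebra)"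
  using bracket_scaleC_left[of 0 0 x] by simp

lemma bracket_zero_right [simp]: "bracket x 0 = (0 :: 'a::lie_algebra)"
  using bracket_scaleC_right[of x 0 0] by simp

lemma bracket_sum_left: "bracket (sum f A) y = (\<Sum>i\<in>A. bracket (f i) (y :: 'a::lie_algebra))"
  by (induction A rule: infinite_finite_induct) (simp_all add: bracket_add_left)

lemma bracket_sum_right: "bracket y (sum f A) = (\<Sum>i\<in>A. bracket (y :: 'a::lie_algebra) (f i))"
  by (induction A rule: infinite_finite_induct) (simp_all add: bracket_add_right)

lemma bracket_anticomm: "bracket x y = - bracket y (x :: 'a::lie_algebra)"
proof -
  have "0 = bracket (x + y) (x + y)" by (simp only: bracket_self)
  also have "\<dots> = bracket x y + bracket y x"
    by (simp only: bracket_add_left bracket_add_right bracket_self[of x] bracket_self[of y]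
        add_0_left add_0_right add.commute)
  finally show ?thesis by (metis eq_neg_iff_add_eq_0)
qed

instantiation prod :: (lie_algebra, lie_algebra) lie_algebra
begin
definition bracket_prod :: "'a \<times> 'b \<Rightarrow> 'a \<times> 'b \<Rightarrow> 'a \<times> 'b" where
  "bracket_prod p q = (bracket (fst p) (fst q), bracket (snd p) (snd q))"
instance
  by standard (simp_all add: bracket_prod_def scaleC_prod_def bracket_add_left bracket_add_right
      bracket_scaleC_left bracket_scaleC_right bracket_self jacobi zero_prod_def)
end

text \<open>A finitely supported function \<open>f\<close> on the exponents stands for the sum of the
  \<open>f k z\<^sup>k\<close>; the bracket is determined by \<open>[a z\<^sup>k, b z\<^sup>l] = [a, b] z\<^sup>k\<^sup>+\<^sup>l\<close>.\<close>

instantiation poly_mapping :: (comm_monoid_add, lie_algebra) lie_algebra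
begin

definition bracket_poly_mapping :: "('a \<Rightarrow>\<^sub>0 'b) \<Rightarrow> ('a \<Rightarrow>\<^sub>0 'b) \<Rightarrow> ('a \<Rightarrow>\<^sub>0 'b)" where
  "bracket_poly_mapping f g =
     (\<Sum>k\<in>Poly_Mapping.keys f. \<Sum>l\<in>Poly_Mapping.keys g.
        Poly_Mapping.single (k + l) (bracket (Poly_Mapping.lookup f k) (Poly_Mapping.lookup g l)))"

lemma bracket_poly_mapping_superset:
  fixes f g :: "'a \<Rightarrow>\<^sub>0 'b"
  assumes "finite A" "Poly_Mapping.keys f \<subseteq> A" "finite B" "Poly_Mapping.keys g \<subseteq> B"
  shows "bracket f g = (\<Sum>k\<in>A. \<Sum>l\<in>B.
    Poly_Mapping.single (k + l) (bracket (Poly_Mapping.lookup f k) (Poly_Mapping.lookup g l)))"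
proof -
  let ?s = "\<lambda>k l. Poly_Mapping.single (k + l)
    (bracket (Poly_Mapping.lookup f k) (Poly_Mapping.lookup g l))"
  have "bracket f g = (\<Sum>k\<in>Poly_Mapping.keys f. \<Sum>l\<in>B. ?s k l)"
    unfolding bracket_poly_mapping_def
    by (intro sum.cong refl sum.mono_neutral_left) (use assms in \<open>auto simp: in_keys_iff\<close>)
  also have "\<dots> = (\<Sum>k\<in>A. \<Sum>l\<in>B. ?s k l)"
    by (intro sum.mono_neutral_left) (use assms in \<open>auto simp: in_keys_iff\<close>)
  finally show ?thesis .
qed

lemma bracket_poly_mapping_single:
  "bracket (Poly_Mapping.single k a) (Poly_Mapping.single l b) =
     (Poly_Mapping.single (k + l) (bracket a b) :: 'a \<Rightarrow>\<^sub>0 'b)"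
  by (subst bracket_poly_mapping_superset[of "{k}" _ "{l}"]) auto

lemma bracket_poly_mapping_add_left:
  "bracket (f + g) h = bracket f h + bracket g (h :: 'a \<Rightarrow>\<^sub>0 'b)"
proof -
  let ?A = "Poly_Mapping.keys f \<union> Poly_Mapping.keys g"
  have "Poly_Mapping.keys (f + g) \<subseteq> ?A" by (rule Poly_Mapping.keys_add)
  then show ?thesis
    by (simp add: bracket_poly_mapping_superset[of ?A _ "Poly_Mapping.keys h"] lookup_add
        bracket_add_left single_add sum.distrib)
qed

lemma bracket_poly_mapping_add_right:
  "bracket h (f + g) = bracket h f + bracket h (g :: 'a \<Rightarrow>\<^sub>0 'b)"
proof -
  let ?A = "Poly_Mapping.keys f \<union> Poly_Mapping.keys g"
  have "Poly_Mapping.keys (f + g) \<subseteq> ?A" by (rule Poly_Mapping.keys_add)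
  then show ?thesis
    by (simp add: bracket_poly_mapping_superset[of "Poly_Mapping.keys h" _ ?A] lookup_add
        bracket_add_right single_add sum.distrib)
qed

lemma single_scaleC:
  "Poly_Mapping.single k (c *\<^sub>C a) = c *\<^sub>C (Poly_Mapping.single k a :: 'a \<Rightarrow>\<^sub>0 'b)"
  by (rule poly_mapping_eqI) (simp add: lookup_scaleC lookup_single when_def)

lemma bracket_poly_mapping_scaleC:
  fixes f g :: "'a \<Rightarrow>\<^sub>0 'b"
  shows "bracket (c *\<^sub>C f) g = c *\<^sub>C bracket f g" and "bracket f (c *\<^sub>C g) = c *\<^sub>C bracket f g"
proof -
  have k: "Poly_Mapping.keys (c *\<^sub>C h) \<subseteq> Poly_Mapping.keys h" for h :: "'a \<Rightarrow>\<^sub>0 'b"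
    by (auto simp: in_keys_iff lookup_scaleC)
  show "bracket (c *\<^sub>C f) g = c *\<^sub>C bracket f g" "bracket f (c *\<^sub>C g) = c *\<^sub>C bracket f g"
    by (simp_all add: bracket_poly_mapping_superset[of "Poly_Mapping.keys f" _ "Poly_Mapping.keys g"]
        k lookup_scaleC bracket_scaleC_left bracket_scaleC_right single_scaleC
        complex_vector.scale_sum_right)
qed

lemma sum_single: "f = (\<Sum>k\<in>Poly_Mapping.keys f. Poly_Mapping.single k (Poly_Mapping.lookup f k))"
  for f :: "'a \<Rightarrow>\<^sub>0 'b"
  by (rule poly_mapping_eqI)
    (simp add: lookup_sum lookup_single when_def sum.delta' in_keys_iff)

lemma poly_mapping_additive_induct:
  fixes f :: "'a \<Rightarrow>\<^sub>0 'b"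
  assumes "P 0" "\<And>k a. P (Poly_Mapping.single k a)" "\<And>f g. P f \<Longrightarrow> P g \<Longrightarrow> P (f + g)"
  shows "P f"
proof -
  have "P (\<Sum>k\<in>A. Poly_Mapping.single k (Poly_Mapping.lookup f k))" for A
    by (induction A rule: infinite_finite_induct) (auto intro: assms)
  then show ?thesis by (metis sum_single)
qed

instance
proof
  fix f g h :: "'a \<Rightarrow>\<^sub>0 'b" and c :: complex
  show "bracket (f + g) h = bracket f h + bracket g h"
    by (rule bracket_poly_mapping_add_left)
  show "bracket f (g + h) = bracket f g + bracket f h"
    by (rule bracket_poly_mapping_add_right)
  show "bracket (c *\<^sub>C f) g = c *\<^sub>C bracket f g" "bracket f (c *\<^sub>C g) = c *\<^sub>C bracket f g"
    by (rule bracket_poly_mapping_scaleC)+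
  have zero: "bracket 0 u = 0" "bracket u 0 = 0" for u :: "'a \<Rightarrow>\<^sub>0 'b"
    by (simp_all add: bracket_poly_mapping_def)
  note add = bracket_poly_mapping_add_left bracket_poly_mapping_add_right
  have anti: "bracket u v + bracket v u = 0" for u v :: "'a \<Rightarrow>\<^sub>0 'b"
  proof (induction u rule: poly_mapping_additive_induct)
    case (2 k a)
    show ?case
    proof (induction v rule: poly_mapping_additive_induct)
      case (2 l b)
      then show ?case
        by (simp add: bracket_poly_mapping_single add.commute[of l k] single_add[symmetric])
          (simp add: bracket_anticomm[of b a])
    next
      case (3 v w)
      from arg_cong2[OF 3, of "(+)"] show ?case by (simp add: add algebra_simps)
    qed (simp add: zero)
  next
    case (3 v w)
    from arg_cong2[OF 3, of "(+)"] show ?case by (simp add: add algebra_simps)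
  qed (simp add: zero)
  show "bracket f f = 0"
  proof (induction f rule: poly_mapping_additive_induct)
    case (3 u v)
    then show ?case using anti[of v u] by (simp add: add)
  qed (simp_all add: zero bracket_poly_mapping_single bracket_self)
  show "bracket f (bracket g h) + bracket g (bracket h f) + bracket h (bracket f g) = 0"
  proof (induction f rule: poly_mapping_additive_induct)
    case (2 k a)
    show ?case
    proof (induction g rule: poly_mapping_additive_induct)
      case (2 l b)
      show ?case
      proof (induction h rule: poly_mapping_additive_induct)
        case (2 j d)
        have "l + (j + k) = k + (l + j)" "j + (k + l) = k + (l + j)"
          by (simp_all add: ac_simps)
        then show ?case
          by (simp add: bracket_poly_mapping_single single_add[symmetric] jacobi)
      next
        case (3 u v)
        from arg_cong2[OF 3, of "(+)"] show ?case by (simp add: add algebra_simps)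
      qed (simp add: zero)
    next
      case (3 u v)
      from arg_cong2[OF 3, of "(+)"] show ?case by (simp add: add algebra_simps)
    qed (simp add: zero)
  next
    case (3 u v)
    from arg_cong2[OF 3, of "(+)"] show ?case by (simp add: add algebra_simps)
  qed (simp add: zero)
qed

end

definition lie_subalgebra :: "'a::lie_algebra set \<Rightarrow> 'a set \<Rightarrow> bool" where
  "lie_subalgebra W R \<longleftrightarrow> W \<subseteq> R \<and> csubspace W \<and> (\<forall>x\<in>W. \<forall>y\<in>W. bracket x y \<in> W)"

text \<open>A Lie algebra is treated as a set closed under the operations of an ambient type.\<close>

abbreviation lie_algebra_on :: "'a::lie_algebra set \<Rightarrow> bool" where
  "lie_algebra_on R \<equiv> lie_subalgebra R UNIV"

definition lie_ideal :: "'a::lie_algebra set \<Rightarrow> 'a set \<Rightarrow> bool" where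
  "lie_ideal I R \<longleftrightarrow> I \<subseteq> R \<and> csubspace I \<and> (\<forall>x\<in>R. \<forall>y\<in>I. bracket x y \<in> I)"

definition simple_lie_algebra :: "'a::lie_algebra set \<Rightarrow> bool" where
  "simple_lie_algebra R \<longleftrightarrow> lie_algebra_on R \<and> (\<exists>x\<in>R. \<exists>y\<in>R. bracket x y \<noteq> 0) \<and>
     (\<forall>I. lie_ideal I R \<longrightarrow> I = {0} \<or> I = R)"

definition killing_form :: "'a::lie_algebra \<Rightarrow> 'a \<Rightarrow> complex" where
  "killing_form a b = trace_endo (\<lambda>x. bracket a (bracket b x))"

fun lower_central :: "'a::lie_algebra set \<Rightarrow> nat \<Rightarrow> 'a set" where
  "lower_central R 0 = R"
| "lower_central R (Suc n) = cspan {bracket x y | x y. x \<in> R \<and> y \<in> lower_central R n}"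

definition nilpotent_lie :: "'a::lie_algebra set \<Rightarrow> bool" where
  "nilpotent_lie R \<longleftrightarrow> (\<exists>n. lower_central R n = {0})"

definition cartan_subalgebra :: "'a::lie_algebra set \<Rightarrow> 'a set \<Rightarrow> bool" where
  "cartan_subalgebra H R \<longleftrightarrow> lie_subalgebra H R \<and> nilpotent_lie H \<and>
     {x \<in> R. \<forall>y\<in>H. bracket x y \<in> H} = H"

text \<open>Linear functionals on \<open>H\<close> are represented by functions that vanish outside \<open>H\<close>.\<close>

definition root_space :: "'a::lie_algebra set \<Rightarrow> 'a set \<Rightarrow> ('a \<Rightarrow> complex) \<Rightarrow> 'a set" where
  "root_space R H \<alpha> = {x \<in> R. \<forall>h\<in>H. bracket h x = \<alpha> h *\<^sub>C x}"

definition roots :: "'a::lie_algebra set \<Rightarrow> 'a set \<Rightarrow> ('a \<Rightarrow> complex) set" where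
  "roots R H = {\<alpha>. linear_on H \<alpha> \<and> (\<forall>x. x \<notin> H \<longrightarrow> \<alpha> x = 0) \<and> (\<exists>x\<in>H. \<alpha> x \<noteq> 0) \<and>
     root_space R H \<alpha> \<noteq> {0}}"

definition positive_system :: "('a \<Rightarrow> complex) set \<Rightarrow> ('a \<Rightarrow> complex) set \<Rightarrow> bool" where
  "positive_system P \<Delta> \<longleftrightarrow> P \<subseteq> \<Delta> \<and>
     (\<forall>\<alpha>\<in>\<Delta>. (\<alpha> \<in> P) \<noteq> ((\<lambda>x. - \<alpha> x) \<in> P)) \<and>
     (\<forall>\<alpha>\<in>P. \<forall>\<beta>\<in>P. (\<lambda>x. \<alpha> x + \<beta> x) \<in> \<Delta> \<longrightarrow> (\<lambda>x. \<alpha> x + \<beta> x) \<in> P)"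

definition triangular_decomposition ::
  "'a::lie_algebra set \<Rightarrow> 'a set \<Rightarrow> 'a set \<Rightarrow> 'a set \<Rightarrow> bool" where
  "triangular_decomposition R Np H Nm \<longleftrightarrow> cartan_subalgebra H R \<and>
     (\<exists>P. positive_system P (roots R H) \<and>
        Np = cspan (\<Union>\<alpha>\<in>P. root_space R H \<alpha>) \<and>
        Nm = cspan (\<Union>\<alpha>\<in>P. root_space R H (\<lambda>x. - \<alpha> x))) \<and>
     direct_sum {x + y | x y. x \<in> Np \<and> y \<in> H} Np H \<and>
     direct_sum R {x + y | x y. x \<in> Np \<and> y \<in> H} Nm"

definition lie_automorphism :: "('a::lie_algebra \<Rightarrow> 'a) \<Rightarrow> bool" where
  "lie_automorphism \<sigma> \<longleftrightarrow> clinear \<sigma> \<and> bij \<sigma> \<and> (\<forall>x y. \<sigma> (bracket x y) = bracket (\<sigma> x) (\<sigma> y))"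

definition has_order :: "('a \<Rightarrow> 'a) \<Rightarrow> nat \<Rightarrow> bool" where
  "has_order \<sigma> m \<longleftrightarrow> 0 < m \<and> \<sigma> ^^ m = id \<and> (\<forall>j. 0 < j \<and> j < m \<longrightarrow> \<sigma> ^^ j \<noteq> id)"


section \<open>Lie bialgebras and Manin triples\<close>

text \<open>\<open>tensor_ad a t\<close> is \<open>[a \<otimes> 1 + 1 \<otimes> a, t]\<close>.\<close>

definition tensor_ad :: "'a::lie_algebra \<Rightarrow> ('a, 'a) tensor \<Rightarrow> ('a, 'a) tensor" where
  "tensor_ad a = tensor_lift (\<lambda>x y. bracket a x \<otimes> y + x \<otimes> bracket a y)"

definition lie_bialgebra :: "'a::lie_algebra set \<Rightarrow> ('a \<Rightarrow> ('a, 'a) tensor) \<Rightarrow> bool" where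
  "lie_bialgebra R \<delta> \<longleftrightarrow> lie_algebra_on R \<and> linear_on R \<delta> \<and> (\<forall>a\<in>R. \<delta> a \<in> wedge2 R) \<and>
     (\<forall>a\<in>R. \<forall>b\<in>R. \<delta> (bracket a b) = tensor_ad a (\<delta> b) - tensor_ad b (\<delta> a)) \<and>
     (\<forall>a\<in>R. alt3 (tensor_lift_on R R (\<lambda>x y. \<delta> x \<otimes> y) (\<delta> a)) = 0)"

definition orthogonal_in :: "'a set \<Rightarrow> ('a \<Rightarrow> 'a \<Rightarrow> complex) \<Rightarrow> 'a set \<Rightarrow> 'a set" where
  "orthogonal_in R F W = {x \<in> R. \<forall>y\<in>W. F x y = 0}"

definition manin_triple ::
  "'a::lie_algebra set \<Rightarrow> ('a \<Rightarrow> 'a \<Rightarrow> complex) \<Rightarrow> 'a set \<Rightarrow> 'a set \<Rightarrow> bool" where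
  "manin_triple R F Rp Rm \<longleftrightarrow> lie_algebra_on R \<and>
     bilinear_on R R F \<and> (\<forall>x\<in>R. \<forall>y\<in>R. F x y = F y x) \<and>
     (\<forall>x\<in>R. \<forall>y\<in>R. \<forall>z\<in>R. F (bracket x y) z = F x (bracket y z)) \<and>
     orthogonal_in R F R = {0} \<and>
     lie_subalgebra Rp R \<and> lie_subalgebra Rm R \<and>
     Rp \<subseteq> orthogonal_in R F Rp \<and> Rm \<subseteq> orthogonal_in R F Rm \<and> direct_sum R Rp Rm"

text \<open>Being determined by a Manin triple includes that \<open>(R, Rp, Rm)\<close> is one.\<close>

definition determined_by_manin_triple :: "'a::lie_algebra set \<Rightarrow> ('a \<Rightarrow> 'a \<Rightarrow> complex) \<Rightarrow>
    'a set \<Rightarrow> 'a set \<Rightarrow> ('a \<Rightarrow> ('a, 'a) tensor) \<Rightarrow> bool" where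
  "determined_by_manin_triple R F Rp Rm \<delta> \<longleftrightarrow> manin_triple R F Rp Rm \<and>
     (\<forall>a\<in>Rp. \<forall>b1\<in>Rm. \<forall>b2\<in>Rm. tensor_form R F (\<delta> a) (b1 \<otimes> b2) = F a (bracket b1 b2))"

definition MT :: "'a::lie_algebra set \<Rightarrow> ('a \<Rightarrow> 'a \<Rightarrow> complex) \<Rightarrow> 'a set \<Rightarrow> 'a set \<Rightarrow> 'a set set" where
  "MT R F Rp Rm = {W. manin_triple R F Rp W \<and> commensurable W Rm}"


section \<open>Twisted loop algebras and the standard Manin triple\<close>

type_synonym 'g laurent = "int \<Rightarrow>\<^sub>0 'g"

definition unity_root :: "nat \<Rightarrow> complex" where
  "unity_root m = exp (2 * of_real pi * \<i> / of_nat m)"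

definition grade :: "('g::lie_algebra \<Rightarrow> 'g) \<Rightarrow> nat \<Rightarrow> int \<Rightarrow> 'g set" where
  "grade \<sigma> m k = {a. \<sigma> a = (unity_root m powi k) *\<^sub>C a}"

definition loop_algebra :: "('g::lie_algebra \<Rightarrow> 'g) \<Rightarrow> nat \<Rightarrow> 'g laurent set" where
  "loop_algebra \<sigma> m = {f. \<forall>k. Poly_Mapping.lookup f k \<in> grade \<sigma> m k}"

abbreviation loop_algebra_dagger :: "('g::lie_algebra \<Rightarrow> 'g) \<Rightarrow> nat \<Rightarrow> 'g laurent set" where
  "loop_algebra_dagger \<sigma> m \<equiv> loop_algebra (inv \<sigma>) m"

lemma grade_inv:
  assumes "lie_automorphism \<sigma>"
  shows "grade (inv \<sigma>) m k = {a. \<sigma> a = (unity_root m powi (- k)) *\<^sub>C a}"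
proof -
  have lin: "clinear \<sigma>" and bij: "bij \<sigma>"
    using assms by (auto simp: lie_automorphism_def)
  have u: "unity_root m powi k \<noteq> 0" by (simp add: unity_root_def)
  have "inv \<sigma> a = (unity_root m powi k) *\<^sub>C a \<longleftrightarrow> \<sigma> a = (unity_root m powi (- k)) *\<^sub>C a" for a
  proof -
    have "inv \<sigma> a = (unity_root m powi k) *\<^sub>C a \<longleftrightarrow> a = (unity_root m powi k) *\<^sub>C \<sigma> a"
      using bij by (metis bij_inv_eq_iff complex_vector_pair.linear_scale[OF lin])
    also have "\<dots> \<longleftrightarrow> \<sigma> a = (unity_root m powi (- k)) *\<^sub>C a"
      using u by (metis complex_vector.scale_one complex_vector.scale_scale power_int_minus
          left_inverse right_inverse)
    finally show ?thesis .
  qed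
  then show ?thesis by (auto simp: grade_def)
qed

text \<open>The map \<open>(a z\<^sup>k)\<^sup>\<ddagger> = a z\<^sup>-\<^sup>k\<close>.\<close>

lift_definition dagger :: "'g::zero laurent \<Rightarrow> 'g laurent" is "\<lambda>f k. f (- k)"
proof -
  fix f :: "int \<Rightarrow> 'g"
  assume "finite {k. f k \<noteq> 0}"
  then have "finite (uminus ` {k. f k \<noteq> 0})" by (rule finite_imageI)
  then show "finite {k. f (- k) \<noteq> 0}"
    by (rule rev_finite_subset) (auto intro: image_eqI[of _ uminus "- x" for x])
qed

definition loop_form :: "'g::lie_algebra laurent \<Rightarrow> 'g laurent \<Rightarrow> complex" where
  "loop_form f g =
     (\<Sum>k\<in>Poly_Mapping.keys f. killing_form (Poly_Mapping.lookup f k) (Poly_Mapping.lookup g (- k)))"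

definition double_algebra :: "('g::lie_algebra \<Rightarrow> 'g) \<Rightarrow> nat \<Rightarrow> ('g laurent \<times> 'g laurent) set" where
  "double_algebra \<sigma> m = loop_algebra \<sigma> m \<times> loop_algebra_dagger \<sigma> m"

definition double_form ::
  "'g::lie_algebra laurent \<times> 'g laurent \<Rightarrow> 'g laurent \<times> 'g laurent \<Rightarrow> complex" where
  "double_form f g = loop_form (fst f) (fst g) - loop_form (snd f) (snd g)"

definition diag_embed :: "'g::lie_algebra laurent \<Rightarrow> 'g laurent \<times> 'g laurent" where
  "diag_embed f = (f, dagger f)"

definition diagonal :: "('g::lie_algebra \<Rightarrow> 'g) \<Rightarrow> nat \<Rightarrow> ('g laurent \<times> 'g laurent) set" where
  "diagonal \<sigma> m = diag_embed ` loop_algebra \<sigma> m"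

text \<open>Both \<open>\<BB>\<^sub>+\<close> and \<open>\<BB>\<^sub>-\<close> have this form, the latter inside the daggered loop algebra,
  with \<open>N\<close> the respective nilpotent part.\<close>

definition loop_borel :: "'g::lie_algebra laurent set \<Rightarrow> 'g set \<Rightarrow> 'g set \<Rightarrow> 'g laurent set" where
  "loop_borel L N H = {f \<in> L. (\<forall>k<0. Poly_Mapping.lookup f k = 0) \<and>
     Poly_Mapping.lookup f 0 \<in> {x + h | x h. x \<in> N \<and> h \<in> H}}"

definition borel_proj :: "'g::lie_algebra set \<Rightarrow> 'g set \<Rightarrow> 'g laurent \<Rightarrow> 'g" where
  "borel_proj N H f = (THE h. h \<in> H \<and> (\<exists>x\<in>N. Poly_Mapping.lookup f 0 = x + h))"

definition standard_complement :: "('g::lie_algebra \<Rightarrow> 'g) \<Rightarrow> nat \<Rightarrow> 'g set \<Rightarrow> 'g set \<Rightarrow> 'g set \<Rightarrow>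
    ('g laurent \<times> 'g laurent) set" where
  "standard_complement \<sigma> m Np H Nm =
     {(fp, fm). fp \<in> loop_borel (loop_algebra \<sigma> m) Np H \<and>
        fm \<in> loop_borel (loop_algebra_dagger \<sigma> m) Nm H \<and>
        borel_proj Np H fp + borel_proj Nm H fm = 0}"

text \<open>Transport of tensors and cobrackets along the identification \<open>diag_embed\<close> of the loop algebra
  with the diagonal, whose inverse is \<open>fst\<close>.\<close>

abbreviation diag_tensor :: "('g::lie_algebra laurent, 'g laurent) tensor \<Rightarrow>
    ('g laurent \<times> 'g laurent, 'g laurent \<times> 'g laurent) tensor" where
  "diag_tensor \<equiv> tensor_map diag_embed diag_embed"

definition diag_cobracket :: "('g::lie_algebra laurent \<Rightarrow> ('g laurent, 'g laurent) tensor) \<Rightarrow>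
    'g laurent \<times> 'g laurent \<Rightarrow> ('g laurent \<times> 'g laurent, 'g laurent \<times> 'g laurent) tensor" where
  "diag_cobracket \<delta> x = diag_tensor (\<delta> (fst x))"

definition standard_cobracket :: "('g::lie_algebra \<Rightarrow> 'g) \<Rightarrow> nat \<Rightarrow> 'g set \<Rightarrow> 'g set \<Rightarrow> 'g set \<Rightarrow>
    ('g laurent \<Rightarrow> ('g laurent, 'g laurent) tensor) \<Rightarrow> bool" where
  "standard_cobracket \<sigma> m Np H Nm \<delta> \<longleftrightarrow> lie_bialgebra (loop_algebra \<sigma> m) \<delta> \<and>
     determined_by_manin_triple (double_algebra \<sigma> m) double_form (diagonal \<sigma> m)
       (standard_complement \<sigma> m Np H Nm) (diag_cobracket \<delta>)"

text \<open>For \<open>t = \<Sum>\<^sub>i a\<^sub>i \<otimes> b\<^sub>i\<close> with all \<open>a\<^sub>i, b\<^sub>i\<close> in \<open>C\<close>, the value at \<open>w\<close> is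
  \<open>\<Sum>\<^sub>i F (w, a\<^sub>i) b\<^sub>i\<close>.\<close>

definition tensor_contract :: "'a::complex_vector set \<Rightarrow> ('a \<Rightarrow> 'a \<Rightarrow> complex) \<Rightarrow>
    ('a, 'a) tensor \<Rightarrow> 'a \<Rightarrow> 'a" where
  "tensor_contract C F t w = tensor_lift_on C C (\<lambda>a b. F w a *\<^sub>C b) t"

definition twisted_complement :: "('g::lie_algebra \<Rightarrow> 'g) \<Rightarrow> nat \<Rightarrow> 'g set \<Rightarrow> 'g set \<Rightarrow> 'g set \<Rightarrow>
    ('g laurent, 'g laurent) tensor \<Rightarrow> ('g laurent \<times> 'g laurent) set" where
  "twisted_complement \<sigma> m Np H Nm t =
     {w + tensor_contract (diagonal \<sigma> m) double_form (diag_tensor t) w | w.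
        w \<in> standard_complement \<sigma> m Np H Nm}"

definition twisted_cobracket :: "('a::lie_algebra \<Rightarrow> ('a, 'a) tensor) \<Rightarrow> ('a, 'a) tensor \<Rightarrow>
    'a \<Rightarrow> ('a, 'a) tensor" where
  "twisted_cobracket \<delta> t a = \<delta> a + tensor_ad a t"

end

theory Submission
  imports Defs
begin

text \<open>Write \<open>W\<^sub>t\<close> for the graph of \<open>f\<^sub>t\<close>.  Because \<open>t\<close> is skew, \<open>W\<^sub>t\<close> is a Lagrangian complement of the
  diagonal \<open>C\<close>, and invariance of \<open>F\<close> gives
  \<open>F (\<delta>\<^sub>t a, u \<otimes> v) = F (a, [u, v])\<close> for \<open>a \<in> C\<close> and \<open>u, v \<in> W\<^sub>t\<close>, for every \<open>t\<close>.
  Pairing the co-Jacobi expression of \<open>a\<close> with \<open>u \<otimes> v \<otimes> w\<close> therefore yields the cyclic sum of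
  \<open>F (a, [\<pi> [u, v], w])\<close>, where \<open>\<pi>\<close> is the projection to \<open>W\<^sub>t\<close> along \<open>C\<close>.  If \<open>W\<^sub>t\<close> is a subalgebra, this
  vanishes by the Jacobi identity.

  Conversely, there is a finite \<open>S \<subseteq> C\<close> such that every \<open>w \<in> W\<^sub>t\<close> orthogonal to \<open>S\<close> satisfies
  \<open>F ([u, v], w) = 0\<close> for all \<open>u, v \<in> W\<^sub>t\<close>, so that \<open>[u, w]\<close> and \<open>[v, w]\<close> lie in \<open>W\<^sub>t\<close>.  For such \<open>w\<close> the co-Jacobi
  identity reduces to \<open>F ([a, r], w) = 0\<close> with \<open>r\<close> the \<open>C\<close>-component of \<open>[u, v]\<close>.  Hence
  \<open>[a, r]\<close> lies in the span of \<open>S\<close> for all \<open>a \<in> C\<close>.  In a loop algebra this forces \<open>r = 0\<close>: bracketing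
  with \<open>a z\<^sup>k\<close> for large \<open>k\<close> leaves the degrees of \<open>S\<close>, so all coefficients of \<open>r\<close> are central in \<open>\<gg>\<close>.

  For surjectivity, a complement commensurable to \<open>W\<^sup>\<circ>\<close> is the graph of a skew map \<open>W\<^sup>\<circ> \<rightarrow> C\<close> of finite
  rank; expanding it in a basis of its image and a dual family in \<open>W\<^sup>\<circ>\<close> exhibits the tensor \<open>t\<close>.\<close>

section \<open>Linear algebra\<close>

lemma linear_on_extend:
  fixes f :: "'a::complex_vector \<Rightarrow> 'b::complex_vector"
  assumes "csubspace V" "linear_on V f"
  obtains g where "clinear g" "\<And>x. x \<in> V \<Longrightarrow> g x = f x"
proof -
  have "clinear (\<lambda>x::'a. x)" by (rule clinearI) simp_all
  from complex_vector_pair.linear_exists_left_inverse_on[OF this assms(1)]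
  obtain p :: "'a \<Rightarrow> 'a" where p: "p ` UNIV \<subseteq> V" "clinear p" "\<forall>v\<in>V. p v = v"
    by (auto simp: inj_on_def)
  have "clinear (\<lambda>x. f (p x))"
    using p(1) assms(2)
    by (intro clinearI)
      (auto simp: linear_on_def complex_vector_pair.linear_add[OF p(2)]
        complex_vector_pair.linear_scale[OF p(2)] image_subset_iff)
  then show thesis using p(3) by (intro that[of "\<lambda>x. f (p x)"]) auto
qed

text \<open>Subtracting a projection \<open>q\<close> onto \<open>B\<close> kills \<open>B\<close>
  and stays injective on \<open>A\<close>, because \<open>A\<close> meets \<open>B\<close> only in
  \<open>0\<close>. A left inverse on \<open>A\<close> then restores the elements of
  \<open>A\<close>.\<close>

lemma direct_sum_projection:
  fixes A B :: "'a::complex_vector set"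
  assumes A: "csubspace A" and B: "csubspace B" and AB: "A \<inter> B = {0}"
  obtains \<rho> where "clinear \<rho>" "\<And>a. a \<in> A \<Longrightarrow> \<rho> a = a" "\<And>b. b \<in> B \<Longrightarrow> \<rho> b = 0"
proof -
  have "clinear (\<lambda>x::'a. x)" by (rule clinearI) simp_all
  from complex_vector_pair.linear_exists_left_inverse_on[OF this B]
  obtain q :: "'a \<Rightarrow> 'a" where q: "q ` UNIV \<subseteq> B" "clinear q" "\<forall>v\<in>B. q v = v"
    by (auto simp: inj_on_def)
  define T where "T x = x - q x" for x
  have T: "clinear T"
    unfolding T_def
    by (rule clinearI) (simp_all add: complex_vector_pair.linear_add[OF q(2)]
      complex_vector_pair.linear_scale[OF q(2)] complex_vector.scale_right_diff_distrib)
  have "inj_on T A"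
  proof (rule inj_onI)
    fix x y assume xy: "x \<in> A" "y \<in> A" "T x = T y"
    then have "x - y = q (x - y)"
      by (simp add: T_def complex_vector_pair.linear_diff[OF q(2)] algebra_simps)
    then have "x - y \<in> B" using q(1) by (metis image_subset_iff UNIV_I)
    moreover have "x - y \<in> A" using xy complex_vector.subspace_diff[OF A] by blast
    ultimately have "x - y \<in> {0}" using AB by blast
    then show "x = y" by simp
  qed
  from complex_vector_pair.linear_exists_left_inverse_on[OF T A this]
  obtain g where g: "clinear g" "\<forall>v\<in>A. g (T v) = v" by auto
  have "clinear (\<lambda>x. g (T x))"
    by (rule clinearI) (simp_all add: complex_vector_pair.linear_add[OF T]
      complex_vector_pair.linear_scale[OF T] complex_vector_pair.linear_add[OF g(1)]
      complex_vector_pair.linear_scale[OF g(1)])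
  moreover have "g (T b) = 0" if "b \<in> B" for b
    using q(3) that by (simp add: T_def complex_vector_pair.linear_0[OF g(1)])
  ultimately show thesis using g(2) by (intro that[of "\<lambda>x. g (T x)"]) auto
qed

text \<open>Induction on \<open>S\<close>: either the new \<open>s\<close> imposes no further
  condition on \<open>w\<close>, or some \<open>w0\<close> dual to it allows a multiple of
  \<open>s\<close> to be removed from \<open>v\<close>.\<close>

lemma double_annihilator:
  fixes e :: "'w::complex_vector \<Rightarrow> 'v::complex_vector \<Rightarrow> complex"
  assumes W: "csubspace W" and V: "csubspace V" and e: "bilinear_on W V e"
    and nondeg: "\<And>x. x \<in> V \<Longrightarrow> \<forall>w\<in>W. e w x = 0 \<Longrightarrow> x = 0"
    and "finite S" "S \<subseteq> V" "v \<in> V"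
    and "\<forall>w\<in>W. (\<forall>s\<in>S. e w s = 0) \<longrightarrow> e w v = 0"
  shows "v \<in> cspan S"
  using assms(5-8)
proof (induction S arbitrary: v rule: finite_induct)
  case empty
  then show ?case using nondeg complex_vector.span_zero by blast
next
  case (insert s S)
  have eV: "e w (x + y) = e w x + e w y" "e w (c *\<^sub>C x) = c * e w x"
    if "w \<in> W" "x \<in> V" "y \<in> V" for w x y c
    using e that by (auto simp: bilinear_on_def linear_on_def scaleC_complex_def)
  have eW: "e (w + w') x = e w x + e w' x" "e (c *\<^sub>C w) x = c * e w x"
    if "w \<in> W" "w' \<in> W" "x \<in> V" for w w' x c
    using e that by (auto simp: bilinear_on_def linear_on_def scaleC_complex_def)
  have sV: "s \<in> V" using insert by auto
  show ?case
  proof (cases "\<forall>w\<in>W. (\<forall>s\<in>S. e w s = 0) \<longrightarrow> e w s = 0")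
    case True
    then have "v \<in> cspan S" using insert by auto
    then show ?thesis using complex_vector.span_mono[of S "insert s S"] by auto
  next
    case False
    then obtain w1 where w1: "w1 \<in> W" "\<forall>s\<in>S. e w1 s = 0" "e w1 s \<noteq> 0" by blast
    define w0 where "w0 = (1 / e w1 s) *\<^sub>C w1"
    have w0: "w0 \<in> W" "e w0 s = 1" "\<And>u. u \<in> S \<Longrightarrow> e w0 u = 0"
      using w1 complex_vector.subspace_scale[OF W] eW sV insert.prems(1) by (auto simp: w0_def)
    \<comment> \<open>Chosen so that \<open>w0\<close> annihilates \<open>v'\<close>; then so does
      every \<open>w\<close> that annihilates \<open>S\<close>.\<close>
    define v' where "v' = v + (- e w0 v) *\<^sub>C s"
    have v'V: "v' \<in> V"
      unfolding v'_def using insert.prems sV V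
      by (intro complex_vector.subspace_add complex_vector.subspace_scale) auto
    have "e w v' = 0" if w: "w \<in> W" "\<forall>u\<in>S. e w u = 0" for w
    proof -
      \<comment> \<open>Removing a multiple of \<open>w0\<close> makes \<open>w\<close> kill
        \<open>s\<close> as well, so that the hypothesis on \<open>v\<close> applies to
        \<open>u\<close>.\<close>
      define u where "u = w + (- e w s) *\<^sub>C w0"
      have uW: "u \<in> W" and cW: "(- e w s) *\<^sub>C w0 \<in> W"
        unfolding u_def using w(1) w0(1) W
        by (blast intro: complex_vector.subspace_add complex_vector.subspace_scale)+
      have eu: "e u x = e w x - e w s * e w0 x" if "x \<in> V" for x
        unfolding u_def using eW(1)[OF w(1) cW that] eW(2)[OF w0(1) w0(1) that, of "- e w s"]
        by (simp del: complex_vector.scale_minus_left)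
      have "\<forall>x\<in>insert s S. e u x = 0"
        using eu insert.prems(1) w w0 by auto
      then have "e u v = 0" using insert.prems uW by auto
      moreover have "(- e w0 v) *\<^sub>C s \<in> V" using complex_vector.subspace_scale[OF V sV] .
      ultimately show ?thesis
        unfolding v'_def
        using eu insert.prems eV(1)[OF w(1)] eV(2)[OF w(1) sV sV, of "- e w0 v"] w sV
        by (simp add: mult.commute del: complex_vector.scale_minus_left)
    qed
    then have "v' \<in> cspan S" using insert v'V by auto
    then have "v' \<in> cspan (insert s S)" using complex_vector.span_mono[of S "insert s S"] by auto
    moreover have "v = v' + e w0 v *\<^sub>C s" by (simp add: v'_def)
    ultimately show ?thesis
      by (metis complex_vector.span_add complex_vector.span_base complex_vector.span_scale insertI1)
  qed
qed

text \<open>Independence keeps \<open>b\<close> out of the span of \<open>B - {b}\<close>, so by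
  \<open>double_annihilator\<close> some vector of \<open>W\<close> kills the others but not
  \<open>b\<close>; it is then rescaled.\<close>

lemma dual_family:
  fixes e :: "'w::complex_vector \<Rightarrow> 'v::complex_vector \<Rightarrow> complex"
  assumes W: "csubspace W" and V: "csubspace V" and e: "bilinear_on W V e"
    and nondeg: "\<And>x. x \<in> V \<Longrightarrow> \<forall>w\<in>W. e w x = 0 \<Longrightarrow> x = 0"
    and B: "finite B" "B \<subseteq> V" "complex_vector.independent B"
  obtains \<omega> where "\<And>b. b \<in> B \<Longrightarrow> \<omega> b \<in> W"
    "\<And>b b'. b \<in> B \<Longrightarrow> b' \<in> B \<Longrightarrow> e (\<omega> b) b' = (if b = b' then 1 else 0)"
proof -
  have "\<exists>w\<in>W. \<forall>b'\<in>B. e w b' = (if b = b' then 1 else 0)" if b: "b \<in> B" for b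
  proof -
    have "b \<notin> cspan (B - {b})"
      using B(3) b by (simp add: complex_vector.dependent_def)
    then obtain w1 where w1: "w1 \<in> W" "\<forall>s\<in>B - {b}. e w1 s = 0" "e w1 b \<noteq> 0"
      using double_annihilator[OF W V e nondeg, of "B - {b}" b] B b by blast
    then have "\<forall>b'\<in>B. e ((1 / e w1 b) *\<^sub>C w1) b' = (if b = b' then 1 else 0)"
      using e B(2) by (auto simp: bilinear_on_def linear_on_def scaleC_complex_def subset_iff)
    then show ?thesis using complex_vector.subspace_scale[OF W w1(1)] by blast
  qed
  then show thesis using that by metis
qed

text \<open>Preimages \<open>G\<close> of a finite basis of the image suffice, because vectors with
  equal image differ by an element of the kernel.\<close>

lemma finite_rank_generators:
  fixes f :: "'a::complex_vector \<Rightarrow> 'b::complex_vector"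
  assumes W: "csubspace W" and f: "clinear f" and S: "finite S" "f ` W \<subseteq> cspan S"
  obtains G where "finite G" "G \<subseteq> W" "W \<subseteq> cspan (G \<union> {w \<in> W. f w = 0})"
proof -
  obtain B where B: "B \<subseteq> f ` W" "complex_vector.independent B" "f ` W \<subseteq> cspan B"
    using complex_vector.maximal_independent_subset by blast
  have "finite B"
    using complex_vector.independent_span_bound[OF S(1) B(2)] B(1) S(2) by auto
  then obtain G where G: "finite G" "G \<subseteq> W" "f ` G = B"
    using B(1) by (metis finite_subset_image)
  show thesis
  proof (rule that[OF G(1,2)], rule subsetI)
    fix w assume w: "w \<in> W"
    then have "f w \<in> f ` cspan G"
      using B(3) G(3) complex_vector_pair.linear_span_image[OF f, of G] by auto
    then obtain u where u: "u \<in> cspan G" "f w = f u" by auto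
    have "u \<in> W" using u(1) complex_vector.span_minimal[OF G(2) W] by auto
    then have "w - u \<in> {w \<in> W. f w = 0}"
      using w u(2) complex_vector.subspace_diff[OF W] complex_vector_pair.linear_diff[OF f] by auto
    then have "w - u \<in> cspan (G \<union> {w \<in> W. f w = 0})" by (simp add: complex_vector.span_base)
    moreover have "u \<in> cspan (G \<union> {w \<in> W. f w = 0})"
      using u(1) complex_vector.span_mono[of G "G \<union> {w \<in> W. f w = 0}"] by auto
    ultimately show "w \<in> cspan (G \<union> {w \<in> W. f w = 0})"
      using complex_vector.span_add by fastforce
  qed
qed

section \<open>Tensors\<close>

lemma tensor_pure_add_left: "(x + x') \<otimes> y = x \<otimes> y + x' \<otimes> y"
  and tensor_pure_add_right: "x \<otimes> (y + y') = x \<otimes> y + x \<otimes> y'"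
  and tensor_pure_scale_left: "(c *\<^sub>C x) \<otimes> y = c *\<^sub>C (x \<otimes> y)"
  and tensor_pure_scale_right: "x \<otimes> (c *\<^sub>C y) = c *\<^sub>C (x \<otimes> y)"
  for x x' :: "'a::complex_vector" and y y' :: "'b::complex_vector"
  using tensor_pure_bilinear[where 'a='a and 'b='b] by (auto simp: bilinear_on_def linear_on_def)

lemma tensor_pure_zero_left [simp]: "0 \<otimes> y = 0"
  and tensor_pure_zero_right [simp]: "x \<otimes> 0 = 0"
  using tensor_pure_scale_left[of 0 0 y] tensor_pure_scale_right[of x 0 0] by simp_all

lemmas tensor_pure_simps =
  tensor_pure_add_left tensor_pure_add_right tensor_pure_scale_left tensor_pure_scale_right

text \<open>There is no case for scalars: a coefficient is absorbed into the first factor, which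
  stays in the subspace \<open>V\<close>.\<close>

lemma tensor_on_induct [consumes 2, case_names zero pure add]:
  assumes "T \<in> tensor_on V W" "csubspace V"
    and "P 0" "\<And>x y. x \<in> V \<Longrightarrow> y \<in> W \<Longrightarrow> P (x \<otimes> y)" "\<And>S T. P S \<Longrightarrow> P T \<Longrightarrow> P (S + T)"
  shows "P T"
  using assms(1) unfolding tensor_on_def
proof (induction rule: complex_vector.span_induct_alt)
  case base
  then show ?case by (rule assms(3))
next
  case (step c s T)
  then obtain x y where "s = x \<otimes> y" "x \<in> V" "y \<in> W" by auto
  then have "P (c *\<^sub>C s)"
    using assms(4)[of "c *\<^sub>C x" y] complex_vector.subspace_scale[OF assms(2)]
    by (simp add: tensor_pure_scale_left)
  then show ?case using step assms(5) by blast
qed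

text \<open>Every class has a representative that is a finite combination of free generators, whose
  classes are the pure tensors.\<close>

lemma tensor_on_UNIV: "tensor_on UNIV UNIV = (UNIV :: ('a::complex_vector, 'b::complex_vector) tensor set)"
proof -
  have single: "abs_tensor (Poly_Mapping.single k v) \<in> tensor_on UNIV UNIV" for k :: "'a \<times> 'b" and v
  proof -
    have "Poly_Mapping.single k v = v *\<^sub>C free_gen (fst k) (snd k)"
      by (rule poly_mapping_eqI) (simp add: lookup_scaleC lookup_single when_def scaleC_complex_def)
    then have "abs_tensor (Poly_Mapping.single k v) = v *\<^sub>C (fst k \<otimes> snd k)"
      by (simp add: scaleC_tensor.abs_eq tensor_pure.abs_eq)
    then show ?thesis
      unfolding tensor_on_def
      by (metis (mono_tags, lifting) UNIV_I complex_vector.span_base complex_vector.span_scale mem_Collect_eq)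
  qed
  have sum: "abs_tensor (\<Sum>k\<in>A. Poly_Mapping.single k (u k)) \<in> tensor_on UNIV UNIV"
    for A :: "('a \<times> 'b) set" and u
  proof (induction A rule: infinite_finite_induct)
    case (insert k A)
    then show ?case
      using single[of k "u k"] unfolding tensor_on_def
      by (simp add: plus_tensor.abs_eq[symmetric] complex_vector.span_add)
  qed (simp_all add: zero_tensor.abs_eq[symmetric] tensor_on_def complex_vector.span_zero)
  have "f = (\<Sum>k\<in>Poly_Mapping.keys f. Poly_Mapping.single k (Poly_Mapping.lookup f k))"
    for f :: "('a \<times> 'b) \<Rightarrow>\<^sub>0 complex"
    by (rule poly_mapping_eqI)
      (simp add: lookup_sum lookup_single when_def sum.delta' in_keys_iff)
  then have "abs_tensor f \<in> tensor_on UNIV UNIV" for f :: "('a \<times> 'b) \<Rightarrow>\<^sub>0 complex"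
    by (metis sum)
  moreover have "\<exists>f. T = abs_tensor f" for T :: "('a, 'b) tensor"
    by (metis Quotient3_abs_rep[OF Quotient3_tensor])
  ultimately show ?thesis by (metis UNIV_eq_I)
qed

lemma tensor_induct [case_names zero pure add]:
  fixes T :: "('a::complex_vector, 'b::complex_vector) tensor"
  assumes "P 0" "\<And>x y. P (x \<otimes> y)" "\<And>S T. P S \<Longrightarrow> P T \<Longrightarrow> P (S + T)"
  shows "P T"
  using tensor_on_induct[of T UNIV UNIV P] assms by (simp add: tensor_on_UNIV)

lemma csubspace_tensor_on: "csubspace (tensor_on V W)"
  unfolding tensor_on_def by (rule complex_vector.subspace_span)

lemma tensor_onI: "x \<in> V \<Longrightarrow> y \<in> W \<Longrightarrow> x \<otimes> y \<in> tensor_on V W"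
  unfolding tensor_on_def by (auto intro: complex_vector.span_base)

lemma tensor_on_sum_list:
  assumes "T \<in> tensor_on V W" "csubspace V"
  obtains ps where "set ps \<subseteq> V \<times> W" "T = (\<Sum>(x, y)\<leftarrow>ps. x \<otimes> y)"
proof -
  have "\<exists>ps. set ps \<subseteq> V \<times> W \<and> T = (\<Sum>(x, y)\<leftarrow>ps. x \<otimes> y)"
    using assms
  proof (induction T rule: tensor_on_induct)
    case zero
    show ?case by (rule exI[of _ "[]"]) simp
  next
    case (pure x y)
    then show ?case by (intro exI[of _ "[(x, y)]"]) simp
  next
    case (add S T)
    then obtain ps qs where "set ps \<subseteq> V \<times> W" "S = (\<Sum>(x, y)\<leftarrow>ps. x \<otimes> y)"
      "set qs \<subseteq> V \<times> W" "T = (\<Sum>(x, y)\<leftarrow>qs. x \<otimes> y)" by blast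
    then show ?case by (intro exI[of _ "ps @ qs"]) simp
  qed
  then show thesis using that by blast
qed

text \<open>Trades the \<open>THE\<close> in the definition of the lift for a map that is linear on
  the whole type.\<close>

lemma tensor_lift_on_agree:
  assumes "csubspace V" "csubspace W" "bilinear_on V W \<beta>" "T \<in> tensor_on V W"
    and g: "clinear g" "\<And>x y. x \<in> V \<Longrightarrow> y \<in> W \<Longrightarrow> g (x \<otimes> y) = \<beta> x y"
  shows "tensor_lift_on V W \<beta> T = g T"
proof -
  obtain ps where ps: "set ps \<subseteq> V \<times> W" "T = (\<Sum>(x, y)\<leftarrow>ps. x \<otimes> y)"
    using tensor_on_sum_list[OF assms(4,1)] .
  show ?thesis
    unfolding ps(2) using tensor_lift_on_sum[OF assms(1-3) ps(1)]
      clinear_sum_list_pure[OF g(1) ps(1), of \<beta>] g(2) by simp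
qed

lemma tensor_lift_on_pure:
  assumes "csubspace V" "csubspace W" "bilinear_on V W \<beta>" "x \<in> V" "y \<in> W"
  shows "tensor_lift_on V W \<beta> (x \<otimes> y) = \<beta> x y"
  using tensor_lift_on_sum[OF assms(1-3), of "[(x, y)]"] assms(4,5) by simp

lemma clinear_tensor_lift:
  assumes "bilinear_on UNIV UNIV \<beta>"
  shows "clinear (tensor_lift \<beta>)"
proof -
  obtain g where g: "clinear g" "\<forall>x y. g (x \<otimes> y) = \<beta> x y" using tensor_universal[OF assms] by blast
  then have "tensor_lift \<beta> = g"
    by (intro ext tensor_lift_on_agree[OF _ _ assms]) (auto simp: tensor_on_UNIV)
  then show ?thesis using g(1) by simp
qed

lemma tensor_lift_pure:
  assumes "bilinear_on UNIV UNIV \<beta>"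
  shows "tensor_lift \<beta> (x \<otimes> y) = \<beta> x y"
  by (rule tensor_lift_on_pure[OF _ _ assms]) simp_all

lemma bilinear_onI:
  assumes "\<And>x x' y. x \<in> V \<Longrightarrow> x' \<in> V \<Longrightarrow> y \<in> W \<Longrightarrow> \<beta> (x + x') y = \<beta> x y + \<beta> x' y"
    "\<And>c x y. x \<in> V \<Longrightarrow> y \<in> W \<Longrightarrow> \<beta> (c *\<^sub>C x) y = c *\<^sub>C \<beta> x y"
    "\<And>x y y'. x \<in> V \<Longrightarrow> y \<in> W \<Longrightarrow> y' \<in> W \<Longrightarrow> \<beta> x (y + y') = \<beta> x y + \<beta> x y'"
    "\<And>c x y. x \<in> V \<Longrightarrow> y \<in> W \<Longrightarrow> \<beta> x (c *\<^sub>C y) = c *\<^sub>C \<beta> x y"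
  shows "bilinear_on V W \<beta>"
  using assms by (simp add: bilinear_on_def linear_on_def)

lemma
  assumes "clinear f" "clinear g"
  shows clinear_tensor_map: "clinear (tensor_map f g)"
    and tensor_map_pure: "tensor_map f g (x \<otimes> y) = f x \<otimes> g y"
proof -
  have b: "bilinear_on UNIV UNIV (\<lambda>x y. f x \<otimes> g y)"
    by (intro bilinear_onI) (simp_all add: tensor_pure_simps complex_vector_pair.linear_add[OF assms(1)]
      complex_vector_pair.linear_scale[OF assms(1)] complex_vector_pair.linear_add[OF assms(2)]
      complex_vector_pair.linear_scale[OF assms(2)])
  show "clinear (tensor_map f g)" "tensor_map f g (x \<otimes> y) = f x \<otimes> g y"
    unfolding tensor_map_def using clinear_tensor_lift[OF b] tensor_lift_pure[OF b] by auto
qed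

lemma clinear_tensor_swap: "clinear tensor_swap"
  and tensor_swap_pure: "tensor_swap (x \<otimes> y) = y \<otimes> x"
proof -
  have b: "bilinear_on UNIV UNIV (\<lambda>x y. y \<otimes> x)"
    by (intro bilinear_onI) (simp_all add: tensor_pure_simps)
  show "clinear tensor_swap" "tensor_swap (x \<otimes> y) = y \<otimes> x"
    unfolding tensor_swap_def using clinear_tensor_lift[OF b] tensor_lift_pure[OF b] by auto
qed

lemma
  fixes a :: "'a::lie_algebra"
  shows clinear_tensor_ad: "clinear (tensor_ad a)"
    and tensor_ad_pure: "tensor_ad a (x \<otimes> y) = bracket a x \<otimes> y + x \<otimes> bracket a y"
proof -
  have b: "bilinear_on UNIV UNIV (\<lambda>x y. bracket a x \<otimes> y + x \<otimes> bracket a y)"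
    by (intro bilinear_onI)
      (simp_all add: tensor_pure_simps bracket_add_right bracket_scaleC_right algebra_simps
        complex_vector.scale_right_distrib)
  show "clinear (tensor_ad a)" "tensor_ad a (x \<otimes> y) = bracket a x \<otimes> y + x \<otimes> bracket a y"
    unfolding tensor_ad_def using clinear_tensor_lift[OF b] tensor_lift_pure[OF b] by auto
qed

lemma
  fixes a b c :: "'a::complex_vector"
  shows clinear_tensor_cycle: "clinear (tensor_cycle :: (('a, 'a) tensor, 'a) tensor \<Rightarrow> _)"
    and tensor_cycle_pure: "tensor_cycle (a \<otimes> b \<otimes> c) = c \<otimes> a \<otimes> b"
proof -
  have b1: "bilinear_on UNIV UNIV (\<lambda>(a::'a) (b::'a). c \<otimes> a \<otimes> b)" for c :: 'a
    by (intro bilinear_onI) (simp_all add: tensor_pure_simps)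
  define \<Lambda> where "\<Lambda> c = tensor_lift (\<lambda>(a::'a) (b::'a). c \<otimes> a \<otimes> b)" for c :: 'a
  have l: "clinear (\<Lambda> c)" and p: "\<Lambda> c (x \<otimes> y) = c \<otimes> x \<otimes> y" for c x y
    unfolding \<Lambda>_def using clinear_tensor_lift[OF b1] tensor_lift_pure[OF b1] by auto
  note \<Lambda> = complex_vector_pair.linear_add[OF l] complex_vector_pair.linear_scale[OF l]
    complex_vector_pair.linear_0[OF l] p
  \<comment> \<open>The dependence on \<open>c\<close> is hidden inside the lift, so linearity in
    \<open>c\<close> is recovered by induction on \<open>s\<close>.\<close>
  have r: "\<Lambda> (c + c') s = \<Lambda> c s + \<Lambda> c' s" "\<Lambda> (k *\<^sub>C c) s = k *\<^sub>C \<Lambda> c s" for c c' k s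
    by (induction s rule: tensor_induct)
      (simp_all add: \<Lambda> tensor_pure_simps complex_vector.scale_right_distrib)
  have b: "bilinear_on UNIV UNIV (\<lambda>s c. \<Lambda> c s)"
    by (intro bilinear_onI) (simp_all add: \<Lambda> r)
  show "clinear (tensor_cycle :: (('a, 'a) tensor, 'a) tensor \<Rightarrow> _)"
    using clinear_tensor_lift[OF b] unfolding tensor_cycle_def \<Lambda>_def .
  show "tensor_cycle (a \<otimes> b \<otimes> c) = c \<otimes> a \<otimes> b"
    using tensor_lift_pure[OF b, of "a \<otimes> b" c] p[of c a b] unfolding tensor_cycle_def \<Lambda>_def by simp
qed

lemma bilinear_on_mult:
  fixes f :: "'a::complex_vector \<Rightarrow> complex" and g :: "'b::complex_vector \<Rightarrow> complex"
  assumes "clinear f" "clinear g"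
  shows "bilinear_on UNIV UNIV (\<lambda>x y. f x * g y)"
  by (intro bilinear_onI)
    (simp_all add: complex_vector_pair.linear_add[OF assms(1)] complex_vector_pair.linear_scale[OF assms(1)]
      complex_vector_pair.linear_add[OF assms(2)] complex_vector_pair.linear_scale[OF assms(2)]
      scaleC_complex_def algebra_simps)

text \<open>Collect \<open>T\<close> as a sum of \<open>b \<otimes> y b\<close> over independent
  \<open>b\<close>. For each \<open>g\<close>, the combination of the \<open>b\<close> with
  coefficients \<open>g (y b)\<close> is killed by all of \<open>\<Phi>\<close>, hence zero; so all
  \<open>g (y b)\<close> vanish, and \<open>\<Psi>\<close> gives \<open>y b = 0\<close>.\<close>

lemma tensor_functionals_separate:
  fixes T :: "('a::complex_vector, 'b::complex_vector) tensor"
  assumes V: "csubspace V" and W: "csubspace W" and T: "T \<in> tensor_on V W"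
    and \<Phi>: "\<And>f. f \<in> \<Phi> \<Longrightarrow> clinear f" "\<And>x. x \<in> V \<Longrightarrow> \<forall>f\<in>\<Phi>. f x = (0::complex) \<Longrightarrow> x = 0"
    and \<Psi>: "\<And>g. g \<in> \<Psi> \<Longrightarrow> clinear g" "\<And>y. y \<in> W \<Longrightarrow> \<forall>g\<in>\<Psi>. g y = (0::complex) \<Longrightarrow> y = 0"
    and zero: "\<And>f g. f \<in> \<Phi> \<Longrightarrow> g \<in> \<Psi> \<Longrightarrow> tensor_lift (\<lambda>x y. f x * g y) T = 0"
  shows "T = 0"
proof -
  obtain ps where ps: "set ps \<subseteq> V \<times> W" "T = (\<Sum>(x, y)\<leftarrow>ps. x \<otimes> y)"
    using tensor_on_sum_list[OF T V] .
  obtain B where B: "B \<subseteq> fst ` set ps" "complex_vector.independent B" "fst ` set ps \<subseteq> cspan B"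
    using complex_vector.maximal_independent_subset by blast
  have finB: "finite B" using B(1) finite_subset by blast
  have BV: "B \<subseteq> V" using B(1) ps(1) by force
  \<comment> \<open>Generalised to sublists \<open>qs\<close> so that the basis taken from
    \<open>ps\<close> stays fixed during the induction.\<close>
  have "\<exists>y. (\<forall>b\<in>B. y b \<in> W) \<and> (\<Sum>(x, y)\<leftarrow>qs. x \<otimes> y) = (\<Sum>b\<in>B. b \<otimes> y b)"
    if "set qs \<subseteq> set ps" for qs
    using that
  proof (induction qs)
    case Nil
    show ?case by (rule exI[of _ "\<lambda>_. 0"]) (simp add: complex_vector.subspace_0[OF W])
  next
    case (Cons q qs)
    obtain x z where q: "q = (x, z)" by force
    obtain y where y: "\<forall>b\<in>B. y b \<in> W" "(\<Sum>(x, y)\<leftarrow>qs. x \<otimes> y) = (\<Sum>b\<in>B. b \<otimes> y b)"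
      using Cons by auto
    have "x \<in> cspan B" "z \<in> W" using Cons.prems q B(3) ps(1) by force+
    then obtain u where u: "x = (\<Sum>b\<in>B. u b *\<^sub>C b)"
      using complex_vector.span_finite[OF finB] by auto
    have "x \<otimes> z = (\<Sum>b\<in>C. (u b *\<^sub>C b)) \<otimes> z \<Longrightarrow> x \<otimes> z = (\<Sum>b\<in>C. (u b *\<^sub>C b) \<otimes> z)"
      if "finite C" for C
      using that by (induction C arbitrary: x rule: finite_induct) (auto simp: tensor_pure_simps)
    from this[OF finB] have "x \<otimes> z = (\<Sum>b\<in>B. b \<otimes> (u b *\<^sub>C z))"
      using u by (simp add: tensor_pure_simps)
    then have "(\<Sum>(x, y)\<leftarrow>q # qs. x \<otimes> y) = (\<Sum>b\<in>B. b \<otimes> (u b *\<^sub>C z + y b))"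
      by (simp add: q y(2) tensor_pure_add_right sum.distrib)
    moreover have "\<forall>b\<in>B. u b *\<^sub>C z + y b \<in> W"
      using y(1) \<open>z \<in> W\<close> complex_vector.subspace_add[OF W] complex_vector.subspace_scale[OF W] by blast
    ultimately show ?case by (intro exI[of _ "\<lambda>b. u b *\<^sub>C z + y b"]) simp
  qed
  from this[of ps] obtain y where y: "\<forall>b\<in>B. y b \<in> W" "T = (\<Sum>b\<in>B. b \<otimes> y b)" using ps(2) by auto
  have "g (y b) = 0" if g: "g \<in> \<Psi>" and b: "b \<in> B" for g b
  proof -
    define v where "v = (\<Sum>b\<in>B. g (y b) *\<^sub>C b)"
    have "f v = 0" if f: "f \<in> \<Phi>" for f
    proof -
      note bl = bilinear_on_mult[OF \<Phi>(1)[OF f] \<Psi>(1)[OF g]]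
      have "tensor_lift (\<lambda>x y. f x * g y) T = (\<Sum>b\<in>B. f b * g (y b))"
        by (simp add: y(2) complex_vector_pair.linear_sum[OF clinear_tensor_lift[OF bl]]
            tensor_lift_pure[OF bl])
      then show ?thesis
        using zero[OF f g]
        by (simp add: v_def complex_vector_pair.linear_sum[OF \<Phi>(1)[OF f]]
            complex_vector_pair.linear_scale[OF \<Phi>(1)[OF f]] scaleC_complex_def mult.commute)
    qed
    moreover have "v \<in> V"
      unfolding v_def using BV V
      by (intro complex_vector.subspace_sum complex_vector.subspace_scale) auto
    ultimately have "v = 0" using \<Phi>(2) by blast
    then show ?thesis
      using complex_vector.independentD[OF B(2) finB order_refl, of "\<lambda>b. g (y b)" b] b
      by (simp add: v_def)
  qed
  then have "\<forall>b\<in>B. y b = 0" using \<Psi>(2) y(1) by blast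
  then show ?thesis by (simp add: y(2))
qed

section \<open>The adjoint action on tensors\<close>

lemma bracket_minus_left: "bracket (- x) y = - bracket x (y :: 'a::lie_algebra)"
  using bracket_scaleC_left[of "- 1" x y] by simp

lemma bracket_minus_right: "bracket x (- y) = - bracket x (y :: 'a::lie_algebra)"
  using bracket_scaleC_right[of x "- 1" y] by simp

lemma bracket_bracket_left:
  "bracket (bracket a b) x = bracket a (bracket b x) - bracket b (bracket a (x :: 'a::lie_algebra))"
proof -
  have "bracket b (bracket x a) = - bracket b (bracket a x)"
    using bracket_anticomm[of x a] by (simp add: bracket_minus_right)
  then show ?thesis
    using jacobi[of a b x] bracket_anticomm[of "bracket a b" x]
    by (simp add: eq_neg_iff_add_eq_0[symmetric] algebra_simps)
qed

lemma tensor_pure_diff_left: "(x - x') \<otimes> y = x \<otimes> y - x' \<otimes> y"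
  using tensor_pure_add_left[of "x - x'" x' y] by simp

lemma tensor_pure_diff_right: "x \<otimes> (y - y') = x \<otimes> y - x \<otimes> y'"
  using tensor_pure_add_right[of x "y - y'" y'] by simp

text \<open>By Jacobi the diagonal adjoint action is a representation; this gives the cocycle
  identity for the coboundary of \<open>t\<close>.\<close>

lemma tensor_ad_bracket:
  "tensor_ad (bracket a b) t = tensor_ad a (tensor_ad b t) - tensor_ad b (tensor_ad a t)"
  by (induction t rule: tensor_induct)
    (simp_all add: complex_vector_pair.linear_add[OF clinear_tensor_ad]
      complex_vector_pair.linear_0[OF clinear_tensor_ad] tensor_ad_pure bracket_bracket_left
      tensor_pure_diff_left tensor_pure_diff_right)

lemma tensor_ad_add_left: "tensor_ad (a + b) t = tensor_ad a t + tensor_ad b t"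
  by (induction t rule: tensor_induct)
    (simp_all add: complex_vector_pair.linear_add[OF clinear_tensor_ad]
      complex_vector_pair.linear_0[OF clinear_tensor_ad] tensor_ad_pure bracket_add_left
      tensor_pure_simps algebra_simps)

lemma tensor_ad_scale_left: "tensor_ad (c *\<^sub>C a) t = c *\<^sub>C tensor_ad a t"
  by (induction t rule: tensor_induct)
    (simp_all add: complex_vector_pair.linear_add[OF clinear_tensor_ad]
      complex_vector_pair.linear_0[OF clinear_tensor_ad] tensor_ad_pure bracket_scaleC_left
      tensor_pure_simps complex_vector.scale_right_distrib)

lemma tensor_swap_ad: "tensor_swap (tensor_ad a t) = tensor_ad a (tensor_swap t)"
  by (induction t rule: tensor_induct)
    (simp_all add: complex_vector_pair.linear_add[OF clinear_tensor_ad]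
      complex_vector_pair.linear_0[OF clinear_tensor_ad] tensor_ad_pure
      complex_vector_pair.linear_add[OF clinear_tensor_swap]
      complex_vector_pair.linear_0[OF clinear_tensor_swap] tensor_swap_pure add.commute)

lemma tensor_ad_in_tensor_on:
  assumes V: "lie_algebra_on V" and a: "a \<in> V" and t: "t \<in> tensor_on V V"
  shows "tensor_ad a t \<in> tensor_on V V"
proof -
  have "csubspace V" using V by (simp add: lie_subalgebra_def)
  with t show ?thesis
  proof (induction t rule: tensor_on_induct)
    case (pure x y)
    then show ?case
      using V a unfolding tensor_ad_pure
      by (intro complex_vector.subspace_add[OF csubspace_tensor_on] tensor_onI)
        (auto simp: lie_subalgebra_def)
  qed (simp_all add: complex_vector_pair.linear_add[OF clinear_tensor_ad]
        complex_vector_pair.linear_0[OF clinear_tensor_ad]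
        complex_vector.subspace_add[OF csubspace_tensor_on]
        complex_vector.subspace_0[OF csubspace_tensor_on])
qed

lemma csubspace_wedge2: "csubspace (wedge2 V)"
  unfolding wedge2_def complex_vector.subspace_def
  using csubspace_tensor_on[of V V]
  by (auto simp: complex_vector.subspace_def complex_vector_pair.linear_add[OF clinear_tensor_swap]
      complex_vector_pair.linear_0[OF clinear_tensor_swap]
      complex_vector_pair.linear_scale[OF clinear_tensor_swap])

lemma alt3_in_tensor_on:
  assumes V: "csubspace V" and u: "u \<in> tensor_on (tensor_on V V) V"
  shows "alt3 u \<in> tensor_on (tensor_on V V) V"
proof -
  have cyc: "tensor_cycle u \<in> tensor_on (tensor_on V V) V" if "u \<in> tensor_on (tensor_on V V) V" for u
    using that csubspace_tensor_on
  proof (induction u rule: tensor_on_induct)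
    case (pure s c)
    from pure(1) V show ?case
    proof (induction s rule: tensor_on_induct)
      case (add s s')
      then show ?case
        by (simp add: tensor_pure_add_left complex_vector_pair.linear_add[OF clinear_tensor_cycle]
          complex_vector.subspace_add[OF csubspace_tensor_on])
    qed (simp_all add: tensor_cycle_pure tensor_onI pure(2)
        complex_vector_pair.linear_0[OF clinear_tensor_cycle]
        complex_vector.subspace_0[OF csubspace_tensor_on])
  qed (simp_all add: complex_vector_pair.linear_add[OF clinear_tensor_cycle]
        complex_vector_pair.linear_0[OF clinear_tensor_cycle]
        complex_vector.subspace_add[OF csubspace_tensor_on]
        complex_vector.subspace_0[OF csubspace_tensor_on])
  show ?thesis
    unfolding alt3_def using u cyc
    by (intro complex_vector.subspace_add[OF csubspace_tensor_on]) auto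
qed

section \<open>Lagrangian complements and twists\<close>

text \<open>\<open>L\<close> plays the loop algebra, \<open>d\<close> its diagonal embedding and
  \<open>R\<close> the double. Tensors are kept over \<open>L\<close> and complements inside
  \<open>R\<close>; \<open>d\<close> passes between the two.\<close>

locale isotropic_embedding =
  fixes L :: "'l::lie_algebra set" and d :: "'l \<Rightarrow> 'r::lie_algebra"
    and R :: "'r set" and F :: "'r \<Rightarrow> 'r \<Rightarrow> complex"
  assumes L: "lie_algebra_on L" and R: "lie_algebra_on R"
    and F: "bilinear_on R R F"
    and F_sym: "\<And>x y. x \<in> R \<Longrightarrow> y \<in> R \<Longrightarrow> F x y = F y x"
    and F_inv: "\<And>x y z. x \<in> R \<Longrightarrow> y \<in> R \<Longrightarrow> z \<in> R \<Longrightarrow> F (bracket x y) z = F x (bracket y z)"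
    and F_nondeg: "orthogonal_in R F R = {0}"
    and d: "clinear d" and d_bracket: "\<And>x y. d (bracket x y) = bracket (d x) (d y)"
    and d_inj: "inj d" and d_R: "\<And>x. x \<in> L \<Longrightarrow> d x \<in> R"
    and d_iso: "\<And>x y. x \<in> L \<Longrightarrow> y \<in> L \<Longrightarrow> F (d x) (d y) = 0"
begin

section \<open>The invariant form and its evaluation functionals\<close>

lemma R_sub: "csubspace R" and R_bracket: "x \<in> R \<Longrightarrow> y \<in> R \<Longrightarrow> bracket x y \<in> R"
  and L_sub: "csubspace L" and L_bracket: "a \<in> L \<Longrightarrow> b \<in> L \<Longrightarrow> bracket a b \<in> L"
  using R L by (auto simp: lie_subalgebra_def)

lemmas R_add = complex_vector.subspace_add[OF R_sub]
lemmas L_add = complex_vector.subspace_add[OF L_sub]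
lemmas d_linear = complex_vector_pair.linear_add[OF d] complex_vector_pair.linear_scale[OF d]
  complex_vector_pair.linear_0[OF d] complex_vector_pair.linear_neg[OF d]
  complex_vector_pair.linear_diff[OF d]

lemma F_add: "x \<in> R \<Longrightarrow> y \<in> R \<Longrightarrow> z \<in> R \<Longrightarrow> F (x + y) z = F x z + F y z"
    "x \<in> R \<Longrightarrow> y \<in> R \<Longrightarrow> z \<in> R \<Longrightarrow> F z (x + y) = F z x + F z y"
  and F_scale: "x \<in> R \<Longrightarrow> z \<in> R \<Longrightarrow> F (c *\<^sub>C x) z = c * F x z"
    "x \<in> R \<Longrightarrow> z \<in> R \<Longrightarrow> F z (c *\<^sub>C x) = c * F z x"
  using F by (auto simp: bilinear_on_def linear_on_def scaleC_complex_def)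

lemma F_minus: "x \<in> R \<Longrightarrow> z \<in> R \<Longrightarrow> F (- x) z = - F x z"
    "x \<in> R \<Longrightarrow> z \<in> R \<Longrightarrow> F z (- x) = - F z x"
  using F_scale[of x z "- 1"] by simp_all

lemma F_cyclic:
  assumes "x \<in> R" "y \<in> R" "z \<in> R"
  shows "F x (bracket y z) = F y (bracket z x)"
  using assms F_inv F_sym R_bracket by metis

text \<open>\<open>ev w\<close> extends \<open>x \<mapsto> F (d x) w\<close> linearly from \<open>L\<close> to the whole type, so that tensor maps built
  from it need no carriers.  It is meaningful only for \<open>w \<in> R\<close>.\<close>

definition ev :: "'r \<Rightarrow> 'l \<Rightarrow> complex" where
  "ev w = (SOME g. clinear g \<and> (\<forall>x\<in>L. g x = F (d x) w))"

lemma
  assumes "w \<in> R"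
  shows clinear_ev: "clinear (ev w)" and ev: "x \<in> L \<Longrightarrow> ev w x = F (d x) w"
proof -
  have "linear_on L (\<lambda>x. F (d x) w)"
    using assms d_R by (simp add: linear_on_def d_linear F_add F_scale scaleC_complex_def)
  then have "\<exists>g. clinear g \<and> (\<forall>x\<in>L. g x = F (d x) w)"
    using linear_on_extend[OF L_sub] by metis
  then have "clinear (ev w) \<and> (\<forall>x\<in>L. ev w x = F (d x) w)"
    unfolding ev_def by (rule someI_ex)
  then show "clinear (ev w)" "x \<in> L \<Longrightarrow> ev w x = F (d x) w" by auto
qed

lemma ev_linear: "w \<in> R \<Longrightarrow> ev w (x + y) = ev w x + ev w y"
    "w \<in> R \<Longrightarrow> ev w (c *\<^sub>C x) = c * ev w x" "w \<in> R \<Longrightarrow> ev w 0 = 0"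
  using complex_vector_pair.linear_add[OF clinear_ev] complex_vector_pair.linear_scale[OF clinear_ev]
    complex_vector_pair.linear_0[OF clinear_ev]
  by (simp_all add: scaleC_complex_def)

text \<open>Invariance of \<open>F\<close> makes the adjoint action skew-adjoint.\<close>

lemma ev_bracket:
  assumes "w \<in> R" "a \<in> L" "x \<in> L"
  shows "ev w (bracket a x) = - ev (bracket (d a) w) x"
proof -
  have "F (bracket (d a) (d x)) w = - F (d x) (bracket (d a) w)"
    using assms d_R R_bracket F_inv[of "d x" "d a" w] bracket_anticomm[of "d a" "d x"]
    by (simp add: F_minus)
  then show ?thesis using assms L_bracket R_bracket d_R by (simp add: ev d_bracket)
qed

text \<open>The image of \<open>d\<close> is isotropic, so \<open>ev\<close> depends on its argument
  only modulo that image.\<close>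

lemma ev_shift: "w \<in> R \<Longrightarrow> x \<in> L \<Longrightarrow> y \<in> L \<Longrightarrow> ev (w + d x) y = ev w y"
  using d_R R_add by (simp add: ev F_add d_iso)

section \<open>Pairings of tensors over \<open>L\<close> with elements of \<open>R\<close>\<close>

definition pair2 :: "'r \<Rightarrow> 'r \<Rightarrow> ('l, 'l) tensor \<Rightarrow> complex" where
  "pair2 v w = tensor_lift (\<lambda>x y. ev v x * ev w y)"

definition pair3 :: "'r \<Rightarrow> 'r \<Rightarrow> 'r \<Rightarrow> (('l, 'l) tensor, 'l) tensor \<Rightarrow> complex" where
  "pair3 u v w = tensor_lift (\<lambda>s z. pair2 u v s * ev w z)"

text \<open>The map \<open>f\<^sub>t\<close> of the theorem with its values pulled back along
  \<open>d\<close>; see \<open>tensor_contract_diag\<close>.\<close>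

definition contract :: "('l, 'l) tensor \<Rightarrow> 'r \<Rightarrow> 'l" where
  "contract t w = tensor_lift (\<lambda>x y. ev w x *\<^sub>C y) t"

lemma
  assumes "v \<in> R" "w \<in> R"
  shows clinear_pair2: "clinear (pair2 v w)" and pair2_pure: "pair2 v w (x \<otimes> y) = ev v x * ev w y"
  unfolding pair2_def
  using bilinear_on_mult[OF clinear_ev[OF assms(1)] clinear_ev[OF assms(2)]]
  by (simp_all add: clinear_tensor_lift tensor_lift_pure)

lemma
  assumes "u \<in> R" "v \<in> R" "w \<in> R"
  shows clinear_pair3: "clinear (pair3 u v w)"
    and pair3_pure: "pair3 u v w (s \<otimes> z) = pair2 u v s * ev w z"
  unfolding pair3_def
  using bilinear_on_mult[OF clinear_pair2[OF assms(1,2)] clinear_ev[OF assms(3)]]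
  by (simp_all add: clinear_tensor_lift tensor_lift_pure)

lemma
  assumes "w \<in> R"
  shows clinear_contract: "clinear (\<lambda>t. contract t w)"
    and contract_pure: "contract (x \<otimes> y) w = ev w x *\<^sub>C y"
proof -
  have "bilinear_on UNIV UNIV (\<lambda>x (y::'l). ev w x *\<^sub>C y)"
    using assms
    by (intro bilinear_onI) (simp_all add: ev_linear complex_vector.scale_left_distrib
      complex_vector.scale_right_distrib mult.commute)
  then show "clinear (\<lambda>t. contract t w)" "contract (x \<otimes> y) w = ev w x *\<^sub>C y"
    unfolding contract_def by (simp_all add: clinear_tensor_lift tensor_lift_pure)
qed

lemmas pair2_linear =
  complex_vector_pair.linear_add[OF clinear_pair2] complex_vector_pair.linear_0[OF clinear_pair2]
  complex_vector_pair.linear_neg[OF clinear_pair2]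

lemmas pair3_linear =
  complex_vector_pair.linear_add[OF clinear_pair3] complex_vector_pair.linear_0[OF clinear_pair3]

lemmas contract_linear =
  complex_vector_pair.linear_add[OF clinear_contract] complex_vector_pair.linear_0[OF clinear_contract]

lemma pair2_swap: "v \<in> R \<Longrightarrow> w \<in> R \<Longrightarrow> pair2 v w (tensor_swap t) = pair2 w v t"
  by (induction t rule: tensor_induct)
    (simp_all add: pair2_linear pair2_pure tensor_swap_pure
      complex_vector_pair.linear_add[OF clinear_tensor_swap]
      complex_vector_pair.linear_0[OF clinear_tensor_swap])

lemma pair2_wedge2: "t \<in> wedge2 V \<Longrightarrow> v \<in> R \<Longrightarrow> w \<in> R \<Longrightarrow> pair2 v w t = - pair2 w v t"
  using pair2_swap[of w v t] by (simp add: wedge2_def pair2_linear)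

text \<open>On pure tensors the cycle moves the last factor to the front, where it meets
  \<open>u\<close>; before the cycle \<open>u\<close> must stand last.\<close>

lemma pair3_cycle:
  assumes "u \<in> R" "v \<in> R" "w \<in> R"
  shows "pair3 u v w (tensor_cycle T) = pair3 v w u T"
proof (induction T rule: tensor_induct)
  case (pure s c)
  show ?case
    by (induction s rule: tensor_induct)
      (use assms in \<open>simp_all add: tensor_cycle_pure pair3_pure pair2_pure tensor_pure_add_left
        complex_vector_pair.linear_add[OF clinear_tensor_cycle] pair3_linear pair2_linear
        complex_vector_pair.linear_0[OF clinear_tensor_cycle] algebra_simps\<close>)
qed (use assms in \<open>simp_all add: pair3_linear complex_vector_pair.linear_0[OF clinear_tensor_cycle]
      complex_vector_pair.linear_add[OF clinear_tensor_cycle]\<close>)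

lemma pair3_alt3:
  assumes "u \<in> R" "v \<in> R" "w \<in> R"
  shows "pair3 u v w (alt3 T) = pair3 u v w T + pair3 v w u T + pair3 w u v T"
  using assms by (simp add: alt3_def pair3_linear pair3_cycle)

lemma pair2_contract:
  assumes "v \<in> R" "w \<in> R"
  shows "pair2 v w t = ev w (contract t v)"
  by (induction t rule: tensor_induct)
    (use assms in \<open>simp_all add: pair2_linear pair2_pure contract_linear contract_pure ev_linear\<close>)

text \<open>\<open>S\<close> collects the second factors of one finite expansion of
  \<open>t\<close>. They span a space containing the range of the contraction, so a \<open>w\<close>
  orthogonal to them is orthogonal to that range.\<close>

lemma contract_range:
  assumes "t \<in> tensor_on L L"
  obtains S where "finite S" "S \<subseteq> L" "\<And>w. w \<in> R \<Longrightarrow> contract t w \<in> cspan S"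
    "\<And>v w. v \<in> R \<Longrightarrow> w \<in> R \<Longrightarrow> \<forall>s\<in>S. ev w s = 0 \<Longrightarrow> pair2 v w t = 0"
proof -
  obtain ps where ps: "set ps \<subseteq> L \<times> L" "t = (\<Sum>(x, y)\<leftarrow>ps. x \<otimes> y)"
    using tensor_on_sum_list[OF assms L_sub] .
  let ?S = "snd ` set ps"
  have "contract (\<Sum>(x, y)\<leftarrow>qs. x \<otimes> y) w \<in> cspan (snd ` set qs)" if "w \<in> R" for w qs
  proof (induction qs)
    case Nil
    then show ?case using that by (simp add: contract_linear complex_vector.span_zero)
  next
    case (Cons q qs)
    have "cspan (snd ` set qs) \<subseteq> cspan (snd ` set (q # qs))"
      by (intro complex_vector.span_mono) auto
    then have "ev w (fst q) *\<^sub>C snd q + contract (\<Sum>(x, y)\<leftarrow>qs. x \<otimes> y) w \<in> cspan (snd ` set (q # qs))"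
      using Cons
      by (intro complex_vector.span_add complex_vector.span_scale) (auto intro: complex_vector.span_base)
    then show ?case
      using that by (simp add: contract_linear contract_pure case_prod_unfold)
  qed
  then have c: "contract t w \<in> cspan ?S" if "w \<in> R" for w using that ps(2) by simp
  have "pair2 v w t = 0" if vw: "v \<in> R" "w \<in> R" "\<forall>s\<in>?S. ev w s = 0" for v w
    using complex_vector_pair.linear_eq_0_on_span[OF clinear_ev[OF vw(2)] _ c[OF vw(1)]] vw
    by (simp add: pair2_contract)
  moreover have "?S \<subseteq> L" using ps(1) by force
  ultimately show thesis using that[of ?S] c by simp
qed

lemma contract_in: "t \<in> tensor_on L L \<Longrightarrow> w \<in> R \<Longrightarrow> contract t w \<in> L"
  by (metis contract_range complex_vector.span_minimal L_sub subset_iff)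

lemma contract_linear_on:
  assumes "t \<in> tensor_on L L"
  shows "linear_on R (contract t)"
  using assms L_sub
proof (induction t rule: tensor_on_induct)
  case (pure x y)
  then show ?case using R_sub d_R
    by (simp add: linear_on_def contract_pure R_add ev F_add F_scale
       complex_vector.subspace_scale[OF R_sub] complex_vector.scale_left_distrib)
next
  case (add S T)
  then show ?case
    by (simp add: linear_on_def contract_linear R_add complex_vector.subspace_scale[OF R_sub]
      complex_vector.scale_right_distrib)
qed (simp add: linear_on_def contract_linear R_add complex_vector.subspace_scale[OF R_sub])

section \<open>Comparison with \<open>tensor_contract\<close> and \<open>tensor_form\<close>\<close>

lemma d_L_sub: "csubspace (d ` L)"
  using complex_vector_pair.linear_subspace_image[OF d L_sub] .

lemma tensor_contract_diag:
  assumes "t \<in> tensor_on L L" "w \<in> R"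
  shows "tensor_contract (d ` L) F (tensor_map d d t) w = d (contract t w)"
proof -
  obtain ps where ps: "set ps \<subseteq> L \<times> L" "t = (\<Sum>(x, y)\<leftarrow>ps. x \<otimes> y)"
    using tensor_on_sum_list[OF assms(1) L_sub] .
  let ?qs = "map (\<lambda>(x, y). (d x, d y)) ps"
  have 1: "tensor_map d d (\<Sum>(x, y)\<leftarrow>ps. x \<otimes> y) = (\<Sum>(x, y)\<leftarrow>map (\<lambda>(x, y). (d x, d y)) ps. x \<otimes> y)" for ps
    by (induction ps) (auto simp: complex_vector_pair.linear_0[OF clinear_tensor_map[OF d d]]
      complex_vector_pair.linear_add[OF clinear_tensor_map[OF d d]] tensor_map_pure[OF d d])
  have "bilinear_on (d ` L) (d ` L) (\<lambda>a b. F w a *\<^sub>C b)"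
    using assms(2) d_R
    by (intro bilinear_onI) (auto simp: F_add F_scale complex_vector.scale_left_distrib
      complex_vector.scale_right_distrib mult.commute)
  then have "tensor_contract (d ` L) F (tensor_map d d t) w = (\<Sum>(a, b)\<leftarrow>?qs. F w a *\<^sub>C b)"
    unfolding tensor_contract_def ps(2) 1
    by (intro tensor_lift_on_sum[OF d_L_sub d_L_sub]) (use ps(1) in auto)
  also have "\<dots> = d (contract t w)"
    unfolding ps(2) using ps(1)
  proof (induction ps)
    case Nil
    then show ?case using assms(2) by (simp add: contract_linear d_linear)
  next
    case (Cons p ps)
    then show ?case
      using assms(2) d_R
      by (auto simp: contract_linear contract_pure d_linear ev F_sym split_beta)
  qed
  finally show ?thesis .
qed

lemma tensor_form_diag:
  assumes T: "T \<in> tensor_on L L" and "v \<in> R" "w \<in> R"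
  shows "tensor_form R F (tensor_map d d T) (v \<otimes> w) = pair2 v w T"
proof -
  have b: "bilinear_on R R (\<lambda>a1 a2. F a1 v * F a2 w)" if "v \<in> R" "w \<in> R" for v w
    using that
    by (intro bilinear_onI) (simp_all add: F_add F_scale scaleC_complex_def algebra_simps)
  have in_R: "tensor_map d d T \<in> tensor_on R R"
    using T L_sub
    by (induction T rule: tensor_on_induct)
      (simp_all add: complex_vector_pair.linear_0[OF clinear_tensor_map[OF d d]]
        complex_vector_pair.linear_add[OF clinear_tensor_map[OF d d]] tensor_map_pure[OF d d]
        complex_vector.subspace_0[OF csubspace_tensor_on]
        complex_vector.subspace_add[OF csubspace_tensor_on] tensor_onI d_R)
  have inner: "tensor_lift_on R R (\<lambda>a1 a2. F a1 v * F a2 w) (tensor_map d d T) = pair2 v w T"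
    if vw: "v \<in> R" "w \<in> R" for v w
  proof -
    obtain g where g: "clinear g" "\<forall>x\<in>R. \<forall>y\<in>R. g (x \<otimes> y) = F x v * F y w"
      using tensor_universal_on[OF R_sub R_sub b[OF vw]] by blast
    have "tensor_lift_on R R (\<lambda>a1 a2. F a1 v * F a2 w) (tensor_map d d T) = g (tensor_map d d T)"
      using g by (intro tensor_lift_on_agree[OF R_sub R_sub b[OF vw] in_R]) auto
    also have "\<dots> = pair2 v w T"
      using T L_sub
      by (induction T rule: tensor_on_induct)
        (use vw g in \<open>simp_all add: complex_vector_pair.linear_0[OF clinear_tensor_map[OF d d]]
          complex_vector_pair.linear_add[OF clinear_tensor_map[OF d d]] tensor_map_pure[OF d d]
          complex_vector_pair.linear_0[OF g(1)] complex_vector_pair.linear_add[OF g(1)]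
          pair2_linear pair2_pure d_R ev\<close>)
    finally show ?thesis .
  qed
  \<comment> \<open>\<open>ev\<close> is chosen separately for each argument, so linearity in
    \<open>v\<close> and \<open>w\<close> is proved on tensors over \<open>L\<close>, where
    \<open>ev\<close> is given by \<open>F\<close>.\<close>
  have pl: "pair2 (v + v') w T = pair2 v w T + pair2 v' w T"
    "pair2 v (w + w') T = pair2 v w T + pair2 v w' T"
    "pair2 (c *\<^sub>C v) w T = c * pair2 v w T" "pair2 v (c *\<^sub>C w) T = c * pair2 v w T"
    if "v \<in> R" "v' \<in> R" "w \<in> R" "w' \<in> R" for v v' w w' c
    using T L_sub
    by (induction T rule: tensor_on_induct, use that in
       \<open>simp_all add: pair2_linear pair2_pure R_add complex_vector.subspace_scale[OF R_sub]
          ev d_R F_add F_scale algebra_simps\<close>)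
  have "bilinear_on R R
     (\<lambda>b1 b2. tensor_lift_on R R (\<lambda>a1 a2. F a1 b1 * F a2 b2) (tensor_map d d T))"
    by (intro bilinear_onI)
      (simp_all add: inner R_add complex_vector.subspace_scale[OF R_sub] pl scaleC_complex_def)
  from tensor_lift_on_pure[OF R_sub R_sub this assms(2,3)] show ?thesis
    unfolding tensor_form_def using inner assms by simp
qed

lemma pair2_ad:
  assumes t: "t \<in> tensor_on L L" and "v \<in> R" "w \<in> R" and a: "a \<in> L"
  shows "pair2 v w (tensor_ad a t) = - pair2 (bracket (d a) v) w t - pair2 v (bracket (d a) w) t"
  using t L_sub
proof (induction t rule: tensor_on_induct)
  case (pure x y)
  then show ?case
    using assms d_R by (simp add: pair2_linear pair2_pure tensor_ad_pure R_bracket ev_bracket)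
qed (use assms d_R in \<open>simp_all add: pair2_linear R_bracket
      complex_vector_pair.linear_0[OF clinear_tensor_ad]
      complex_vector_pair.linear_add[OF clinear_tensor_ad]\<close>)

lemma pair2_shift:
  assumes "T \<in> tensor_on L L" "v \<in> R" "w \<in> R" "x \<in> L" "y \<in> L"
  shows "pair2 (v + d x) (w + d y) T = pair2 v w T"
  using assms(1) L_sub
  by (induction T rule: tensor_on_induct)
    (use assms d_R in \<open>simp_all add: pair2_linear pair2_pure R_add ev_shift\<close>)

text \<open>What makes \<open>W\<close> the second half of a Manin triple, with closure under the
  bracket left open; for twists that closure is the point at issue.\<close>

definition lagrangian_complement :: "'r set \<Rightarrow> bool" where
  "lagrangian_complement W \<longleftrightarrow> csubspace W \<and> W \<subseteq> R \<and> (\<forall>v\<in>W. \<forall>w\<in>W. F v w = 0) \<and>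
     direct_sum R (d ` L) W"

lemma manin_triple_iff:
  "manin_triple R F (d ` L) W \<longleftrightarrow> lie_subalgebra W R \<and> lagrangian_complement W"
proof -
  have "lie_subalgebra (d ` L) R"
    using d_L_sub d_R L_bracket by (auto simp: lie_subalgebra_def d_bracket[symmetric])
  moreover have "d ` L \<subseteq> orthogonal_in R F (d ` L)"
    using d_R d_iso by (auto simp: orthogonal_in_def)
  ultimately show ?thesis
    unfolding manin_triple_def lagrangian_complement_def
    using R F F_sym F_inv F_nondeg by (auto simp: orthogonal_in_def lie_subalgebra_def)
qed

section \<open>Duality between a Lagrangian complement and \<open>L\<close>\<close>

context
  fixes W assumes W: "lagrangian_complement W"
begin

lemma complement_subspace: "csubspace W" and complement_in_R: "w \<in> W \<Longrightarrow> w \<in> R"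
  and complement_isotropic: "v \<in> W \<Longrightarrow> w \<in> W \<Longrightarrow> F v w = 0"
  using W by (auto simp: lagrangian_complement_def)

lemma complement_decomp:
  assumes "v \<in> R"
  obtains x w where "x \<in> L" "w \<in> W" "v = d x + w"
  using W assms unfolding lagrangian_complement_def direct_sum_def by blast

lemma complement_inter: "x \<in> L \<Longrightarrow> d x \<in> W \<Longrightarrow> x = 0"
proof -
  assume "x \<in> L" "d x \<in> W"
  then have "d x \<in> {0}" using W unfolding lagrangian_complement_def direct_sum_def by blast
  then show "x = 0" using d_inj d_linear(3) by (metis injD singletonD)
qed

text \<open>\<open>d x\<close> is orthogonal to the image of \<open>d\<close> by isotropy and to
  \<open>W\<close> by assumption. These span \<open>R\<close>, on which \<open>F\<close> is
  non-degenerate.\<close>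

lemma complement_nondeg:
  assumes "x \<in> L" "\<forall>w\<in>W. ev w x = 0"
  shows "x = 0"
proof -
  have "F (d x) v = 0" if v: "v \<in> R" for v
  proof -
    obtain y w where "y \<in> L" "w \<in> W" "v = d y + w" using complement_decomp[OF v] .
    then show ?thesis using assms complement_in_R d_R by (simp add: F_add d_iso ev)
  qed
  then have "d x \<in> orthogonal_in R F R" using assms(1) d_R by (simp add: orthogonal_in_def)
  then show ?thesis using F_nondeg d_inj d_linear(3) by (metis injD singletonD)
qed

text \<open>As \<open>W\<close> is isotropic, the component \<open>d x\<close> of \<open>v\<close>
  is itself orthogonal to \<open>W\<close> and vanishes by \<open>complement_nondeg\<close>.\<close>

lemma complement_perp:
  assumes "v \<in> R" "\<forall>w\<in>W. F v w = 0"
  shows "v \<in> W"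
proof -
  obtain x w where v: "x \<in> L" "w \<in> W" "v = d x + w" using complement_decomp[OF assms(1)] .
  have "ev u x = 0" if "u \<in> W" for u
    using that v assms complement_in_R d_R complement_isotropic F_add by (simp add: ev)
  then have "x = 0" using complement_nondeg v(1) by blast
  then show ?thesis using v by (simp add: d_linear)
qed

lemma complement_bilinear: "bilinear_on W L ev"
  using complement_in_R d_R L_sub complement_subspace
  by (intro bilinear_onI)
    (simp_all add: ev F_add F_scale R_add scaleC_complex_def d_linear
      complex_vector.subspace_scale[OF R_sub] L_add complex_vector.subspace_scale[OF L_sub])

lemma pair2_nondeg:
  assumes "T \<in> tensor_on L L" "\<And>v w. v \<in> W \<Longrightarrow> w \<in> W \<Longrightarrow> pair2 v w T = 0"
  shows "T = 0"
  by (rule tensor_functionals_separate[OF L_sub L_sub assms(1), of "ev ` W" "ev ` W"])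
    (use assms(2) complement_nondeg clinear_ev complement_in_R in \<open>auto simp: pair2_def\<close>)

text \<open>By \<open>pair2_nondeg\<close> the pairings \<open>pair2 v w\<close> separate the first
  factor, so the separation of tensors by functionals can be iterated.\<close>

lemma pair3_nondeg:
  assumes "T \<in> tensor_on (tensor_on L L) L"
    "\<And>u v w. u \<in> W \<Longrightarrow> v \<in> W \<Longrightarrow> w \<in> W \<Longrightarrow> pair3 u v w T = 0"
  shows "T = 0"
proof (rule tensor_functionals_separate[OF csubspace_tensor_on L_sub assms(1),
      of "{pair2 v w |v w. v \<in> W \<and> w \<in> W}" "ev ` W"])
  fix x :: "('l, 'l) tensor"
  assume "x \<in> tensor_on L L" "\<forall>f\<in>{pair2 v w |v w. v \<in> W \<and> w \<in> W}. f x = 0"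
  then show "x = 0" using pair2_nondeg by blast
qed (use assms(2) complement_nondeg clinear_ev clinear_pair2 complement_in_R in \<open>auto simp: pair3_def\<close>)

end

section \<open>The co-Jacobi identity and closure of a complement under the bracket\<close>

definition cojacobi :: "('l \<Rightarrow> ('l, 'l) tensor) \<Rightarrow> 'l \<Rightarrow> (('l, 'l) tensor, 'l) tensor" where
  "cojacobi \<delta> a = tensor_lift_on L L (\<lambda>x y. \<delta> x \<otimes> y) (\<delta> a)"

text \<open>The relation between the cobracket and a Manin triple, phrased so that it makes sense
  for a \<open>W\<close> not known to be a subalgebra and can be carried over to twists.\<close>

definition cobracket_dual_to :: "'r set \<Rightarrow> ('l \<Rightarrow> ('l, 'l) tensor) \<Rightarrow> bool" where
  "cobracket_dual_to W \<delta> \<longleftrightarrow> linear_on L \<delta> \<and> (\<forall>a\<in>L. \<delta> a \<in> tensor_on L L) \<and>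
     (\<forall>a\<in>L. \<forall>v\<in>W. \<forall>w\<in>W. pair2 v w (\<delta> a) = F (d a) (bracket v w))"

context
  fixes W \<delta> assumes W: "lagrangian_complement W" and \<delta>: "cobracket_dual_to W \<delta>"
begin

lemma cobracket_in_tensor_on: "a \<in> L \<Longrightarrow> \<delta> a \<in> tensor_on L L"
  and cobracket_pairing: "a \<in> L \<Longrightarrow> v \<in> W \<Longrightarrow> w \<in> W \<Longrightarrow> pair2 v w (\<delta> a) = F (d a) (bracket v w)"
  and cobracket_add: "a \<in> L \<Longrightarrow> b \<in> L \<Longrightarrow> \<delta> (a + b) = \<delta> a + \<delta> b"
  and cobracket_scale: "a \<in> L \<Longrightarrow> \<delta> (c *\<^sub>C a) = c *\<^sub>C \<delta> a"
  using \<delta> by (auto simp: cobracket_dual_to_def linear_on_def)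

text \<open>Pairing \<open>\<delta> y\<close> with \<open>u\<close> and \<open>v\<close> gives
  \<open>F (d y) (bracket u v)\<close>, from which \<open>d x\<close> drops out by isotropy. What
  remains is \<open>ev p y\<close>, so the triple pairing collapses to the pairing of
  \<open>\<delta> a\<close> with \<open>p\<close> and \<open>w\<close>.\<close>

lemma
  assumes a: "a \<in> L"
  shows cojacobi_in: "cojacobi \<delta> a \<in> tensor_on (tensor_on L L) L"
    and pair3_cojacobi: "\<And>u v w x p. u \<in> W \<Longrightarrow> v \<in> W \<Longrightarrow> w \<in> W \<Longrightarrow> x \<in> L \<Longrightarrow> p \<in> W \<Longrightarrow>
      bracket u v = d x + p \<Longrightarrow> pair3 u v w (cojacobi \<delta> a) = F (d a) (bracket p w)"
proof -
  have b: "bilinear_on L L (\<lambda>x y. \<delta> x \<otimes> y)"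
    by (intro bilinear_onI) (simp_all add: tensor_pure_simps cobracket_add cobracket_scale)
  obtain g where g: "clinear g" "\<forall>x\<in>L. \<forall>y\<in>L. g (x \<otimes> y) = \<delta> x \<otimes> y"
    using tensor_universal_on[OF L_sub L_sub b] by blast
  have J: "cojacobi \<delta> a = g (\<delta> a)"
    unfolding cojacobi_def using g by (intro tensor_lift_on_agree[OF L_sub L_sub b cobracket_in_tensor_on[OF a]]) auto
  have "g T \<in> tensor_on (tensor_on L L) L" if "T \<in> tensor_on L L" for T
    using that L_sub
    by (induction T rule: tensor_on_induct)
      (use g in \<open>auto simp: complex_vector_pair.linear_0[OF g(1)] complex_vector_pair.linear_add[OF g(1)]
        complex_vector.subspace_0[OF csubspace_tensor_on] tensor_onI cobracket_in_tensor_on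
        complex_vector.subspace_add[OF csubspace_tensor_on]\<close>)
  then show "cojacobi \<delta> a \<in> tensor_on (tensor_on L L) L" using J cobracket_in_tensor_on[OF a] by simp
  fix u v w x p assume *: "u \<in> W" "v \<in> W" "w \<in> W" "x \<in> L" "p \<in> W" "bracket u v = d x + p"
  note R = *(1-3,5)[THEN complement_in_R[OF W]]
  have "pair3 u v w (g T) = pair2 p w T" if "T \<in> tensor_on L L" for T
    using that L_sub
  proof (induction T rule: tensor_on_induct)
    case (pure y z)
    have "pair2 u v (\<delta> y) = ev p y"
      using * R pure d_R by (simp add: cobracket_pairing F_add d_iso ev)
    then show ?case using g pure R by (simp add: pair3_pure pair2_pure)
  qed (use R in \<open>simp_all add: complex_vector_pair.linear_0[OF g(1)]
      complex_vector_pair.linear_add[OF g(1)] pair3_linear pair2_linear\<close>)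
  then show "pair3 u v w (cojacobi \<delta> a) = F (d a) (bracket p w)"
    using J cobracket_in_tensor_on[OF a] cobracket_pairing[OF a] * by simp
qed

text \<open>Brackets in \<open>W\<close> have no diagonal component, so the three rotated pairings
  involve full iterated brackets and cancel by Jacobi; \<open>pair3_nondeg\<close> removes the test
  vectors.\<close>

lemma cojacobi_if_subalgebra:
  assumes "\<And>v w. v \<in> W \<Longrightarrow> w \<in> W \<Longrightarrow> bracket v w \<in> W" and a: "a \<in> L"
  shows "alt3 (cojacobi \<delta> a) = 0"
proof (rule pair3_nondeg[OF W])
  show "alt3 (cojacobi \<delta> a) \<in> tensor_on (tensor_on L L) L"
    using alt3_in_tensor_on[OF L_sub cojacobi_in[OF a]] .
  fix u v w assume W3: "u \<in> W" "v \<in> W" "w \<in> W"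
  note complement_in_R[OF W, simp] \<open>a \<in> L\<close>[THEN d_R, simp]
  have p: "pair3 u v w (cojacobi \<delta> a) = F (d a) (bracket (bracket u v) w)"
    if "u \<in> W" "v \<in> W" "w \<in> W" for u v w
    using pair3_cojacobi[OF a that complex_vector.subspace_0[OF L_sub] assms(1)[OF that(1,2)]]
    by (simp add: d_linear)
  have "bracket (bracket u v) w + bracket (bracket v w) u + bracket (bracket w u) v = 0"
    using jacobi[of u v w] bracket_anticomm[of "bracket u v" w] bracket_anticomm[of "bracket v w" u]
      bracket_anticomm[of "bracket w u" v]
    by (simp add: add_eq_0_iff algebra_simps)
  moreover have "F (d a) (bracket (bracket u v) w) + F (d a) (bracket (bracket v w) u) +
      F (d a) (bracket (bracket w u) v) =
    F (d a) (bracket (bracket u v) w + bracket (bracket v w) u + bracket (bracket w u) v)"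
    using W3 by (simp add: F_add R_bracket R_add)
  moreover have "F (d a) 0 = 0" using F_scale(2)[of 0 "d a" 0] complex_vector.subspace_0[OF R_sub] by simp
  ultimately show "pair3 u v w (alt3 (cojacobi \<delta> a)) = 0"
    using W3 by (simp add: pair3_alt3 p)
qed

text \<open>For \<open>w\<close> orthogonal to \<open>S\<close>, only \<open>bracket u v\<close>
  among the three inner brackets can have a diagonal component \<open>d x\<close>. Co-Jacobi then
  confines every \<open>bracket a x\<close> to the span of \<open>S\<close>, which
  \<open>ad_inf\<close> allows only for \<open>x = 0\<close>.\<close>

lemma subalgebra_if_cojacobi:
  assumes ad_inf: "\<And>S x. finite S \<Longrightarrow> S \<subseteq> L \<Longrightarrow> x \<in> L \<Longrightarrow> \<forall>a\<in>L. bracket a x \<in> cspan S \<Longrightarrow> x = 0"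
    and S: "finite S" "S \<subseteq> L"
      "\<And>u v w. u \<in> W \<Longrightarrow> v \<in> W \<Longrightarrow> w \<in> W \<Longrightarrow> \<forall>s\<in>S. ev w s = 0 \<Longrightarrow> F (bracket u v) w = 0"
    and cojac: "\<And>a. a \<in> L \<Longrightarrow> alt3 (cojacobi \<delta> a) = 0"
    and uv: "u \<in> W" "v \<in> W"
  shows "bracket u v \<in> W"
proof -
  note complement_in_R[OF W, simp] d_R[simp] R_bracket[simp]
  obtain x p where x: "x \<in> L" "p \<in> W" "bracket u v = d x + p"
    using complement_decomp[OF W, of "bracket u v"] uv by auto
  \<comment> \<open>By duality it suffices that each \<open>w\<close> in \<open>W\<close> orthogonal
    to \<open>S\<close> is also orthogonal to \<open>bracket a x\<close>.\<close>
  have "bracket a x \<in> cspan S" if a: "a \<in> L" for a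
  proof (rule double_annihilator[OF complement_subspace[OF W] L_sub complement_bilinear[OF W]
        complement_nondeg[OF W] S(1,2)])
    show "bracket a x \<in> L" using a x by (simp add: L_bracket)
    show "\<forall>w\<in>W. (\<forall>s\<in>S. ev w s = 0) \<longrightarrow> ev w (bracket a x) = 0"
    proof (intro ballI impI)
      fix w assume w: "w \<in> W" "\<forall>s\<in>S. ev w s = 0"
      \<comment> \<open>It is enough to test against \<open>W\<close>. Invariance turns each test
        into a pairing of a bracket from \<open>W\<close> with \<open>w\<close>, to which the
        property of \<open>S\<close> applies; \<open>wu\<close> is treated in the same way.\<close>
      have vw: "bracket v w \<in> W"
      proof (rule complement_perp[OF W])
        show "\<forall>u\<in>W. F (bracket v w) u = 0"
        proof
          fix u assume u: "u \<in> W"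
          have "F (bracket v w) u = F u (bracket v w)" using u uv w by (intro F_sym) simp_all
          also have "\<dots> = F (bracket u v) w" using u uv w by (intro F_inv[symmetric]) simp_all
          finally show "F (bracket v w) u = 0" using S(3)[OF u uv(2) w] by simp
        qed
      qed (use uv w in simp)
      have wu: "bracket w u \<in> W"
      proof (rule complement_perp[OF W])
        show "\<forall>v\<in>W. F (bracket w u) v = 0"
        proof
          fix v assume v: "v \<in> W"
          have "F (bracket w u) v = F w (bracket u v)" using v uv w by (intro F_inv) simp_all
          also have "\<dots> = F (bracket u v) w" using v uv w by (intro F_sym) simp_all
          finally show "F (bracket w u) v = 0" using S(3)[OF uv(1) v w] by simp
        qed
      qed (use uv w in simp)
      note z = complex_vector.subspace_0[OF L_sub]
      \<comment> \<open>In the last two cyclic terms the inner bracket lies in \<open>W\<close>, so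
        \<open>0\<close> serves as its diagonal component.\<close>
      have "F (d a) (bracket p w) + F (d a) (bracket (bracket v w) u) + F (d a) (bracket (bracket w u) v) = 0"
        using cojac[OF a] pair3_alt3[of u v w "cojacobi \<delta> a"] uv w(1)
          pair3_cojacobi[OF a uv w(1) x] pair3_cojacobi[OF a uv(2) w(1) uv(1) z vw]
          pair3_cojacobi[OF a w(1) uv z wu]
          complex_vector_pair.linear_0[OF clinear_pair3, of u v w]
        by (simp add: d_linear)
      \<comment> \<open>Jacobi for \<open>u\<close>, \<open>v\<close>, \<open>w\<close>, with
        \<open>bracket u v\<close> split as \<open>d x + p\<close>.\<close>
      moreover have "bracket p w + bracket (bracket v w) u + bracket (bracket w u) v = - bracket (d x) w"
      proof -
        have "bracket (bracket u v) w + bracket (bracket v w) u + bracket (bracket w u) v = 0"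
          using jacobi[of u v w] bracket_anticomm[of "bracket u v" w]
            bracket_anticomm[of "bracket v w" u] bracket_anticomm[of "bracket w u" v]
          by (simp add: add_eq_0_iff algebra_simps)
        then have "bracket (d x) w + (bracket p w + bracket (bracket v w) u + bracket (bracket w u) v) = 0"
          by (simp add: x(3) bracket_add_left add.assoc)
        then show ?thesis by (metis minus_unique)
      qed
      moreover have "F (d a) (bracket p w) + F (d a) (bracket (bracket v w) u) + F (d a) (bracket (bracket w u) v)
        = F (d a) (bracket p w + bracket (bracket v w) u + bracket (bracket w u) v)"
        using a x uv w by (simp add: F_add R_add)
      ultimately have "F (d a) (bracket (d x) w) = 0"
        using a x w by (simp add: F_minus)
      then show "ev w (bracket a x) = 0"
        using a x w L_bracket F_inv[of "d a" "d x" w] by (simp add: ev d_bracket)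
    qed
  qed
  then have "x = 0" using ad_inf[OF S(1,2) x(1)] by blast
  then show ?thesis using x by (simp add: d_linear)
qed

end

section \<open>Twists of a complement and of its cobracket\<close>

definition twist :: "'r set \<Rightarrow> ('l, 'l) tensor \<Rightarrow> 'r set" where
  "twist W t = {w + d (contract t w) | w. w \<in> W}"

context
  fixes t assumes t: "t \<in> wedge2 L"
begin

lemma wedge2_in_tensor_on: "t \<in> tensor_on L L"
  using t by (simp add: wedge2_def)

lemma contract_wedge2:
  "v \<in> R \<Longrightarrow> contract t v \<in> L"
  "v \<in> R \<Longrightarrow> w \<in> R \<Longrightarrow> contract t (v + w) = contract t v + contract t w"
  "v \<in> R \<Longrightarrow> contract t (c *\<^sub>C v) = c *\<^sub>C contract t v"
  using contract_in[OF wedge2_in_tensor_on] contract_linear_on[OF wedge2_in_tensor_on]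
  by (auto simp: linear_on_def)

context
  fixes W assumes W: "lagrangian_complement W"
begin

text \<open>The mixed terms in the form on two points of the graph are \<open>pair2 w v t\<close>
  and \<open>pair2 v w t\<close>, which cancel by skewness. Shifting \<open>d (contract t w)\<close>
  between the summands turns a decomposition along \<open>W\<close> into one along the
  twist.\<close>

lemma twist_lagrangian_complement: "lagrangian_complement (twist W t)"
  unfolding lagrangian_complement_def
proof (intro conjI ballI)
  note complement_in_R[OF W, simp] d_R[simp] contract_wedge2[simp]
  show "csubspace (twist W t)"
    unfolding complex_vector.subspace_def
  proof (intro conjI ballI allI)
    have "contract t 0 = 0"
      using contract_wedge2(3)[of 0 0] complex_vector.subspace_0[OF R_sub] by simp
    then show "0 \<in> twist W t"
      using complex_vector.subspace_0[OF complement_subspace[OF W]] by (force simp: twist_def d_linear)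
  next
    fix x y assume "x \<in> twist W t" "y \<in> twist W t"
    then obtain v w where "v \<in> W" "w \<in> W" "x = v + d (contract t v)" "y = w + d (contract t w)"
      by (auto simp: twist_def)
    then show "x + y \<in> twist W t"
      using complex_vector.subspace_add[OF complement_subspace[OF W], of v w]
      by (auto simp: twist_def d_linear intro!: exI[of _ "v + w"])
  next
    fix x c assume "x \<in> twist W t"
    then obtain v where "v \<in> W" "x = v + d (contract t v)" by (auto simp: twist_def)
    then show "c *\<^sub>C x \<in> twist W t"
      using complex_vector.subspace_scale[OF complement_subspace[OF W], of v c]
      by (auto simp: twist_def d_linear complex_vector.scale_right_distrib intro!: exI[of _ "c *\<^sub>C v"])
  qed
  show "twist W t \<subseteq> R" by (auto simp: twist_def R_add)
  show "F x y = 0" if xy: "x \<in> twist W t" "y \<in> twist W t" for x y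
  proof -
    obtain v w where vw: "v \<in> W" "w \<in> W" "x = v + d (contract t v)" "y = w + d (contract t w)"
      using xy by (auto simp: twist_def)
    then have "F x y = F v (d (contract t w)) + F (d (contract t v)) w"
      by (simp add: F_add R_add d_iso complement_isotropic[OF W])
    also have "F v (d (contract t w)) = F (d (contract t w)) v"
      using vw by (intro F_sym) simp_all
    also have "F (d (contract t w)) v + F (d (contract t v)) w = pair2 w v t + pair2 v w t"
      using vw by (simp add: pair2_contract ev)
    finally show ?thesis using pair2_wedge2[OF t, of v w] vw by simp
  qed
  show "direct_sum R (d ` L) (twist W t)"
    unfolding direct_sum_def
  proof (intro conjI set_eqI iffI)
    fix v assume "v \<in> R"
    then obtain x w where v: "x \<in> L" "w \<in> W" "v = d x + w" using complement_decomp[OF W] by blast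
    then have "v = d (x - contract t w) + (w + d (contract t w))" by (simp add: d_linear)
    moreover have "x - contract t w \<in> L"
      using v complex_vector.subspace_diff[OF L_sub] by simp
    ultimately show "v \<in> {x + y | x y. x \<in> d ` L \<and> y \<in> twist W t}"
      using v(2) unfolding twist_def by blast
  next
    fix v assume "v \<in> {x + y | x y. x \<in> d ` L \<and> y \<in> twist W t}"
    then show "v \<in> R" by (auto simp: twist_def R_add)
  next
    fix v assume "v \<in> d ` L \<inter> twist W t"
    then obtain x w where v: "x \<in> L" "v = d x" "w \<in> W" "v = w + d (contract t w)"
      by (auto simp: twist_def)
    then have "d (x - contract t w) = w" by (metis add_diff_cancel_right' d_linear(5))
    moreover have "x - contract t w \<in> L"
      using v complex_vector.subspace_diff[OF L_sub] by simp
    ultimately have "x - contract t w = 0" using complement_inter[OF W] v by metis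
    then have "w = 0" using \<open>d (x - contract t w) = w\<close> by (simp add: d_linear)
    then show "v \<in> {0}"
      using v contract_wedge2(3)[of 0 0] complex_vector.subspace_0[OF R_sub] by (simp add: d_linear)
  next
    fix v :: 'r assume "v \<in> {0}"
    moreover have "contract t 0 = 0"
      using contract_wedge2(3)[of 0 0] complex_vector.subspace_0[OF R_sub] by simp
    ultimately show "v \<in> d ` L \<inter> twist W t"
      using complex_vector.subspace_0[OF complement_subspace[OF W]] complex_vector.subspace_0[OF d_L_sub]
      by (force simp: twist_def d_linear)
  qed
qed

text \<open>Skewness of \<open>t\<close> and cyclicity of \<open>F\<close> isolate
  \<open>d a\<close>. What it is paired with are the mixed terms in the bracket of
  \<open>v + d (contract t v)\<close> and \<open>w + d (contract t w)\<close>.\<close>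

lemma pair2_coboundary:
  assumes a: "a \<in> L" and vw: "v \<in> W" "w \<in> W"
  shows "pair2 v w (tensor_ad a t) =
    F (d a) (bracket (d (contract t v)) w) + F (d a) (bracket v (d (contract t w)))"
proof -
  note complement_in_R[OF W, simp] d_R[simp] contract_wedge2[simp] R_bracket[simp]
  have "pair2 v w (tensor_ad a t) = pair2 w (bracket (d a) v) t - pair2 v (bracket (d a) w) t"
    using a vw pair2_wedge2[OF t, of "bracket (d a) v" w] by (simp add: pair2_ad[OF wedge2_in_tensor_on])
  also have "\<dots> = F (d (contract t w)) (bracket (d a) v) - F (d (contract t v)) (bracket (d a) w)"
    using a vw by (simp add: pair2_contract ev)
  also have "F (d (contract t w)) (bracket (d a) v) = F (d a) (bracket v (d (contract t w)))"
    using a vw by (intro F_cyclic) simp_all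
  also have "F (d (contract t v)) (bracket (d a) w) = F (d a) (bracket w (d (contract t v)))"
    using a vw by (intro F_cyclic) simp_all
  also have "bracket w (d (contract t v)) = - bracket (d (contract t v)) w"
    by (rule bracket_anticomm)
  finally show ?thesis using a vw by (simp add: F_minus)
qed

text \<open>The pairing ignores diagonal summands, so \<open>x\<close> and \<open>y\<close> may be
  replaced by \<open>v\<close> and \<open>w\<close>. Then \<open>\<delta>\<close> contributes the
  bracket of \<open>v\<close> and \<open>w\<close>, the coboundary the two mixed terms, and the
  fourth term is diagonal, hence orthogonal to \<open>d a\<close>.\<close>

lemma twist_cobracket_dual:
  assumes \<delta>: "cobracket_dual_to W \<delta>"
  shows "cobracket_dual_to (twist W t) (twisted_cobracket \<delta> t)"
  unfolding cobracket_dual_to_def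
proof (intro conjI ballI)
  note complement_in_R[OF W, simp] d_R[simp] contract_wedge2[simp] R_bracket[simp]
  show "linear_on L (twisted_cobracket \<delta> t)"
    using \<delta> by (simp add: cobracket_dual_to_def linear_on_def twisted_cobracket_def
      tensor_ad_add_left tensor_ad_scale_left complex_vector.scale_right_distrib)
  show in_L: "twisted_cobracket \<delta> t a \<in> tensor_on L L" if "a \<in> L" for a
    using \<delta> tensor_ad_in_tensor_on[OF L that wedge2_in_tensor_on] that
    by (simp add: cobracket_dual_to_def twisted_cobracket_def
      complex_vector.subspace_add[OF csubspace_tensor_on])
  fix a x y assume a: "a \<in> L" and "x \<in> twist W t" "y \<in> twist W t"
  then obtain v w where vw: "v \<in> W" "w \<in> W" "x = v + d (contract t v)" "y = w + d (contract t w)"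
    by (auto simp: twist_def)
  have "pair2 x y (twisted_cobracket \<delta> t a) = pair2 v w (twisted_cobracket \<delta> t a)"
    using vw pair2_shift[OF in_L[OF a]] by simp
  also have "\<dots> = pair2 v w (\<delta> a) + pair2 v w (tensor_ad a t)"
    using vw by (simp add: twisted_cobracket_def pair2_linear)
  also have "\<dots> = F (d a) (bracket v w) +
      (F (d a) (bracket (d (contract t v)) w) + F (d a) (bracket v (d (contract t w))))"
    using \<delta> a vw by (simp add: pair2_coboundary cobracket_dual_to_def)
  also have "\<dots> = F (d a) (bracket x y)"
    using a vw
    by (simp add: bracket_add_left bracket_add_right F_add R_add d_bracket[symmetric] L_bracket d_iso)
  finally show "pair2 x y (twisted_cobracket \<delta> t a) = F (d a) (bracket x y)" .
qed

end

end

section \<open>Finite test sets and the bialgebra criterion for twists\<close>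

lemma finite_kills_cobracket:
  assumes "linear_on L \<delta>" "\<And>a. a \<in> L \<Longrightarrow> \<delta> a \<in> tensor_on L L" "finite B" "B \<subseteq> L"
  obtains S where "finite S" "S \<subseteq> L"
    "\<And>a v w. a \<in> cspan B \<Longrightarrow> v \<in> R \<Longrightarrow> w \<in> R \<Longrightarrow> \<forall>s\<in>S. ev w s = 0 \<Longrightarrow> pair2 v w (\<delta> a) = 0"
proof -
  \<comment> \<open>Each generator \<open>b\<close> gets the test set of the tensor
    \<open>\<delta> b\<close> from \<open>contract_range\<close>; by linearity their union serves
    the whole span of \<open>B\<close>.\<close>
  have "\<forall>b\<in>B. \<exists>S. finite S \<and> S \<subseteq> L \<and>
    (\<forall>v\<in>R. \<forall>w\<in>R. (\<forall>s\<in>S. ev w s = 0) \<longrightarrow> pair2 v w (\<delta> b) = 0)"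
    using contract_range assms(2,4) by (metis subsetD)
  then obtain S where S: "\<And>b. b \<in> B \<Longrightarrow> finite (S b) \<and> S b \<subseteq> L \<and>
    (\<forall>v\<in>R. \<forall>w\<in>R. (\<forall>s\<in>S b. ev w s = 0) \<longrightarrow> pair2 v w (\<delta> b) = 0)" by metis
  show thesis
  proof (rule that[of "\<Union>b\<in>B. S b"])
    fix a v w assume a: "a \<in> cspan B" and vw: "v \<in> R" "w \<in> R" and kill: "\<forall>s\<in>\<Union>b\<in>B. S b. ev w s = 0"
    have "a \<in> L \<and> pair2 v w (\<delta> a) = 0"
      using a
    proof (induction rule: complex_vector.span_induct_alt)
      case base
      have "\<delta> 0 = 0" using assms(1) complex_vector.subspace_0[OF L_sub]
        unfolding linear_on_def by (metis complex_vector.scale_zero_left)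
      then show ?case using complex_vector.subspace_0[OF L_sub] vw by (simp add: pair2_linear)
    next
      case (step c b y)
      have bL: "b \<in> L" "c *\<^sub>C b \<in> L"
        using step(1) assms(4) complex_vector.subspace_scale[OF L_sub] by auto
      have "\<delta> (c *\<^sub>C b + y) = c *\<^sub>C \<delta> b + \<delta> y"
        using bL step assms(1) by (simp add: linear_on_def)
      moreover have "pair2 v w (\<delta> b) = 0" using S[OF step(1)] vw kill step(1) by blast
      ultimately show ?case
        using step bL vw L_add
        by (simp add: pair2_linear complex_vector_pair.linear_scale[OF clinear_pair2])
    qed
    then show "pair2 v w (\<delta> a) = 0" ..
  qed (use S assms(3) in auto)
qed

text \<open>For \<open>w\<close> in a subspace of \<open>W\<close> of finite codimension, the correction \<open>contract t w\<close> vanishes and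
  \<open>w\<close> is invisible to the finitely many tensors that occur when \<open>F [u, v] w\<close> is expanded.\<close>

lemma twist_bracket_finite_defect:
  assumes W: "lagrangian_complement W" and t: "t \<in> wedge2 L" and \<delta>: "cobracket_dual_to W \<delta>"
    and closed: "\<And>v w. v \<in> W \<Longrightarrow> w \<in> W \<Longrightarrow> bracket v w \<in> W"
  obtains S where "finite S" "S \<subseteq> L"
    "\<And>u v w. u \<in> twist W t \<Longrightarrow> v \<in> twist W t \<Longrightarrow> w \<in> twist W t \<Longrightarrow> \<forall>s\<in>S. ev w s = 0 \<Longrightarrow>
       F (bracket u v) w = 0"
proof -
  note W' = twist_lagrangian_complement[OF t W] and \<delta>' = twist_cobracket_dual[OF t W \<delta>]
  note complement_in_R[OF W, simp] d_R[simp] contract_wedge2[OF t, simp] R_bracket[simp]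
  obtain B where B: "finite B" "B \<subseteq> L" "\<And>w. w \<in> R \<Longrightarrow> contract t w \<in> cspan B"
      "\<And>v w. v \<in> R \<Longrightarrow> w \<in> R \<Longrightarrow> \<forall>s\<in>B. ev w s = 0 \<Longrightarrow> pair2 v w t = 0"
    using contract_range[OF wedge2_in_tensor_on[OF t]] by metis
  obtain S1 where S1: "finite S1" "S1 \<subseteq> L"
    "\<And>a v w. a \<in> cspan B \<Longrightarrow> v \<in> R \<Longrightarrow> w \<in> R \<Longrightarrow> \<forall>s\<in>S1. ev w s = 0 \<Longrightarrow> pair2 v w (\<delta> a) = 0"
    using finite_kills_cobracket[of \<delta> B] \<delta> B(1,2) unfolding cobracket_dual_to_def by metis
  obtain S2 where S2: "finite S2" "S2 \<subseteq> L"
    "\<And>a v w. a \<in> cspan B \<Longrightarrow> v \<in> R \<Longrightarrow> w \<in> R \<Longrightarrow> \<forall>s\<in>S2. ev w s = 0 \<Longrightarrow>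
      pair2 v w (twisted_cobracket \<delta> t a) = 0"
    using finite_kills_cobracket[of "twisted_cobracket \<delta> t" B] \<delta>' B(1,2)
    unfolding cobracket_dual_to_def by metis
  show thesis
  proof (rule that[of "B \<union> S1 \<union> S2"])
    fix x y z assume xyz: "x \<in> twist W t" "y \<in> twist W t" "z \<in> twist W t"
      and kill: "\<forall>s\<in>B \<union> S1 \<union> S2. ev z s = 0"
    obtain u v w where u: "u \<in> W" "x = u + d (contract t u)" and v: "v \<in> W" "y = v + d (contract t v)"
      and w: "w \<in> W" "z = w + d (contract t w)"
      using xyz by (auto simp: twist_def)
    have xyz_R: "x \<in> R" "y \<in> R" "z \<in> R" using xyz complement_in_R[OF W'] by auto
    have "ev w s = ev z s" if "s \<in> L" for s using that w by (simp add: ev_shift)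
    then have kill_w: "\<forall>s\<in>B \<union> S1 \<union> S2. ev w s = 0" using kill B(2) S1(2) S2(2) by fastforce
    \<comment> \<open>Skewness moves \<open>w\<close> to the second slot, where its orthogonality to
      \<open>B\<close> applies; so the correction to \<open>w\<close> vanishes and
      \<open>z = w\<close>.\<close>
    have "ev v (contract t w) = 0" if "v \<in> W" for v
      using pair2_wedge2[OF t, of w v] B(4)[of v w] that w(1) kill_w by (simp add: pair2_contract)
    then have "contract t w = 0" using complement_nondeg[OF W] w(1) by simp
    then have zw: "z = w" using w(2) by (simp add: d_linear)
    have "F (bracket x y) z = F x (bracket y z)" using xyz_R by (rule F_inv)
    also have "\<dots> = F u (bracket y z) + F (d (contract t u)) (bracket y z)"
      using u xyz_R by (simp add: F_add)
    \<comment> \<open>This is the pairing of \<open>y\<close> and \<open>z\<close> with the twisted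
      cobracket of \<open>contract t u\<close>, an element of the span of \<open>B\<close>; it
      vanishes by the choice of \<open>S2\<close>.\<close>
    also have "F (d (contract t u)) (bracket y z) = 0"
      using S2(3)[OF B(3), of u y z] \<delta>' xyz xyz_R kill u by (simp add: cobracket_dual_to_def)
    also have "F u (bracket y z) = F u (bracket v w) + F u (bracket (d (contract t v)) w)"
      using u v w zw by (simp add: bracket_add_left F_add)
    also have "F u (bracket v w) = 0" using u v w closed complement_isotropic[OF W] by simp
    \<comment> \<open>After rotation and up to sign, this is the pairing of \<open>u\<close> and
      \<open>w\<close> with \<open>\<delta> (contract t v)\<close>, which vanishes by the choice of
      \<open>S1\<close>.\<close>
    also have "F u (bracket (d (contract t v)) w) = F (d (contract t v)) (bracket w u)"
      using u v w by (intro F_cyclic) simp_all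
    also have "\<dots> = - F (d (contract t v)) (bracket u w)"
      using bracket_anticomm[of w u] u v w by (simp add: F_minus)
    also have "F (d (contract t v)) (bracket u w) = 0"
      using S1(3)[OF B(3), of v u w] \<delta> u v w kill_w by (simp add: cobracket_dual_to_def)
    finally show "F (bracket x y) z = 0" by simp
  qed (use B S1 S2 in auto)
qed

text \<open>Skewness and the cocycle identity survive adding the coboundary of a skew tensor, so
  only co-Jacobi is at stake; it is matched with closure of the twist.\<close>

lemma lie_bialgebra_twist_iff:
  assumes W: "lagrangian_complement W" and W_lie: "lie_subalgebra W R"
    and \<delta>: "cobracket_dual_to W \<delta>" and bialg: "lie_bialgebra L \<delta>" and t: "t \<in> wedge2 L"
    and ad_inf: "\<And>S x. finite S \<Longrightarrow> S \<subseteq> L \<Longrightarrow> x \<in> L \<Longrightarrow> \<forall>a\<in>L. bracket a x \<in> cspan S \<Longrightarrow> x = 0"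
  shows "lie_subalgebra (twist W t) R \<longleftrightarrow> lie_bialgebra L (twisted_cobracket \<delta> t)"
proof -
  note W' = twist_lagrangian_complement[OF t W] and \<delta>' = twist_cobracket_dual[OF t W \<delta>]
  have "twisted_cobracket \<delta> t a \<in> wedge2 L" if a: "a \<in> L" for a
  proof -
    have "tensor_ad a t \<in> wedge2 L"
      using t tensor_ad_in_tensor_on[OF L a]
      by (simp add: wedge2_def tensor_swap_ad complex_vector_pair.linear_neg[OF clinear_tensor_ad])
    then show ?thesis
      using bialg a by (simp add: twisted_cobracket_def lie_bialgebra_def
        complex_vector.subspace_add[OF csubspace_wedge2])
  qed
  moreover have "twisted_cobracket \<delta> t (bracket a b) =
      tensor_ad a (twisted_cobracket \<delta> t b) - tensor_ad b (twisted_cobracket \<delta> t a)"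
    if "a \<in> L" "b \<in> L" for a b
    using bialg that
    by (simp add: twisted_cobracket_def lie_bialgebra_def tensor_ad_bracket
      complex_vector_pair.linear_add[OF clinear_tensor_ad])
  ultimately have "lie_bialgebra L (twisted_cobracket \<delta> t) \<longleftrightarrow>
      (\<forall>a\<in>L. alt3 (cojacobi (twisted_cobracket \<delta> t) a) = 0)"
    using L \<delta>' by (auto simp: lie_bialgebra_def cobracket_dual_to_def cojacobi_def)
  also have "\<dots> \<longleftrightarrow> (\<forall>v\<in>twist W t. \<forall>w\<in>twist W t. bracket v w \<in> twist W t)"
  proof
    have closed: "\<And>v w. v \<in> W \<Longrightarrow> w \<in> W \<Longrightarrow> bracket v w \<in> W"
      using W_lie by (simp add: lie_subalgebra_def)
    obtain S where S: "finite S" "S \<subseteq> L"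
      "\<And>u v w. u \<in> twist W t \<Longrightarrow> v \<in> twist W t \<Longrightarrow> w \<in> twist W t \<Longrightarrow> \<forall>s\<in>S. ev w s = 0 \<Longrightarrow>
         F (bracket u v) w = 0"
      using twist_bracket_finite_defect[OF W t \<delta> closed] by metis
    assume "\<forall>a\<in>L. alt3 (cojacobi (twisted_cobracket \<delta> t) a) = 0"
    then show "\<forall>v\<in>twist W t. \<forall>w\<in>twist W t. bracket v w \<in> twist W t"
      by (intro ballI subalgebra_if_cojacobi[OF W' \<delta>' _ S]) (use ad_inf in blast)+
  next
    assume "\<forall>v\<in>twist W t. \<forall>w\<in>twist W t. bracket v w \<in> twist W t"
    then show "\<forall>a\<in>L. alt3 (cojacobi (twisted_cobracket \<delta> t) a) = 0"
      using cojacobi_if_subalgebra[OF W' \<delta>'] by blast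
  qed
  finally show ?thesis
    using complement_subspace[OF W'] complement_in_R[OF W'] by (auto simp: lie_subalgebra_def)
qed

section \<open>Injectivity, commensurability and surjectivity of the twisting map\<close>

lemma twist_inj:
  assumes W: "lagrangian_complement W" and t: "t \<in> wedge2 L" and t': "t' \<in> wedge2 L"
    and eq: "twist W t = twist W t'"
  shows "t = t'"
proof -
  note complement_in_R[OF W, simp] d_R[simp] contract_wedge2[OF t, simp] contract_wedge2[OF t', simp]
  have c: "contract t w = contract t' w" if w: "w \<in> W" for w
  proof -
    have "w + d (contract t w) \<in> twist W t'" using w eq by (auto simp: twist_def)
    then obtain v where v: "v \<in> W" "w + d (contract t w) = v + d (contract t' v)"
      by (auto simp: twist_def)
    \<comment> \<open>Both diagonal and in \<open>W\<close>, this vector vanishes; so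
      \<open>v = w\<close> and the two graphs agree over \<open>w\<close>.\<close>
    then have "d (contract t w - contract t' v) = v - w"
      by (simp add: d_linear algebra_simps)
    moreover have "v - w \<in> W" using v w complex_vector.subspace_diff[OF complement_subspace[OF W]] by simp
    moreover have "contract t w - contract t' v \<in> L"
      using v w complex_vector.subspace_diff[OF L_sub] by simp
    ultimately have "contract t w - contract t' v = 0" using complement_inter[OF W] by metis
    then show ?thesis using \<open>d (contract t w - contract t' v) = v - w\<close> by (simp add: d_linear)
  qed
  have "t - t' = 0"
  proof (rule pair2_nondeg[OF W])
    show "t - t' \<in> tensor_on L L"
      using wedge2_in_tensor_on[OF t] wedge2_in_tensor_on[OF t']
        complex_vector.subspace_diff[OF csubspace_tensor_on] by blast
    fix v w assume "v \<in> W" "w \<in> W"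
    then have "pair2 v w t = pair2 v w t'" by (simp add: pair2_contract c)
    with \<open>v \<in> W\<close> \<open>w \<in> W\<close> show "pair2 v w (t - t') = 0"
      by (simp add: complex_vector_pair.linear_diff[OF clinear_pair2])
  qed
  then show ?thesis by simp
qed

text \<open>The contraction has finite rank, and its kernel in \<open>W\<close> lies in both spaces.
  So the sum is spanned by the intersection, finitely many generators \<open>G\<close> of
  \<open>W\<close> modulo that kernel, and their images.\<close>

lemma twist_commensurable:
  assumes W: "lagrangian_complement W" and t: "t \<in> wedge2 L"
  shows "commensurable (twist W t) W"
proof -
  note W' = twist_lagrangian_complement[OF t W]
  note complement_in_R[OF W, simp] d_R[simp] contract_wedge2[OF t, simp]
  obtain f where f: "clinear f" "\<And>w. w \<in> R \<Longrightarrow> f w = contract t w"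
    using linear_on_extend[OF R_sub contract_linear_on[OF wedge2_in_tensor_on[OF t]]] by metis
  obtain S where S: "finite S" "f ` W \<subseteq> cspan S"
    using contract_range[OF wedge2_in_tensor_on[OF t]] f(2) by (metis complement_in_R[OF W] image_subsetI)
  obtain G where G: "finite G" "G \<subseteq> W" "W \<subseteq> cspan (G \<union> {w \<in> W. f w = 0})"
    using finite_rank_generators[OF complement_subspace[OF W] f(1) S] .
  define S' where "S' = G \<union> (\<lambda>w. d (contract t w)) ` G"
  let ?U = "cspan (S' \<union> (twist W t \<inter> W))"
  have ker: "{w \<in> W. f w = 0} \<subseteq> twist W t \<inter> W"
  proof
    fix w assume w: "w \<in> {w \<in> W. f w = 0}"
    then have "w = w + d (contract t w)" using f(2)[of w] by (simp add: d_linear)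
    then show "w \<in> twist W t \<inter> W" using w unfolding twist_def by blast
  qed
  have WU: "W \<subseteq> ?U"
    using G(3) complex_vector.span_mono[of "G \<union> {w \<in> W. f w = 0}" "S' \<union> (twist W t \<inter> W)"] ker
    by (auto simp: S'_def)
  have dU: "d (f w) \<in> ?U" if "w \<in> W" for w
  proof -
    have df: "clinear (\<lambda>w. d (f w))"
      by (rule clinearI) (simp_all add: d_linear complex_vector_pair.linear_add[OF f(1)]
        complex_vector_pair.linear_scale[OF f(1)])
    have "(\<lambda>w. d (f w)) ` (G \<union> {w \<in> W. f w = 0}) \<subseteq> ?U"
    proof (rule image_subsetI)
      fix w assume "w \<in> G \<union> {w \<in> W. f w = 0}"
      then consider "w \<in> G" | "f w = 0" by blast
      then show "d (f w) \<in> ?U"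
      proof cases
        case 1
        then have "d (f w) \<in> S'" using G(2) f(2)[of w] by (auto simp: S'_def)
        then show ?thesis by (simp add: complex_vector.span_base)
      next
        case 2
        then show ?thesis by (simp add: d_linear complex_vector.span_zero)
      qed
    qed
    then have "cspan ((\<lambda>w. d (f w)) ` (G \<union> {w \<in> W. f w = 0})) \<subseteq> ?U"
      by (rule complex_vector.span_minimal) (rule complex_vector.subspace_span)
    then show ?thesis
      using complex_vector_pair.linear_span_image[OF df] G(3) that by blast
  qed
  let ?Sum = "{x + y | x y. x \<in> twist W t \<and> y \<in> W}"
  have "?Sum \<subseteq> ?U"
  proof clarify
    fix x y assume "x \<in> twist W t" "y \<in> W"
    then obtain w where "w \<in> W" "x = w + d (contract t w)" by (auto simp: twist_def)
    then show "x + y \<in> ?U"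
      using WU dU[of w] f(2)[of w] \<open>y \<in> W\<close> by (auto intro!: complex_vector.span_add)
  qed
  moreover have "?U \<subseteq> ?Sum"
  proof (rule complex_vector.span_minimal)
    have sub: "csubspace ?Sum"
      using complex_vector.subspace_sums[OF complement_subspace[OF W'] complement_subspace[OF W]] by simp
    then show "csubspace ?Sum" .
    have 1: "W \<subseteq> ?Sum"
      using complex_vector.subspace_0[OF complement_subspace[OF W']] by force
    have 2: "d (contract t w) \<in> ?Sum" if "w \<in> W" for w
    proof -
      have "d (contract t w) = (w + d (contract t w)) + (- w)" by simp
      then show ?thesis
        using that complex_vector.subspace_neg[OF complement_subspace[OF W]] unfolding twist_def by blast
    qed
    show "S' \<union> (twist W t \<inter> W) \<subseteq> ?Sum" using 1 2 G(2) by (auto simp: S'_def)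
  qed
  moreover have "finite S'" using G(1) by (simp add: S'_def)
  ultimately show ?thesis
    unfolding commensurable_def using complement_subspace[OF W'] complement_subspace[OF W] by blast
qed

lemma twist_surj:
  assumes W: "lagrangian_complement W" and V: "lagrangian_complement V"
    and comm: "commensurable V W"
  obtains t where "t \<in> wedge2 L" "V = twist W t"
proof -
  note complement_in_R[OF W, simp] complement_in_R[OF V, simp] d_R[simp]
  have inter: "d ` L \<inter> U = {0}" if "lagrangian_complement U" for U
    using that by (simp add: lagrangian_complement_def direct_sum_def)
  obtain \<rho>V where \<rho>V: "clinear \<rho>V" "\<And>a. a \<in> d ` L \<Longrightarrow> \<rho>V a = a" "\<And>b. b \<in> V \<Longrightarrow> \<rho>V b = 0"
    using direct_sum_projection[OF d_L_sub complement_subspace[OF V] inter[OF V]] by metis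
  obtain \<rho>W where \<rho>W: "clinear \<rho>W" "\<And>a. a \<in> d ` L \<Longrightarrow> \<rho>W a = a" "\<And>b. b \<in> W \<Longrightarrow> \<rho>W b = 0"
    using direct_sum_projection[OF d_L_sub complement_subspace[OF W] inter[OF W]] by metis
  obtain h where h: "h ` UNIV \<subseteq> L" "clinear h" "\<forall>v\<in>L. h (d v) = v"
    using complex_vector_pair.linear_exists_left_inverse_on[OF d L_sub] d_inj
    by (auto simp: inj_on_def)
  \<comment> \<open>Minus the diagonal component of \<open>w\<close> along \<open>V\<close>, pulled
    back to \<open>L\<close>; hence \<open>w + d (g w)\<close> is the component of \<open>w\<close>
    in \<open>V\<close>.\<close>
  define g where "g w = h (- \<rho>V w)" for w
  have g: "g w \<in> L" "w + d (g w) \<in> V" if w_R: "w \<in> R" for w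
  proof -
    obtain x v where w: "x \<in> L" "v \<in> V" "w = d x + v" using complement_decomp[OF V w_R] .
    then have gw: "g w = - x"
      using \<rho>V h by (simp add: g_def complex_vector_pair.linear_add[OF \<rho>V(1)]
        complex_vector_pair.linear_neg[OF h(2)])
    show "g w \<in> L" using gw w(1) complex_vector.subspace_neg[OF L_sub] by simp
    show "w + d (g w) \<in> V" using gw w by (simp add: d_linear)
  qed
  \<comment> \<open>In the form on two points of \<open>V\<close> only the mixed terms survive,
    since \<open>W\<close> and the image of \<open>d\<close> are isotropic.\<close>
  have skew: "ev v (g w) = - ev w (g v)" if "v \<in> W" "w \<in> W" for v w
  proof -
    have "F (v + d (g v)) (w + d (g w)) = 0" using that g complement_isotropic[OF V] by simp
    moreover have "F v (d (g w)) = F (d (g w)) v" using that g by (intro F_sym) simp_all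
    ultimately show ?thesis
      using that g by (simp add: F_add R_add d_iso complement_isotropic[OF W] ev eq_neg_iff_add_eq_0 add.commute)
  qed
  obtain S where S: "finite S" "{x + y | x y. x \<in> V \<and> y \<in> W} = cspan (S \<union> (V \<inter> W))"
    using comm by (auto simp: commensurable_def)
  define S' where "S' = (h \<circ> \<rho>W) ` S"
  have h\<rho>: "clinear (h \<circ> \<rho>W)"
    by (rule clinearI) (simp_all add: complex_vector_pair.linear_add[OF h(2)]
      complex_vector_pair.linear_scale[OF h(2)] complex_vector_pair.linear_add[OF \<rho>W(1)]
      complex_vector_pair.linear_scale[OF \<rho>W(1)])
  \<comment> \<open>\<open>d (g w)\<close> lies in the sum of \<open>V\<close> and \<open>W\<close>,
    which \<open>S\<close> generates modulo \<open>V \<inter> W\<close>. Projecting to the diagonal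
    along \<open>W\<close> fixes \<open>d (g w)\<close> and kills \<open>V \<inter> W\<close>, so
    \<open>g\<close> has finite rank.\<close>
  have g_span: "g w \<in> cspan S'" if "w \<in> W" for w
  proof -
    have "d (g w) = (w + d (g w)) + (- w)" by simp
    then have "d (g w) \<in> {x + y | x y. x \<in> V \<and> y \<in> W}"
      using g(2)[of w] that complex_vector.subspace_neg[OF complement_subspace[OF W] that] by fastforce
    then have "d (g w) \<in> cspan (S \<union> (V \<inter> W))" using S(2) by simp
    then have "(h \<circ> \<rho>W) (d (g w)) \<in> cspan ((h \<circ> \<rho>W) ` (S \<union> (V \<inter> W)))"
      unfolding complex_vector_pair.linear_span_image[OF h\<rho>] by (rule imageI)
    also have "\<dots> \<subseteq> cspan (insert 0 S')"
      using \<rho>W(3) by (intro complex_vector.span_mono)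
        (auto simp: S'_def complex_vector_pair.linear_0[OF h(2)])
    finally show ?thesis
      using g[of w] that h(3) \<rho>W(2) by (simp add: complex_vector.span_insert_0)
  qed
  obtain B where B: "B \<subseteq> S'" "complex_vector.independent B" "S' \<subseteq> cspan B"
    using complex_vector.maximal_independent_subset by blast
  have finB: "finite B" using B(1) S(1) finite_subset by (auto simp: S'_def)
  have BL: "B \<subseteq> L" using B(1) h(1) by (auto simp: S'_def)
  have gB: "g w \<in> cspan B" if "w \<in> W" for w
    using g_span[OF that] complex_vector.span_minimal[OF B(3) complex_vector.subspace_span] by blast
  obtain \<omega> where \<omega>: "\<And>b. b \<in> B \<Longrightarrow> \<omega> b \<in> W"
    "\<And>b b'. b \<in> B \<Longrightarrow> b' \<in> B \<Longrightarrow> ev (\<omega> b) b' = (if b = b' then 1 else 0)"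
    using dual_family[OF complement_subspace[OF W] L_sub complement_bilinear[OF W]
        complement_nondeg[OF W] finB BL B(2)] by metis
  \<comment> \<open>Contraction pairs \<open>w\<close> with the first factor. With this sign,
    skewness makes the coefficient of \<open>b\<close> equal to
    \<open>ev (\<omega> b) (g w)\<close>, the coordinate of \<open>g w\<close> at
    \<open>b\<close>.\<close>
  define t where "t = (\<Sum>b\<in>B. (- g (\<omega> b)) \<otimes> b)"
  have wedge2_in_tensor_on: "t \<in> tensor_on L L"
    unfolding t_def using BL \<omega>(1) g complex_vector.subspace_neg[OF L_sub]
    by (intro complex_vector.subspace_sum[OF csubspace_tensor_on] tensor_onI) auto
  have contract_t: "contract t w = g w" if w: "w \<in> W" for w
  proof -
    obtain u where u: "g w = (\<Sum>b\<in>B. u b *\<^sub>C b)"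
      using gB[OF w] complex_vector.span_finite[OF finB] by auto
    have "ev (\<omega> b) (g w) = u b" if b: "b \<in> B" for b
    proof -
      have "ev (\<omega> b) (g w) = (\<Sum>b'\<in>B. u b' * ev (\<omega> b) b')"
        using \<omega>(1)[OF b] unfolding u
        by (simp add: complex_vector_pair.linear_sum[OF clinear_ev] ev_linear)
      also have "\<dots> = (\<Sum>b'\<in>B. if b = b' then u b' else 0)"
        using \<omega>(2)[OF b] by (intro sum.cong) auto
      finally show ?thesis using b finB by simp
    qed
    then have "ev w (- g (\<omega> b)) = u b" if "b \<in> B" for b
      using that \<omega>(1)[OF that] w skew[of w "\<omega> b"]
      by (simp add: complex_vector_pair.linear_neg[OF clinear_ev])
    then show ?thesis
      unfolding t_def u using w
      by (simp add: complex_vector_pair.linear_sum[OF clinear_contract] contract_pure)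
  qed
  have "tensor_swap t + t = 0"
  proof (rule pair2_nondeg[OF W])
    have "tensor_swap t = (\<Sum>b\<in>B. b \<otimes> (- g (\<omega> b)))"
      by (simp add: t_def complex_vector_pair.linear_sum[OF clinear_tensor_swap] tensor_swap_pure)
    then have "tensor_swap t \<in> tensor_on L L"
      using BL \<omega>(1) g complex_vector.subspace_neg[OF L_sub]
      by (auto intro!: complex_vector.subspace_sum[OF csubspace_tensor_on] tensor_onI)
    then show "tensor_swap t + t \<in> tensor_on L L"
      using wedge2_in_tensor_on complex_vector.subspace_add[OF csubspace_tensor_on] by blast
    fix v w assume vw: "v \<in> W" "w \<in> W"
    then have "pair2 w v t + pair2 v w t = 0"
      using skew[OF vw] by (simp add: pair2_contract contract_t)
    then show "pair2 v w (tensor_swap t + t) = 0"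
      using vw by (simp add: pair2_linear pair2_swap)
  qed
  then have t: "t \<in> wedge2 L" using wedge2_in_tensor_on by (simp add: wedge2_def eq_neg_iff_add_eq_0)
  moreover have "V = twist W t"
  proof
    show "twist W t \<subseteq> V" using g by (auto simp: twist_def contract_t)
    show "V \<subseteq> twist W t"
    proof
      fix v assume v: "v \<in> V"
      then obtain x w where xw: "x \<in> L" "w \<in> W" "v = d x + w" using complement_decomp[OF W, of v] by auto
      \<comment> \<open>\<open>v\<close> and the point of the graph over its component in
        \<open>W\<close> differ by a diagonal element of \<open>V\<close>, which is zero.\<close>
      have "d (x - g w) = v - (w + d (g w))" using xw by (simp add: d_linear)
      moreover have "v - (w + d (g w)) \<in> V"
        using v g(2)[OF complement_in_R[OF W xw(2)]]
          complex_vector.subspace_diff[OF complement_subspace[OF V]] by blast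
      moreover have "x - g w \<in> L"
        using g[of w] xw complex_vector.subspace_diff[OF L_sub] by simp
      ultimately have "x - g w = 0" using complement_inter[OF V] by metis
      then have "v = w + d (contract t w)" using xw contract_t by simp
      then show "v \<in> twist W t" using xw(2) by (auto simp: twist_def)
    qed
  qed
  ultimately show thesis by (rule that)
qed

end

section \<open>Loop algebras\<close>

lemma dagger_add: "dagger (f + g) = dagger f + dagger (g :: 'g::lie_algebra laurent)"
  by (rule poly_mapping_eqI) (simp add: dagger.rep_eq lookup_add)

lemma dagger_scaleC: "dagger (c *\<^sub>C f) = c *\<^sub>C dagger (f :: 'g::lie_algebra laurent)"
  by (rule poly_mapping_eqI) (simp add: dagger.rep_eq lookup_scaleC)

lemma dagger_single: "dagger (Poly_Mapping.single k a) = Poly_Mapping.single (- k) (a :: 'g::lie_algebra)"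
  by (rule poly_mapping_eqI) (auto simp: dagger.rep_eq lookup_single when_def)

lemma dagger_zero: "dagger 0 = (0 :: 'g::lie_algebra laurent)"
  by (rule poly_mapping_eqI) (simp add: dagger.rep_eq)

lemma dagger_bracket: "dagger (bracket f g) = bracket (dagger f) (dagger (g :: 'g::lie_algebra laurent))"
proof (induction f rule: poly_mapping_additive_induct)
  case (2 k a)
  show ?case
    by (induction g rule: poly_mapping_additive_induct)
      (simp_all add: dagger_zero dagger_single bracket_poly_mapping_single dagger_add bracket_add_right)
qed (simp_all add: dagger_zero dagger_add bracket_add_left)

lemma clinear_diag_embed: "clinear diag_embed"
  by (rule clinearI) (simp_all add: diag_embed_def dagger_add dagger_scaleC scaleC_prod_def)

lemma diag_embed_bracket: "diag_embed (bracket f g) = bracket (diag_embed f) (diag_embed g)"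
  by (simp add: diag_embed_def bracket_prod_def dagger_bracket)

lemma inj_diag_embed: "inj diag_embed"
  by (rule injI) (simp add: diag_embed_def)

lemma lookup_bracket_single:
  "Poly_Mapping.lookup (bracket (Poly_Mapping.single k a) f) j =
     bracket a (Poly_Mapping.lookup (f :: 'g::lie_algebra laurent) (j - k))"
  by (induction f rule: poly_mapping_additive_induct)
    (auto simp: bracket_poly_mapping_single lookup_single when_def lookup_add bracket_add_right)

text \<open>The centre is an ideal, and a proper one because a simple algebra is not
  abelian.\<close>

lemma simple_lie_algebra_centre:
  assumes "simple_lie_algebra (UNIV :: 'g::lie_algebra set)" "\<And>a. bracket a x = (0 :: 'g)"
  shows "x = 0"
proof -
  let ?Z = "{x :: 'g. \<forall>a. bracket a x = 0}"
  have "lie_ideal ?Z UNIV"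
    by (auto simp: lie_ideal_def complex_vector.subspace_def bracket_add_right bracket_scaleC_right)
  then have "?Z = {0} \<or> ?Z = UNIV" using assms(1) by (simp add: simple_lie_algebra_def)
  moreover have "?Z \<noteq> UNIV" using assms(1) by (auto simp: simple_lie_algebra_def)
  ultimately show ?thesis using assms(2) by blast
qed

section \<open>Roots of unity, homogeneous components and adjoint orbits\<close>

lemma unity_root_power: "unity_root m ^ j = cis (2 * pi * real j / real m)"
  by (simp add: unity_root_def cis_conv_exp exp_of_nat_mult[symmetric] mult_ac)

lemma unity_root_power_neq_1:
  assumes "0 < j" "j < m"
  shows "unity_root m ^ j \<noteq> 1"
proof
  have inj: "inj_on (\<lambda>k. cis (2 * pi * real k / real m)) {..<m}"
    using bij_betw_roots_unity[of m] assms by (simp add: bij_betw_def)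
  assume "unity_root m ^ j = 1"
  then have "j = 0" using assms by (intro inj_onD[OF inj]) (simp_all add: unity_root_power)
  then show False using assms by simp
qed

lemma unity_root_power_order: "0 < m \<Longrightarrow> unity_root m ^ m = 1"
  by (simp add: unity_root_power)

text \<open>\<open>m a\<close> is the sum of its isotypic components \<open>\<Sum>\<^sub>j \<epsilon>\<^sup>-\<^sup>j\<^sup>k \<sigma>\<^sup>j a\<close> of degrees \<open>k = K, \<dots>, K + m - 1\<close>.\<close>

lemma bracket_eq_0_if_high_grades:
  fixes \<sigma> :: "'g::lie_algebra \<Rightarrow> 'g"
  assumes "lie_automorphism \<sigma>" "has_order \<sigma> m"
    and high: "\<And>k a. K \<le> k \<Longrightarrow> a \<in> grade \<sigma> m (int k) \<Longrightarrow> bracket a x = 0"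
  shows "bracket a x = 0"
proof -
  have lin: "clinear \<sigma>" and m: "0 < m" "\<sigma> ^^ m = id"
    using assms by (auto simp: lie_automorphism_def has_order_def)
  let ?z = "unity_root m"
  define c where "c = inverse ?z"
  have z: "?z \<noteq> 0" by (simp add: unity_root_def)
  have c: "c ^ m = 1" "\<And>j. 0 < j \<Longrightarrow> j < m \<Longrightarrow> c ^ j \<noteq> 1"
    using unity_root_power_order[OF m(1)] unity_root_power_neq_1[of _ m]
    by (simp_all add: c_def power_inverse)
  define P where "P k = (\<Sum>j<m. (c ^ k) ^ j *\<^sub>C (\<sigma> ^^ j) a)" for k
  have P: "P k \<in> grade \<sigma> m (int k)" for k
  proof -
    define G where "G j = (c ^ k) ^ j *\<^sub>C (\<sigma> ^^ j) a" for j
    have "(c ^ k) ^ m = 1" using c(1) by (metis power_mult mult.commute power_one)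
    \<comment> \<open>Periodicity lets \<open>\<sigma>\<close> permute the summands cyclically, up
      to the eigenvalue.\<close>
    then have "G m = G 0" using m by (simp add: G_def)
    have shift: "\<sigma> (G j) = ?z ^ k *\<^sub>C G (Suc j)" for j
      using z by (simp add: G_def complex_vector_pair.linear_scale[OF lin] c_def
          power_inverse field_simps)
    have "\<sigma> (P k) = (\<Sum>j<m. ?z ^ k *\<^sub>C G (Suc j))"
      unfolding P_def G_def[symmetric] by (simp add: complex_vector_pair.linear_sum[OF lin] shift)
    also have "\<dots> = ?z ^ k *\<^sub>C (\<Sum>j<m. G (Suc j))" by (simp add: complex_vector.scale_sum_right)
    also have "(\<Sum>j<m. G (Suc j)) = (\<Sum>j<m. G j)"
      using sum.lessThan_Suc_shift[of G m] sum.lessThan_Suc[of G m] \<open>G m = G 0\<close>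
      by (simp add: add.commute)
    finally show ?thesis by (simp add: grade_def P_def G_def)
  qed
  have P0: "bracket (P (K + i)) x = 0" for i by (rule high[OF le_add1 P])
  \<comment> \<open>Exchanging the sums leaves, for each \<open>j\<close>, a geometric sum over a
    full period, which vanishes unless \<open>j = 0\<close>.\<close>
  have "(\<Sum>i<m. P (K + i)) = (\<Sum>j<m. (\<Sum>i<m. (c ^ (K + i)) ^ j) *\<^sub>C (\<sigma> ^^ j) a)"
    unfolding P_def by (subst sum.swap) (simp add: complex_vector.scale_sum_left)
  also have "\<dots> = (\<Sum>j<m. if j = 0 then of_nat m *\<^sub>C a else 0)"
  proof (intro sum.cong refl)
    fix j assume "j \<in> {..<m}"
    show "(\<Sum>i<m. (c ^ (K + i)) ^ j) *\<^sub>C (\<sigma> ^^ j) a = (if j = 0 then of_nat m *\<^sub>C a else 0)"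
    proof (cases "j = 0")
      case False
      then have "c ^ j \<noteq> 1" using c(2) \<open>j \<in> {..<m}\<close> by simp
      have "(c ^ j) ^ m = 1" using c(1) by (metis power_mult mult.commute power_one)
      then have "(\<Sum>i<m. (c ^ j) ^ i) = 0"
        using \<open>c ^ j \<noteq> 1\<close> by (simp add: geometric_sum)
      moreover have "(c ^ (K + i)) ^ j = (c ^ K) ^ j * (c ^ j) ^ i" for i
        by (metis power_add power_mult power_mult_distrib mult.commute)
      ultimately have "(\<Sum>i<m. (c ^ (K + i)) ^ j) = 0"
        by (simp add: sum_distrib_left[symmetric])
      then show ?thesis using False by simp
    qed simp
  qed
  also have "\<dots> = of_nat m *\<^sub>C a" using m(1) by simp
  finally have "of_nat m *\<^sub>C bracket a x = (\<Sum>i<m. bracket (P (K + i)) x)"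
    by (metis bracket_scaleC_left bracket_sum_left)
  then have "of_nat m *\<^sub>C bracket a x = 0" using P0 by simp
  then show ?thesis using m(1) by (simp add: complex_vector.scale_eq_0_iff)
qed

lemma loop_algebra_single:
  assumes "lie_automorphism \<sigma>" "a \<in> grade \<sigma> m k"
  shows "Poly_Mapping.single k a \<in> loop_algebra \<sigma> m"
proof -
  have "\<sigma> 0 = 0"
    using assms(1) complex_vector_pair.linear_0 by (auto simp: lie_automorphism_def)
  then show ?thesis
    using assms(2) by (auto simp: loop_algebra_def lookup_single when_def grade_def)
qed

text \<open>Bracketing with an element of large degree moves \<open>x\<close> out of the degrees occurring in \<open>S\<close>.\<close>

lemma loop_algebra_adjoint_orbit_infinite:
  fixes \<sigma> :: "'g::lie_algebra \<Rightarrow> 'g"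
  assumes simple: "simple_lie_algebra (UNIV :: 'g set)"
    and \<sigma>: "lie_automorphism \<sigma>" "has_order \<sigma> m"
    and S: "finite S" and orbit: "\<forall>a\<in>loop_algebra \<sigma> m. bracket a x \<in> cspan S"
  shows "x = 0"
proof -
  have "finite (\<Union>s\<in>insert x S. Poly_Mapping.keys s)" using S by simp
  then have "bdd_above (abs ` (\<Union>s\<in>insert x S. Poly_Mapping.keys s))"
    by (intro bdd_above_finite finite_imageI)
  \<comment> \<open>\<open>N\<close> bounds the absolute degrees occurring in \<open>x\<close> and
    in \<open>S\<close>.\<close>
  then obtain N where "\<forall>j\<in>abs ` (\<Union>s\<in>insert x S. Poly_Mapping.keys s). j \<le> N"
    by (auto simp only: bdd_above_def)
  then have N: "Poly_Mapping.lookup s j = 0" if "s \<in> insert x S" "N < \<bar>j\<bar>" for s j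
    using that by (force simp: in_keys_iff)
  have "cspan S \<subseteq> {u. \<forall>j>N. Poly_Mapping.lookup u j = 0}"
    using N by (intro complex_vector.span_minimal)
      (auto simp: complex_vector.subspace_def lookup_add lookup_scaleC)
  then have span: "Poly_Mapping.lookup u j = 0" if "u \<in> cspan S" "N < j" for u j
    using that by auto
  have "Poly_Mapping.lookup x j = 0" for j
  proof (cases "j < - N")
    case True
    then show ?thesis using N by simp
  next
    case False
    \<comment> \<open>As \<open>j\<close> is at least \<open>- N\<close>, the bound on
      \<open>k\<close> puts \<open>j + k\<close> above \<open>N\<close>, where elements of the span
      of \<open>S\<close> have zero coefficient.\<close>
    have "bracket a (Poly_Mapping.lookup x j) = 0"
      if k: "nat (2 * N) + 1 \<le> k" and a: "a \<in> grade \<sigma> m (int k)" for k a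
    proof -
      have "bracket (Poly_Mapping.single (int k) a) x \<in> cspan S"
        using orbit loop_algebra_single[OF \<sigma>(1) a] by blast
      moreover have "N < j + int k" using False k by linarith
      ultimately show ?thesis using span lookup_bracket_single[of "int k" a x "j + int k"] by simp
    qed
    then show ?thesis
      using simple_lie_algebra_centre[OF simple] bracket_eq_0_if_high_grades[OF \<sigma>] by blast
  qed
  then show ?thesis by (intro poly_mapping_eqI) simp
qed

section \<open>Twists of the standard Manin triple of a loop algebra\<close>

theorem theorem4p1:
  fixes \<sigma> :: "'g::lie_algebra \<Rightarrow> 'g" and m :: nat and Np H Nm :: "'g set"
    and \<delta> :: "'g laurent \<Rightarrow> ('g laurent, 'g laurent) tensor"
  assumes "finite_dimensional (UNIV :: 'g set)"
    and "simple_lie_algebra (UNIV :: 'g set)"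
    and "lie_automorphism \<sigma>"
    and "has_order \<sigma> m"
    and "triangular_decomposition (grade \<sigma> m 0) Np H Nm"
    and "standard_cobracket \<sigma> m Np H Nm \<delta>"
  shows
    "(\<forall>t \<in> wedge2 (loop_algebra \<sigma> m).
        lie_subalgebra (twisted_complement \<sigma> m Np H Nm t) (double_algebra \<sigma> m) \<longleftrightarrow>
        lie_bialgebra (loop_algebra \<sigma> m) (twisted_cobracket \<delta> t)) \<and>
     bij_betw (twisted_complement \<sigma> m Np H Nm)
       {t \<in> wedge2 (loop_algebra \<sigma> m). lie_bialgebra (loop_algebra \<sigma> m) (twisted_cobracket \<delta> t)}
       (MT (double_algebra \<sigma> m) double_form (diagonal \<sigma> m) (standard_complement \<sigma> m Np H Nm)) \<and>
     (\<forall>t \<in> wedge2 (loop_algebra \<sigma> m).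
        lie_bialgebra (loop_algebra \<sigma> m) (twisted_cobracket \<delta> t) \<longrightarrow>
        determined_by_manin_triple (double_algebra \<sigma> m) double_form (diagonal \<sigma> m)
          (twisted_complement \<sigma> m Np H Nm t) (diag_cobracket (twisted_cobracket \<delta> t)))"
proof -
  let ?L = "loop_algebra \<sigma> m" and ?R = "double_algebra \<sigma> m" and ?W = "standard_complement \<sigma> m Np H Nm"
  have bialg: "lie_bialgebra ?L \<delta>"
    and manin: "manin_triple ?R double_form (diag_embed ` ?L) ?W"
    and det: "\<And>a v w. a \<in> ?L \<Longrightarrow> v \<in> ?W \<Longrightarrow> w \<in> ?W \<Longrightarrow>
      tensor_form ?R double_form (diag_tensor (\<delta> a)) (v \<otimes> w) = double_form (diag_embed a) (bracket v w)"
    using assms(6)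
    by (auto simp: standard_cobracket_def determined_by_manin_triple_def diagonal_def
        diag_cobracket_def diag_embed_def)
  \<comment> \<open>The double, its form and the isotropy of the diagonal are read off the standard
    Manin triple, which \<open>standard_cobracket\<close> includes.\<close>
  have M: "diag_embed x \<in> ?R" "y \<in> ?L \<Longrightarrow> double_form (diag_embed x) (diag_embed y) = 0" if "x \<in> ?L" for x y
    using manin that by (auto simp: manin_triple_def lie_subalgebra_def orthogonal_in_def)
  interpret isotropic_embedding ?L diag_embed ?R double_form
    unfolding isotropic_embedding_def
    using bialg manin
    by (intro conjI allI impI M clinear_diag_embed diag_embed_bracket inj_diag_embed)
      (simp_all add: lie_bialgebra_def manin_triple_def)
  have W: "lagrangian_complement ?W" and W_lie: "lie_subalgebra ?W ?R"
    using manin by (simp_all add: manin_triple_iff)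
  have \<delta>: "cobracket_dual_to ?W \<delta>"
    unfolding cobracket_dual_to_def
  proof (intro conjI ballI)
    show "linear_on ?L \<delta>" using bialg by (simp add: lie_bialgebra_def)
    show \<delta>_L: "\<delta> a \<in> tensor_on ?L ?L" if "a \<in> ?L" for a
      using bialg that by (simp add: lie_bialgebra_def wedge2_def)
    show "pair2 v w (\<delta> a) = double_form (diag_embed a) (bracket v w)"
      if "a \<in> ?L" "v \<in> ?W" "w \<in> ?W" for a v w
      using det[OF that] tensor_form_diag[OF \<delta>_L[OF that(1)] complement_in_R[OF W that(2)]
        complement_in_R[OF W that(3)]]
      by simp
  qed
  have tw: "twisted_complement \<sigma> m Np H Nm t = twist ?W t" if "t \<in> wedge2 ?L" for t
    using tensor_contract_diag[OF wedge2_in_tensor_on[OF that]] complement_in_R[OF W]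
    by (force simp: twisted_complement_def twist_def diagonal_def)
  have iff: "lie_subalgebra (twist ?W t) ?R \<longleftrightarrow> lie_bialgebra ?L (twisted_cobracket \<delta> t)"
    if "t \<in> wedge2 ?L" for t
    using lie_bialgebra_twist_iff[OF W W_lie \<delta> bialg that]
      loop_algebra_adjoint_orbit_infinite[OF assms(2-4)] by blast
  have manin_t: "manin_triple ?R double_form (diagonal \<sigma> m) (twist ?W t)"
    if "t \<in> wedge2 ?L" "lie_bialgebra ?L (twisted_cobracket \<delta> t)" for t
    using iff[OF that(1)] that(2) twist_lagrangian_complement[OF that(1) W]
    by (simp add: diagonal_def manin_triple_iff)
  have "determined_by_manin_triple ?R double_form (diagonal \<sigma> m) (twist ?W t)
      (diag_cobracket (twisted_cobracket \<delta> t))"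
    if t: "t \<in> wedge2 ?L" and b: "lie_bialgebra ?L (twisted_cobracket \<delta> t)" for t
    unfolding determined_by_manin_triple_def
  proof (intro conjI ballI)
    fix a v w assume a: "a \<in> diagonal \<sigma> m" and vw: "v \<in> twist ?W t" "w \<in> twist ?W t"
    then obtain x where x: "x \<in> ?L" "a = diag_embed x" by (auto simp: diagonal_def)
    note dual = twist_cobracket_dual[OF t W \<delta>]
    have "tensor_form ?R double_form (diag_cobracket (twisted_cobracket \<delta> t) a) (v \<otimes> w)
      = pair2 v w (twisted_cobracket \<delta> t x)"
      using tensor_form_diag[of "twisted_cobracket \<delta> t x" v w] x vw dual
        complement_in_R[OF twist_lagrangian_complement[OF t W]]
      by (simp add: cobracket_dual_to_def diag_cobracket_def diag_embed_def)
    then show "tensor_form ?R double_form (diag_cobracket (twisted_cobracket \<delta> t) a) (v \<otimes> w) =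
        double_form a (bracket v w)"
      using dual x vw by (simp add: cobracket_dual_to_def)
  qed (rule manin_t[OF t b])
  moreover have "bij_betw (twisted_complement \<sigma> m Np H Nm)
     {t \<in> wedge2 ?L. lie_bialgebra ?L (twisted_cobracket \<delta> t)} (MT ?R double_form (diagonal \<sigma> m) ?W)"
    unfolding bij_betw_def
  proof
    show "inj_on (twisted_complement \<sigma> m Np H Nm)
        {t \<in> wedge2 ?L. lie_bialgebra ?L (twisted_cobracket \<delta> t)}"
      using twist_inj[OF W] by (auto intro!: inj_onI simp: tw)
    show "twisted_complement \<sigma> m Np H Nm `
        {t \<in> wedge2 ?L. lie_bialgebra ?L (twisted_cobracket \<delta> t)} = MT ?R double_form (diagonal \<sigma> m) ?W"
    proof (intro equalityI subsetI)
      fix V assume "V \<in> MT ?R double_form (diagonal \<sigma> m) ?W"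
      then have V: "lagrangian_complement V" "lie_subalgebra V ?R" "commensurable V ?W"
        by (auto simp: MT_def diagonal_def manin_triple_iff)
      \<comment> \<open>Commensurability yields \<open>t\<close>; by \<open>iff\<close>, closure of
        \<open>V\<close> under the bracket makes its twisted cobracket a bialgebra
        structure.\<close>
      obtain t where "t \<in> wedge2 ?L" "V = twist ?W t" using twist_surj[OF W V(1,3)] .
      then show "V \<in> twisted_complement \<sigma> m Np H Nm `
          {t \<in> wedge2 ?L. lie_bialgebra ?L (twisted_cobracket \<delta> t)}"
        using iff V(2) tw by blast
    qed (use manin_t twist_commensurable[OF W] in \<open>auto simp: MT_def tw\<close>)
  qed
  ultimately show ?thesis using tw iff by simp
qed

end
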